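(* Let $\omega=(\omega_k)_{k\in\mathbb{Z}}$ be a sequence of i.i.d. exponential random variables with mean $1$, and let $(\eta(t))_{t\in\mathbb{Z}_{\ge0}}$ be the coupled process, i.e. the Markov chain on $\mathcal{A}_n$ whose step from $t$ to $t+1$ is $$\eta(t+1)=\bigl(D(\eta^1(t),\omega),D(\eta^2(t),\omega),\dots,D(\eta^n(t),\omega)\bigr),$$ with a driving sequence $\omega$ that at each step is a fresh copy independent of everything before. (i) (Invariance.) Let $\rho=(\rho_1,\dots,\rho_n)\in(1,\infty)^n$. Then the probability measure $\mu^\rho$ is invariant for the Markov chain $(\eta(t))_{t\in\mathbb{Z}_{\ge0}}$. (ii) (Uniqueness.) Let $\widetilde\mu$ be a translation-ergodic probability measure on $\mathcal{A}_n$ under which the coordinates $\eta^i_k$ have finite means $\rho_i=E^{\widetilde\mu}[\eta^i_k]>1$. If $\widetilde\mu$ is invariant for the process $\eta(t)$, then $\widetilde\mu=\mu^\rho$ for $\rho=(\rho_1,\dots,\rho_n)\in(1,\infty)^n$.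
   Context: State space: $\mathcal{A}_n$ is the set of $I=(I^1,\dots,I^n)\in(\mathbb{R}_{\ge0}^{\mathbb{Z}})^n$ such that for each $i\in\{1,\dots,n\}$ the limit $\lim_{m\to-\infty}\frac1{|m|}\sum_{k=m}^0I^i_k$ exists and is $>1$. Translations act by $(\theta_\ell\eta)^i_k=\eta^i_{k+\ell}$; a probability measure is translation-ergodic if it is invariant under all $\theta_\ell$ and gives probability $0$ or $1$ to every Borel set invariant under $\{\theta_\ell\}_{\ell\in\mathbb{Z}}$. Queueing map. For $I,\omega\in\mathbb{R}_{\ge0}^{\mathbb{Z}}$ with $\lim_{m\to-\infty}\sum_{i=m}^0(\omega_i-I_{i+1})=-\infty$, choose any $G:\mathbb{Z}\to\mathbb{R}$ with $I_k=G_k-G_{k-1}$, put $\widetilde G_\ell=\sup_{k\le\ell}\{G_k+\sum_{i=k}^\ell\omega_i\}$, and define $D(I,\omega)=(\widetilde G_\ell-\widetilde G_{\ell-1})_{\ell\in\mathbb{Z}}$ (independent of the choice of $G$). Let $D^{(1)}(\zeta)=\zeta$ and $D^{(m)}(\zeta^1,\dots,\zeta^m)=D\bigl(D^{(m-1)}(\zeta^1,\dots,\zeta^{m-1}),\zeta^m\bigr)$ for $m\ge2$. For $I=(I^1,\dots,I^m)$ let $\mathcal{D}^{(m)}(I)=(\eta^1,\dots,\eta^m)$ with $\eta^i=D^{(i)}(I^i,I^{i-1},\dots,I^1)$. For $\sigma\in(0,\infty)^m$, $\nu^\sigma$ is the law of $I=(I^1,\dots,I^m)$ with all coordinates $I^i_k$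 independent and $I^i_k$ exponential with mean $\sigma_i$. Definition of $\mu^\rho$ for $\rho\in(0,\infty)^n$. (1) If $0<\rho_1<\dots<\rho_n$, $\mu^\rho$ is the law of $\mathcal{D}^{(n)}(I)$ with $I\sim\nu^\rho$. (2) If $0<\rho_1\le\dots\le\rho_n$, there are $m\in\{1,\dots,n\}$, $\sigma=(\sigma_1,\dots,\sigma_m)$ with $0<\sigma_1<\dots<\sigma_m$, and indices $1=i_1<i_2<\dots<i_m<i_{m+1}=n+1$ with $\rho_{i_\ell}=\dots=\rho_{i_{\ell+1}-1}=\sigma_\ell$ for $\ell=1,\dots,m$. Let $I\sim\nu^\sigma$, $\zeta=\mathcal{D}^{(m)}(I)$, and set $\eta^{i_\ell}=\dots=\eta^{i_{\ell+1}-1}=\zeta^\ell$ for $\ell=1,\dots,m$; $\mu^\rho$ is the law of $\eta=(\eta^1,\dots,\eta^n)$. (3) For general $\rho\in(0,\infty)^n$, choose a permutation $\pi$ such that $\pi\rho=(\rho_{\pi(1)},\dots,\rho_{\pi(n)})$ is nondecreasing, and let $\mu^\rho$ be the measure under which $(\eta^{\pi(1)},\dots,\eta^{\pi(n)})$ has law $\mu^{\pi\rho}$ as defined in (2). A probability measure $\mu$ is invariant for the chain if $\eta(0)\sim\mu$ independent of $\omega$ implies $\eta(1)\sim\mu$. *)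

theory Defs
  imports "HOL-Probability.Probability" "HOL-Combinatorics.Permutations"
begin

section \<open>Configurations and translations\<close>

type_synonym seq = "int \<Rightarrow> real"

text \<open>Component \<open>i\<close> of an \<open>n\<close>-type configuration is used for \<open>i \<in> {1..n}\<close> only; as usual for
  \<^const>\<open>PiM\<close>, configurations are \<^const>\<open>undefined\<close> at the other indices.\<close>

type_synonym config = "nat \<Rightarrow> seq"

definition config_space :: "nat \<Rightarrow> config measure" where
  "config_space n = (\<Pi>\<^sub>M i\<in>{1..n}. \<Pi>\<^sub>M k\<in>(UNIV :: int set). (borel :: real measure))"

definition state_space :: "nat \<Rightarrow> config set" where
  "state_space n = {I \<in> space (config_space n). \<forall>i\<in>{1..n}.
     (\<forall>k. 0 \<le> I i k) \<and>
     (\<exists>L>1. ((\<lambda>m::int. (\<Sum>k=m..0. I i k) / real_of_int \<bar>m\<bar>) \<longlongrightarrow> L) at_bot)}"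

text \<open>A probability measure on the state space is represented as a probability measure on the
  Borel sets of the surrounding product space that gives full mass to the state space.  The chain
  below leaves the state space only on a null set of driving sequences, so its laws live
  naturally on the surrounding space.\<close>

definition prob_on_states :: "nat \<Rightarrow> config measure \<Rightarrow> bool" where
  "prob_on_states n \<mu> \<longleftrightarrow>
     prob_space \<mu> \<and> sets \<mu> = sets (config_space n) \<and> (AE \<eta> in \<mu>. \<eta> \<in> state_space n)"

definition translate :: "nat \<Rightarrow> int \<Rightarrow> config \<Rightarrow> config" where
  "translate n l \<eta> = (\<lambda>i\<in>{1..n}. \<lambda>k. \<eta> i (k + l))"

definition translation_ergodic :: "nat \<Rightarrow> config measure \<Rightarrow> bool" where
  "translation_ergodic n \<mu> \<longleftrightarrow>
     (\<forall>l. distr \<mu> (config_space n) (translate n l) = \<mu>) \<and>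
     (\<forall>B\<in>sets (config_space n).
        (\<forall>l. translate n l -` B \<inter> space (config_space n) = B) \<longrightarrow>
        measure \<mu> B = 0 \<or> measure \<mu> B = 1)"


section \<open>The queueing map\<close>

definition queue_stable :: "seq \<Rightarrow> seq \<Rightarrow> bool" where
  "queue_stable I \<omega> \<longleftrightarrow>
     filterlim (\<lambda>m::int. \<Sum>i=m..0. \<omega> i - I (i + 1)) at_bot at_bot"

definition last_passage :: "seq \<Rightarrow> seq \<Rightarrow> seq" where
  "last_passage G \<omega> l = (SUP k\<in>{..l}. G k + (\<Sum>i=k..l. \<omega> i))"

text \<open>The choice of \<open>G\<close> does not matter, see \<open>queue_map_eq\<close> below.\<close>

definition queue_map :: "seq \<Rightarrow> seq \<Rightarrow> seq" where
  "queue_map I \<omega> =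
     (if queue_stable I \<omega>
      then let G = (SOME G. \<forall>k. I k = G k - G (k - 1))
           in (\<lambda>l. last_passage G \<omega> l - last_passage G \<omega> (l - 1))
      else undefined)"

text \<open>\<open>queue_iter m \<zeta>\<close> is \<open>D\<^sup>(\<^sup>m\<^sup>)(\<zeta>\<^sup>1, \<dots>, \<zeta>\<^sup>m)\<close>; the value at \<open>m = 0\<close> is irrelevant.\<close>

fun queue_iter :: "nat \<Rightarrow> config \<Rightarrow> seq" where
  "queue_iter 0 \<zeta> = undefined"
| "queue_iter (Suc 0) \<zeta> = \<zeta> 1"
| "queue_iter (Suc (Suc m)) \<zeta> = queue_map (queue_iter (Suc m) \<zeta>) (\<zeta> (Suc (Suc m)))"

text \<open>The arguments enter in reversed order: component \<open>i\<close> is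
  \<open>D\<^sup>(\<^sup>i\<^sup>)(I\<^sup>i, I\<^sup>i\<^sup>-\<^sup>1, \<dots>, I\<^sup>1)\<close>.\<close>

definition multi_queue :: "nat \<Rightarrow> config \<Rightarrow> config" where
  "multi_queue m I = (\<lambda>i\<in>{1..m}. queue_iter i (\<lambda>j. I (i + 1 - j)))"


section \<open>The multiclass measures\<close>

text \<open>\<^const>\<open>exponential_density\<close> takes the rate, i.e. the reciprocal of the mean.\<close>

definition exp_seq :: "real \<Rightarrow> seq measure" where
  "exp_seq s = (\<Pi>\<^sub>M k\<in>(UNIV :: int set). density lborel (exponential_density (1 / s)))"

definition exp_config :: "nat \<Rightarrow> (nat \<Rightarrow> real) \<Rightarrow> config measure" where
  "exp_config m \<sigma> = (\<Pi>\<^sub>M i\<in>{1..m}. exp_seq (\<sigma> i))"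

text \<open>\<open>blocks n \<rho> m \<sigma> b\<close>: the nondecreasing vector \<open>\<rho>\<close> consists of \<open>m\<close> maximal constant blocks
  with values \<open>\<sigma> 1 < \<dots> < \<sigma> m\<close>, the \<open>l\<close>-th one occupying the indices \<open>b l, \<dots>, b (l + 1) - 1\<close>.\<close>

definition blocks :: "nat \<Rightarrow> (nat \<Rightarrow> real) \<Rightarrow> nat \<Rightarrow> (nat \<Rightarrow> real) \<Rightarrow> (nat \<Rightarrow> nat) \<Rightarrow> bool" where
  "blocks n \<rho> m \<sigma> b \<longleftrightarrow>
     m \<in> {1..n} \<and> 0 < \<sigma> 1 \<and> strict_mono_on {1..m} \<sigma> \<and>
     b 1 = 1 \<and> b (m + 1) = n + 1 \<and> strict_mono_on {1..m + 1} b \<and>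
     (\<forall>l\<in>{1..m}. \<forall>j\<in>{b l..<b (l + 1)}. \<rho> j = \<sigma> l)"

definition expand_blocks :: "nat \<Rightarrow> nat \<Rightarrow> (nat \<Rightarrow> nat) \<Rightarrow> config \<Rightarrow> config" where
  "expand_blocks n m b \<zeta> = (\<lambda>j\<in>{1..n}. \<zeta> (THE l. l \<in> {1..m} \<and> j \<in> {b l..<b (l + 1)}))"

text \<open>The measure for strictly increasing \<open>\<rho>\<close> is the special case \<open>m = n\<close>, \<open>\<sigma> = \<rho>\<close>, \<open>b l = l\<close>
  of the one for nondecreasing \<open>\<rho>\<close>, so it needs no clause of its own.\<close>

definition multiclass_sorted :: "nat \<Rightarrow> (nat \<Rightarrow> real) \<Rightarrow> config measure" where
  "multiclass_sorted n \<rho> =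
     (let (m, \<sigma>, b) = (SOME (m, \<sigma>, b). blocks n \<rho> m \<sigma> b)
      in distr (exp_config m \<sigma>) (config_space n) (\<lambda>I. expand_blocks n m b (multi_queue m I)))"

text \<open>If \<open>\<xi>\<close> has the law for the sorted vector \<open>\<rho> \<circ> \<pi>\<close>, then \<open>\<eta>\<close> given by \<open>\<eta> (\<pi> j) = \<xi> j\<close>,
  i.e. \<open>\<eta> i = \<xi> (inv \<pi> i)\<close>, has the law for \<open>\<rho>\<close>.\<close>

definition multiclass_measure :: "nat \<Rightarrow> (nat \<Rightarrow> real) \<Rightarrow> config measure" where
  "multiclass_measure n \<rho> =
     (let \<pi> = (SOME \<pi>. \<pi> permutes {1..n} \<and> mono_on {1..n} (\<rho> \<circ> \<pi>))
      in distr (multiclass_sorted n (\<rho> \<circ> \<pi>)) (config_space n)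
           (\<lambda>\<xi>. \<lambda>i\<in>{1..n}. \<xi> (inv \<pi> i)))"


section \<open>The coupled process\<close>

primrec coupled_process :: "nat \<Rightarrow> config \<Rightarrow> (nat \<Rightarrow> seq) \<Rightarrow> nat \<Rightarrow> config" where
  "coupled_process n \<eta> w 0 = \<eta>"
| "coupled_process n \<eta> w (Suc t) = (\<lambda>i\<in>{1..n}. queue_map (coupled_process n \<eta> w t i) (w t))"

text \<open>The canonical probability space of the chain: an initial state with law \<open>\<mu>\<close> and an
  independent family of driving sequences, one for each time step, which are independent of each
  other and whose entries are i.i.d. exponential with mean 1.\<close>

definition chain_space :: "config measure \<Rightarrow> (config \<times> (nat \<Rightarrow> seq)) measure" where
  "chain_space \<mu> = \<mu> \<Otimes>\<^sub>M (\<Pi>\<^sub>M t\<in>(UNIV :: nat set). exp_seq 1)"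

definition invariant_measure :: "nat \<Rightarrow> config measure \<Rightarrow> bool" where
  "invariant_measure n \<mu> \<longleftrightarrow>
     prob_on_states n \<mu> \<and>
     distr (chain_space \<mu>) (config_space n) (\<lambda>(\<eta>, w). coupled_process n \<eta> w 1) = \<mu>"


section \<open>Independence of the choice of the primitive\<close>

lemma primitive_exists: "\<exists>G::seq. \<forall>k. I k = G k - G (k - 1)"
proof (intro exI allI)
  fix k :: int
  let ?G = "\<lambda>k. if 0 \<le> k then \<Sum>i=1..k. I i else - (\<Sum>i=k+1..0. I i)"
  show "I k = ?G k - ?G (k - 1)"
  proof (cases "0 < k")
    case True
    then have "{1..k} = insert k {1..k-1}" by auto
    with True show ?thesis by simp
  next
    case False
    then have "{k..0} = insert k {k+1..0}" by auto
    with False show ?thesis by simp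
  qed
qed

lemma primitive_unique:
  fixes G H :: seq
  assumes "\<And>k. G k - G (k - 1) = H k - H (k - 1)"
  shows "H k = G k + (H 0 - G 0)"
proof (induction k rule: int_induct[where k = 0])
  case (step1 i)
  then show ?case using assms[of "i + 1"] by simp
next
  case (step2 i)
  then show ?case using assms[of i] by simp
qed simp

lemma stable_bdd_above:
  assumes "queue_stable I \<omega>" and G: "\<And>k. I k = G k - G (k - 1)"
  shows "bdd_above ((\<lambda>k. G k + (\<Sum>i=k..l. \<omega> i)) ` {..l})"
proof -
  let ?f = "\<lambda>k. G k + (\<Sum>i=k..l. \<omega> i)"
  have eq: "?f k = G 1 + (\<Sum>i=k..0. \<omega> i - I (i + 1)) + ((\<Sum>i=k..l. \<omega> i) - (\<Sum>i=k..0. \<omega> i))"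
    if "k \<le> 0" for k
  proof -
    have "(\<Sum>i=k..0. I (i + 1)) = G 1 - G k" using that
    proof (induction k rule: int_le_induct)
      case base
      then show ?case using G[of 1] by simp
    next
      case (step i)
      then have "{i-1..0} = insert (i-1) {i..0}" by auto
      then show ?case using step G[of i] by simp
    qed
    then show ?thesis by (simp add: sum_subtractf)
  qed
  define c where "c = (\<Sum>i\<in>{1..l}. \<omega> i) - (\<Sum>i\<in>{l+1..0}. \<omega> i)"
  have c: "(\<Sum>i=k..l. \<omega> i) - (\<Sum>i=k..0. \<omega> i) = c" if "k \<le> 0" "k \<le> l" for k
  proof (cases "0 \<le> l")
    case True
    then have "{k..l} = {k..0} \<union> {1..l}" "{l+1..0} = {}" using that by auto
    then show ?thesis by (simp add: c_def sum.union_disjoint)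
  next
    case False
    then have "{k..0} = {k..l} \<union> {l+1..0}" "{1..l} = {}" using that by auto
    then show ?thesis by (simp add: c_def sum.union_disjoint)
  qed
  from assms(1) obtain M where M: "\<And>m. m \<le> M \<Longrightarrow> (\<Sum>i=m..0. \<omega> i - I (i + 1)) \<le> 0"
    unfolding queue_stable_def filterlim_at_bot eventually_at_bot_linorder by metis
  define M' where "M' = min M (min 0 l)"
  have "bdd_above (?f ` {..M'})"
  proof (rule bdd_aboveI2)
    fix k assume "k \<in> {..M'}"
    then show "?f k \<le> G 1 + c"
      using eq[of k] c[of k] M[of k] by (simp add: M'_def)
  qed
  moreover have "bdd_above (?f ` {M'..l})" by (intro bdd_above_finite) auto
  ultimately have "bdd_above (?f ` {..M'} \<union> ?f ` {M'..l})" by simp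
  moreover have "?f ` {..l} \<subseteq> ?f ` {..M'} \<union> ?f ` {M'..l}" by force
  ultimately show ?thesis by (rule bdd_above_mono)
qed

lemma queue_map_eq:
  assumes stable: "queue_stable I \<omega>" and G: "\<And>k. I k = G k - G (k - 1)"
  shows "queue_map I \<omega> = (\<lambda>l. last_passage G \<omega> l - last_passage G \<omega> (l - 1))"
proof -
  define H where "H = (SOME H :: seq. \<forall>k. I k = H k - H (k - 1))"
  have H: "I k = H k - H (k - 1)" for k
    using someI_ex[OF primitive_exists[of I]] unfolding H_def by blast
  define c where "c = H 0 - G 0"
  have Hc: "H k = c + G k" for k
    using primitive_unique[of G H k] G H by (simp add: c_def)
  have "last_passage H \<omega> l = c + last_passage G \<omega> l" for l
  proof -
    have "last_passage H \<omega> l = (SUP k\<in>{..l}. c + (G k + (\<Sum>i=k..l. \<omega> i)))"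
      by (simp add: last_passage_def Hc add.assoc)
    also have "\<dots> = c + (SUP k\<in>{..l}. G k + (\<Sum>i=k..l. \<omega> i))"
    proof (rule antisym)
      show "(SUP k\<in>{..l}. c + (G k + (\<Sum>i=k..l. \<omega> i))) \<le> c + (SUP k\<in>{..l}. G k + (\<Sum>i=k..l. \<omega> i))"
        by (intro cSUP_least add_left_mono cSUP_upper stable_bdd_above[OF stable G]) auto
      have bdd: "bdd_above ((\<lambda>k. c + (G k + (\<Sum>i=k..l. \<omega> i))) ` {..l})"
        using stable_bdd_above[OF stable H, of l] by (simp add: Hc add.assoc)
      have "(SUP k\<in>{..l}. G k + (\<Sum>i=k..l. \<omega> i)) \<le> (SUP k\<in>{..l}. c + (G k + (\<Sum>i=k..l. \<omega> i))) - c"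
      proof (rule cSUP_least)
        fix k assume "k \<in> {..l}"
        from cSUP_upper[OF this bdd]
        show "G k + (\<Sum>i=k..l. \<omega> i) \<le> (SUP k\<in>{..l}. c + (G k + (\<Sum>i=k..l. \<omega> i))) - c" by simp
      qed simp
      then show "c + (SUP k\<in>{..l}. G k + (\<Sum>i=k..l. \<omega> i)) \<le> (SUP k\<in>{..l}. c + (G k + (\<Sum>i=k..l. \<omega> i)))"
        by simp
    qed
    finally show ?thesis by (simp add: last_passage_def)
  qed
  then show ?thesis
    using stable by (simp add: queue_map_def Let_def flip: H_def)
qed

end

theory Submission
  imports Defs
begin

text \<open>Invariance.  Let the lines \<open>I\<^sup>1, \<dots>, I\<^sup>m\<close> be served one after the other: line \<open>1\<close> by \<open>\<omega>\<close>,
  and line \<open>i + 1\<close> by the dual service process \<open>min (I\<^sup>i\<^sub>k) (J\<^sup>i\<^sub>k\<^sub>-\<^sub>1)\<close> of line \<open>i\<close>, where \<open>J\<^sup>i\<close> is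
  the sojourn time.  By Burke's theorem the outputs are independent of each other and have the laws of
  the inputs, and since \<open>D (D X I) \<omega> = D (D X R) (D I \<omega>)\<close> for the dual service process \<open>R\<close> of
  \<open>(I, \<omega>)\<close>, the map \<open>\<D>\<^sup>(\<^sup>m\<^sup>)\<close> carries this process to the coupled process.  Burke's theorem itself
  holds because one step of the recursion for the sojourn time preserves a product of three
  exponential laws.

  Uniqueness.  Couple two invariant measures with the same means shift-invariantly, and run both
  with the same services.  The expected distance at a site drops by a loss, which is due to
  discrepancies of opposite signs that cancel.  For a coupling that almost minimises the distance
  the loss is almost zero.  But if \<open>\<omega>\<^sub>a\<close> is large, then all discrepancies of a window to the right
  of \<open>a\<close> cancel as far as their signs allow.  Hence in a typical window all discrepancies have the
  same sign, and by the law of large numbers their sum is small because the means agree.  So the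
  minimal distance is zero.\<close>

section \<open>Sample path properties of the queue\<close>

text \<open>The true queue has been running since minus infinity, while the one-step form of Burke's
  theorem concerns a recursion with a given start. Coalescence is the bridge: started at earlier and
  earlier times in its stationary law, whose rate is the service rate minus the arrival rate, the
  recursion eventually agrees with the true sojourn time on any fixed window. The interchange of two
  queues is a pathwise identity, valid where five queues are stable; that this happens almost surely
  rests on the independence of the three sequences that meet in each interchange. Stability asks for
  strictly ordered means, so equal means are realised by repeating a component. In the uniqueness
  part the couplings are shift-invariant but possibly not ergodic. Hence the laws of large numbers
  are applied to the marginals alone, and the loss is bounded below by the chance
  \<open>exp (- S)\<close> that one service exceeds the content \<open>S\<close> of a window.
  Near-minimisers stand in for a minimal coupling. The averages converge because the state space
  says so; ergodicity makes their limits constant, and truncation identifies these with the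
  means.\<close>

definition prim :: "seq \<Rightarrow> seq" where
  "prim I k = (if 0 \<le> k then \<Sum>i=1..k. I i else - (\<Sum>i=k+1..0. I i))"

lemma prim_step: "prim I k = prim I (k - 1) + I k"
proof (cases "0 < k")
  case True
  then have "{1..k} = insert k {1..k-1}" by auto
  with True show ?thesis by (simp add: prim_def)
next
  case False
  then have "{k..0} = insert k {k+1..0}" by auto
  with False show ?thesis by (simp add: prim_def)
qed

lemma prim_diff: "I k = prim I k - prim I (k - 1)"
  using prim_step[of I k] by simp

lemma sum_prim: "(\<Sum>i=k..k + int n. w i) = prim w (k + int n) - prim w (k - 1)"
proof (induction n)
  case 0
  then show ?case by (simp add: prim_step[of w k])
next
  case (Suc n)
  have "{k..k + int (Suc n)} = insert (k + int (Suc n)) {k..k + int n}" by auto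
  then show ?case using Suc prim_step[of w "k + int (Suc n)"] by simp
qed

lemma sum_prim': "k \<le> l + 1 \<Longrightarrow> (\<Sum>i=k..l. w i) = prim w l - prim w (k - 1)"
proof (cases "k = l + 1")
  case False
  assume "k \<le> l + 1"
  with False have "l = k + int (nat (l - k))" by simp
  then show ?thesis by (metis sum_prim)
qed simp

text \<open>For \<open>k \<le> l\<close>,
  \<open>prim I k + sum w {k..l} = prim w l + gap I w k\<close>. The dependence on \<open>l\<close>
  splits off, so the suprema in the last passage times become running maxima of one
  sequence.\<close>

definition gap :: "seq \<Rightarrow> seq \<Rightarrow> seq" where
  "gap I w j = prim I j - prim w (j - 1)"

lemma queue_stable_iff: "queue_stable I w \<longleftrightarrow> filterlim (gap I w) at_bot at_bot"
proof -
  have eq: "(\<Sum>i=m..0. w i - I (i + 1)) = gap I w m + (- I 1)" if "m \<le> 0" for m :: int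
  proof -
    have "(\<Sum>i=m..0. I (i + 1)) = (\<Sum>i=m+1..1. I i)"
      by (rule sum.reindex_bij_witness[of _ "\<lambda>i. i - 1" "\<lambda>i. i + 1"]) auto
    also have "\<dots> = prim I 1 - prim I m" using that by (simp add: sum_prim')
    finally show ?thesis
      using that by (simp add: sum_subtractf sum_prim' gap_def prim_def[of _ 0] prim_def[of _ 1])
  qed
  have ev: "\<forall>\<^sub>F m::int in at_bot. m \<le> 0" by (rule eventually_le_at_bot)
  have "queue_stable I w \<longleftrightarrow> filterlim (\<lambda>m. gap I w m + (- I 1)) at_bot at_bot"
    unfolding queue_stable_def
    by (rule filterlim_cong[OF refl refl], rule eventually_mono[OF ev]) (rule eq)
  also have "\<dots> \<longleftrightarrow> filterlim (gap I w) at_bot at_bot"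
  proof
    assume *: "filterlim (\<lambda>m. gap I w m + (- I 1)) at_bot at_bot"
    show "filterlim (gap I w) at_bot at_bot"
      unfolding filterlim_at_bot
    proof
      fix Z :: real
      from *[unfolded filterlim_at_bot, rule_format, of "Z - I 1"]
      show "\<forall>\<^sub>F x in at_bot. gap I w x \<le> Z" by eventually_elim simp
    qed
  next
    assume *: "filterlim (gap I w) at_bot at_bot"
    show "filterlim (\<lambda>m. gap I w m + (- I 1)) at_bot at_bot"
      unfolding filterlim_at_bot
    proof
      fix Z :: real
      from *[unfolded filterlim_at_bot, rule_format, of "Z + I 1"]
      show "\<forall>\<^sub>F x in at_bot. gap I w x + - I 1 \<le> Z" by eventually_elim simp
    qed
  qed
  finally show ?thesis .
qed

lemma queue_stable_gap_below:
  assumes "queue_stable I w"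
  shows "\<exists>M. \<forall>j\<le>M. gap I w j \<le> c"
  using assms unfolding queue_stable_iff filterlim_at_bot eventually_at_bot_linorder by blast

text \<open>The gaps tend to minus infinity on the left, so beyond a finite stretch they all lie
  below \<open>gap I w l\<close>.\<close>

lemma gap_attained:
  assumes "queue_stable I w"
  shows "\<exists>j\<le>l. \<forall>i\<le>l. gap I w i \<le> gap I w j"
proof -
  obtain M where M: "\<And>j. j \<le> M \<Longrightarrow> gap I w j \<le> gap I w l"
    using queue_stable_gap_below[OF assms] by blast
  let ?A = "gap I w ` {min M l..l}"
  have "Max ?A \<in> ?A" by (intro Max_in) auto
  then obtain j where j: "j \<in> {min M l..l}" "gap I w j = Max ?A" by force
  have "gap I w i \<le> gap I w j" if "i \<le> l" for i
  proof (cases "i \<le> M")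
    case True
    have "gap I w l \<le> Max ?A" by (intro Max_ge) auto
    with M True j(2) order.trans show ?thesis by metis
  next
    case False
    with that j(2) show ?thesis by (auto intro!: Max_ge)
  qed
  with j show ?thesis by auto
qed

text \<open>The detour through extended reals makes \<open>peak\<close> measurable on all pairs of sequences, the
  unstable ones included.\<close>

definition peak :: "seq \<Rightarrow> seq \<Rightarrow> seq" where
  "peak I w l = real_of_ereal (SUP j\<in>{..l}. ereal (gap I w j))"

lemma peak_eqI:
  assumes "j \<le> l" "\<And>i. i \<le> l \<Longrightarrow> gap I w i \<le> gap I w j"
  shows "peak I w l = gap I w j"
proof -
  have "(SUP j\<in>{..l}. ereal (gap I w j)) = ereal (gap I w j)"
    using assms by (intro SUP_eqI) auto
  then show ?thesis by (simp add: peak_def)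
qed

lemma gap_le_peak:
  assumes "queue_stable I w" "i \<le> l"
  shows "gap I w i \<le> peak I w l"
proof -
  obtain j where j: "j \<le> l" "\<forall>i\<le>l. gap I w i \<le> gap I w j" using gap_attained[OF assms(1)] by blast
  then have "peak I w l = gap I w j" by (intro peak_eqI) auto
  with j assms(2) show ?thesis by simp
qed

lemma peak_attained:
  assumes "queue_stable I w"
  obtains j where "j \<le> l" "peak I w l = gap I w j"
proof -
  obtain j where j: "j \<le> l" "\<forall>i\<le>l. gap I w i \<le> gap I w j" using gap_attained[OF assms(1)] by blast
  then have "peak I w l = gap I w j" by (intro peak_eqI) auto
  with j that show ?thesis by simp
qed

lemma peak_step:
  assumes "queue_stable I w"
  shows "peak I w l = max (peak I w (l - 1)) (gap I w l)"
proof (rule antisym)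
  obtain j where j: "j \<le> l" "peak I w l = gap I w j" by (rule peak_attained[OF assms])
  then show "peak I w l \<le> max (peak I w (l - 1)) (gap I w l)"
    using gap_le_peak[OF assms, of j "l - 1"] by (cases "j = l") auto
  obtain j where j: "j \<le> l - 1" "peak I w (l - 1) = gap I w j" by (rule peak_attained[OF assms])
  then show "max (peak I w (l - 1)) (gap I w l) \<le> peak I w l"
    using gap_le_peak[OF assms, of j l] gap_le_peak[OF assms, of l l] by auto
qed

lemma last_passage_peak:
  assumes "queue_stable I w"
  shows "last_passage (prim I) w l = prim w l + peak I w l"
proof -
  have eq: "prim I k + (\<Sum>i=k..l. w i) = prim w l + gap I w k" if "k \<le> l" for k
    using that by (simp add: sum_prim' gap_def)
  obtain j where j: "j \<le> l" "peak I w l = gap I w j" by (rule peak_attained[OF assms])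
  show ?thesis unfolding last_passage_def
  proof (rule cSup_eq_maximum)
    show "prim w l + peak I w l \<in> (\<lambda>k. prim I k + sum w {k..l}) ` {..l}"
      using j eq[of j] by (intro image_eqI[of _ _ j]) auto
    fix x assume "x \<in> (\<lambda>k. prim I k + sum w {k..l}) ` {..l}"
    then show "x \<le> prim w l + peak I w l" using eq gap_le_peak[OF assms] by auto
  qed
qed

text \<open>Written out, the supremum over \<open>k \<le> l\<close> of
  \<open>sum w {k..l} - sum I {k+1..l}\<close>: the time that customer \<open>l\<close> spends in a
  queue with interarrival times \<open>I\<close> and service times \<open>w\<close>.\<close>

definition sojourn :: "seq \<Rightarrow> seq \<Rightarrow> seq" where
  "sojourn I w l = peak I w l + prim w l - prim I l"

definition dual_service :: "seq \<Rightarrow> seq \<Rightarrow> seq" where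
  "dual_service I w = (\<lambda>k. min (I k) (sojourn I w (k - 1)))"

lemma sojourn_step:
  assumes "queue_stable I w"
  shows "sojourn I w k = w k + max 0 (sojourn I w (k - 1) - I k)"
  using peak_step[OF assms, of k] prim_step[of I k] prim_step[of w k]
  by (simp add: sojourn_def gap_def)

lemma queue_map_peak:
  assumes "queue_stable I w"
  shows "queue_map I w = (\<lambda>k. w k + (peak I w k - peak I w (k - 1)))"
proof
  fix k
  show "queue_map I w k = w k + (peak I w k - peak I w (k - 1))"
    using prim_step[of w k]
    by (simp add: queue_map_eq[OF assms, of "prim I", OF prim_diff] last_passage_peak[OF assms])
qed

text \<open>The time between two departures is a service time plus the idle time of the server
  before the arrival of customer \<open>k\<close>.\<close>

lemma queue_map_sojourn:
  assumes "queue_stable I w"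
  shows "queue_map I w k = w k + max 0 (I k - sojourn I w (k - 1))"
  using peak_step[OF assms, of k] prim_step[of I k] prim_step[of w k]
  by (simp add: queue_map_peak[OF assms] sojourn_def gap_def)

lemma sojourn_ge:
  assumes "queue_stable I w"
  shows "w k \<le> sojourn I w k"
  by (simp add: sojourn_step[OF assms, of k])

section \<open>The sojourn time recursion with a finite start\<close>

primrec lindley :: "seq \<Rightarrow> seq \<Rightarrow> real \<Rightarrow> int \<Rightarrow> nat \<Rightarrow> real" where
  "lindley I w x s 0 = x"
| "lindley I w x s (Suc n) =
     w (s + int n + 1) + max 0 (lindley I w x s n - I (s + int n + 1))"

text \<open>Up to centring, the recursion is a running maximum of gaps. A start far to the left
  contributes a value below the largest gap up to \<open>k0\<close>, so the start is forgotten by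
  time \<open>k0\<close>.\<close>

lemma lindley_coalesces:
  assumes st: "queue_stable I w" and w: "\<And>k. 0 \<le> w k"
  shows "\<exists>s0. \<forall>s\<le>s0. \<forall>n. k0 \<le> s + int n \<longrightarrow> lindley I w x s n = sojourn I w (s + int n)"
proof -
  obtain j0 where j0: "j0 \<le> k0" "peak I w k0 = gap I w j0" by (rule peak_attained[OF st])
  obtain M where M: "\<And>j. j \<le> M \<Longrightarrow> gap I w j \<le> gap I w j0 - x"
    using queue_stable_gap_below[OF st] by blast
  \<comment> \<open>The centring that relates \<open>sojourn\<close> to \<open>peak\<close>; it
    turns the recursion into a running maximum.\<close>
  define Q where "Q s n = lindley I w x s n - prim w (s + int n) + prim I (s + int n)" for s n
  have Q_Suc: "Q s (Suc n) = max (Q s n) (gap I w (s + int (Suc n)))" for s n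
    using prim_step[of I "s + int n + 1"] prim_step[of w "s + int n + 1"]
    by (simp add: Q_def gap_def add_ac)
  have Q_0: "Q s 0 \<le> gap I w j0" if "s \<le> M" for s
    using M[OF that] prim_step[of w s] w[of s] by (simp add: Q_def gap_def)
  have upper: "Q s n \<le> max (gap I w j0) (peak I w (s + int n))" if "s \<le> M" for s n
  proof (induction n)
    case (Suc n)
    have "Q s (Suc n) \<le> max (max (gap I w j0) (peak I w (s + int n))) (gap I w (s + int (Suc n)))"
      using Suc Q_Suc[of s n] by auto
    also have "\<dots> = max (gap I w j0) (peak I w (s + int (Suc n)))"
      using peak_step[OF st, of "s + int (Suc n)"] by (simp add: max.assoc)
    finally show ?case .
  qed (use Q_0[OF that] in auto)
  have lower: "gap I w (s + int i) \<le> Q s n" if "0 < i" "i \<le> n" for s i n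
    using that by (induction n) (auto simp: Q_Suc le_Suc_eq simp del: of_nat_Suc)
  \<comment> \<open>\<open>s \<le> M\<close> keeps the initial value of \<open>Q\<close> below the
    maximum, and \<open>s < j0\<close> makes the maximiser \<open>j0\<close> one of the sites
    visited after the start.\<close>
  have "lindley I w x s n = sojourn I w (s + int n)"
    if s: "s \<le> min M (j0 - 1)" and n: "k0 \<le> s + int n" for s n
  proof -
    define n0 where "n0 = nat (k0 - s)"
    have n0: "s + int n0 = k0" using s j0(1) by (simp add: n0_def)
    have base: "Q s n0 = peak I w k0"
    proof (rule antisym)
      show "Q s n0 \<le> peak I w k0" using upper[of s n0] s n0 j0(2) by simp
      show "peak I w k0 \<le> Q s n0"
        using lower[of "nat (j0 - s)" n0 s] s n0 j0 by simp
    qed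
    have "Q s (n0 + m) = peak I w (k0 + int m)" for m
    proof (induction m)
      case 0
      then show ?case using base by simp
    next
      case (Suc m)
      have "s + int (Suc (n0 + m)) = k0 + int (Suc m)" using n0 by simp
      from Q_Suc[of s "n0 + m", unfolded this] show ?case
        using Suc peak_step[OF st, of "k0 + int (Suc m)"] by simp
    qed
    moreover have "k0 + int (n - n0) = s + int n" "n0 + (n - n0) = n" using n n0 by auto
    ultimately have "Q s n = peak I w (s + int n)" by metis
    then show ?thesis by (simp add: Q_def sojourn_def)
  qed
  then show ?thesis by blast
qed

section \<open>Behaviour under translations\<close>

definition shift :: "seq \<Rightarrow> seq" where
  "shift z = (\<lambda>k. z (k + 1))"

lemma prim_shift: "prim (shift I) k = prim I (k + 1) - I 1"
proof -
  have "prim I (k + 1) - prim I (k - 1 + 1) = prim (shift I) k - prim (shift I) (k - 1)" for k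
    using prim_step[of I "k + 1"] prim_step[of "shift I" k] by (simp add: shift_def)
  from primitive_unique[of "\<lambda>k. prim I (k + 1)" "prim (shift I)", OF this, of k] show ?thesis
    by (simp add: prim_def[of _ 0] prim_def[of _ 1])
qed

text \<open>Since \<open>prim\<close> is normalised to vanish at 0, shifting both sequences adds a
  constant to all gaps; it cancels in sojourn times and outputs.\<close>

lemma gap_shift: "gap (shift I) (shift w) j = gap I w (j + 1) + (w 1 - I 1)"
  by (simp add: gap_def prim_shift)

lemma queue_stable_shift:
  assumes "queue_stable I w"
  shows "queue_stable (shift I) (shift w)"
  unfolding queue_stable_iff filterlim_at_bot eventually_at_bot_linorder
proof
  fix Z
  obtain M where "\<And>j. j \<le> M \<Longrightarrow> gap I w j \<le> Z - (w 1 - I 1)"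
    using queue_stable_gap_below[OF assms] by blast
  then show "\<exists>N. \<forall>n\<le>N. gap (shift I) (shift w) n \<le> Z"
    by (intro exI[of _ "M - 1"]) (simp add: gap_shift le_diff_eq)
qed

lemma peak_shift:
  assumes "queue_stable I w"
  shows "peak (shift I) (shift w) l = peak I w (l + 1) + (w 1 - I 1)"
proof -
  obtain j where j: "j \<le> l + 1" "peak I w (l + 1) = gap I w j" by (rule peak_attained[OF assms])
  have "peak (shift I) (shift w) l = gap (shift I) (shift w) (j - 1)"
    using j gap_le_peak[OF assms, of _ "l + 1"] by (intro peak_eqI) (auto simp: gap_shift)
  then show ?thesis using j by (simp add: gap_shift)
qed

lemma sojourn_shift:
  assumes "queue_stable I w"
  shows "sojourn (shift I) (shift w) = shift (sojourn I w)"
proof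
  show "sojourn (shift I) (shift w) k = shift (sojourn I w) k" for k
    unfolding sojourn_def peak_shift[OF assms] prim_shift by (simp add: shift_def sojourn_def)
qed

lemma queue_map_shift:
  assumes "queue_stable I w"
  shows "queue_map (shift I) (shift w) = shift (queue_map I w)"
  unfolding queue_map_peak[OF assms] queue_map_peak[OF queue_stable_shift[OF assms]]
    peak_shift[OF assms] by (simp add: shift_def)

section \<open>Interchangeability of queues\<close>

text \<open>Last passage value over the paths that collect \<open>a\<close> from \<open>k\<close> to
  some \<open>j\<close> and then \<open>b\<close> from \<open>j\<close> to \<open>l\<close>; the
  site \<open>j\<close> of the change is counted in both rows.\<close>

definition two_line :: "int \<Rightarrow> int \<Rightarrow> seq \<Rightarrow> seq \<Rightarrow> real" where
  "two_line k l a b = Max ((\<lambda>j. sum a {k..j} + sum b {j..l}) ` {k..l})"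

lemma two_line_base: "two_line k k a b = a k + b k"
  by (simp add: two_line_def)

lemma two_line_step:
  assumes "k \<le> l"
  shows "two_line k (l + 1) a b = b (l + 1) + max (two_line k l a b) (sum a {k..l + 1})"
proof -
  have 1: "{k..l + 1} = insert (l + 1) {k..l}" using assms by auto
  have 2: "sum b {j..l + 1} = b (l + 1) + sum b {j..l}" if "j \<in> {k..l}" for j
  proof -
    have "{j..l + 1} = insert (l + 1) {j..l}" using that by auto
    then show ?thesis by simp
  qed
  have "(\<lambda>j. sum a {k..j} + sum b {j..l + 1}) ` {k..l}
      = (\<lambda>y. b (l + 1) + y) ` (\<lambda>j. sum a {k..j} + sum b {j..l}) ` {k..l}"
    unfolding image_image by (rule image_cong) (auto simp: 2)
  moreover have "Max ((\<lambda>y. b (l + 1) + y) ` (\<lambda>j. sum a {k..j} + sum b {j..l}) ` {k..l})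
      = b (l + 1) + two_line k l a b"
    unfolding two_line_def using assms
    by (intro mono_Max_commute[symmetric]) (auto simp: mono_def)
  ultimately have 3: "Max ((\<lambda>j. sum a {k..j} + sum b {j..l + 1}) ` {k..l}) = b (l + 1)
      + two_line k l a b"
    by simp
  have "two_line k (l + 1) a b = Max (insert (sum a {k..l + 1} + sum b {l + 1..l + 1})
      ((\<lambda>j. sum a {k..j} + sum b {j..l + 1}) ` {k..l}))"
    unfolding two_line_def by (subst 1) simp
  also have "\<dots> = max (sum a {k..l + 1} + b (l + 1)) (b (l + 1) + two_line k l a b)"
    using assms by (subst Max_insert) (auto simp: 3)
  finally show ?thesis by (simp add: max_def)
qed

text \<open>Compare the queue \<open>J\<close> with the queue \<open>a\<close> that starts empty at time \<open>k\<close>.  Their difference does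
  not change before \<open>J\<close> idles for the first time, and vanishes afterwards.  This gives the
  dichotomy below, where \<open>U\<close> is the total idle time of \<open>J\<close>.\<close>

lemma two_line_interchange:
  assumes D: "\<And>i. D i = w i + max 0 (I i - J (i - 1))"
    and R: "\<And>i. R i = min (I i) (J (i - 1))"
    and J: "\<And>i. J i = w i + max 0 (J (i - 1) - I i)"
  shows "two_line k (k + int n) I w = two_line k (k + int n) R D"
proof -
  define a where "a n = two_line k (k + int n) I w - sum I {k..k + int n}" for n
  define U where "U n = sum I {k..k + int n} - sum R {k..k + int n}" for n
  have idx: "k + int (Suc n) = k + int n + 1" for n by simp
  have sum_Suc: "sum f {k..k + int (Suc n)} = sum f {k..k + int n} + f (k + int n + 1)"
    for f :: seq and n
  proof -
    have "{k..k + int (Suc n)} = insert (k + int n + 1) {k..k + int n}" by auto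
    then show ?thesis by simp
  qed
  have a_Suc: "a (Suc n) = w (k + int n + 1) + max 0 (a n - I (k + int n + 1))" for n
    using two_line_step[of k "k + int n" I w] sum_Suc[of I n] unfolding a_def idx by linarith
  have U_Suc: "U (Suc n) = U n + max 0 (I (k + int n + 1) - J (k + int n))" for n
    using R[of "k + int n + 1"] unfolding U_def sum_Suc by simp
  have inv: "(U n = 0 \<and> a n \<le> J (k + int n)) \<or> (0 \<le> U n \<and> a n = J (k + int n))" for n
  proof (induction n)
    case 0
    show ?case using R[of k] J[of k] by (auto simp: a_def U_def two_line_base)
  next
    case (Suc n)
    have "J (k + int (Suc n)) = w (k + int n + 1) + max 0 (J (k + int n) - I (k + int n + 1))"
      using J[of "k + int n + 1"] unfolding idx by simp
    with Suc show ?case unfolding a_Suc U_Suc by linarith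
  qed
  show ?thesis
  proof (induction n)
    case 0
    show ?case using D[of k] R[of k] by (simp add: two_line_base)
  next
    case (Suc n)
    let ?i = "k + int n + 1"
    have 1: "two_line k (k + int (Suc n)) I w = w ?i + max (two_line k (k + int n) I w) (sum I {k..k
        + int n} + I ?i)"
      using two_line_step[of k "k + int n" I w] sum_Suc[of I n] unfolding idx by simp
    have 2: "two_line k (k + int (Suc n)) R D = D ?i + max (two_line k (k + int n) R D) (sum R {k..k
        + int n} + R ?i)"
      using two_line_step[of k "k + int n" R D] sum_Suc[of R n] unfolding idx by simp
    have "sum R {k..k + int n} = sum I {k..k + int n} - U n" by (simp add: U_def)
    moreover have "two_line k (k + int n) I w = a n + sum I {k..k + int n}" by (simp add: a_def)
    moreover have "D ?i = w ?i + max 0 (I ?i - J (k + int n))" "R ?i = min (I ?i) (J (k + int n))"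
      using D[of ?i] R[of ?i] by auto
    ultimately show ?case unfolding 1 2 Suc[symmetric] using inv[of n] by linarith
  qed
qed

lemma queue_map_primitive:
  assumes "queue_stable X A" "\<And>k. X k = G k - G (k - 1)"
  shows "queue_map X A k = last_passage G A k - last_passage G A (k - 1)"
  using queue_map_eq[OF assms(1), of G] assms(2) by simp

text \<open>With the next lemma, this makes the last passage time through two queues in series the
  supremum over \<open>k \<le> l\<close> of \<open>G k + two_line k l A B\<close>. The services
  enter only through \<open>two_line\<close>.\<close>

lemma two_line_le_last_passage:
  assumes 1: "queue_stable X A" and 2: "queue_stable (queue_map X A) B"
    and G: "\<And>k. X k = G k - G (k - 1)" and "k \<le> l"
  shows "G k + two_line k l A B \<le> last_passage (last_passage G A) B l"
proof -
  have "two_line k l A B \<in> (\<lambda>j. sum A {k..j} + sum B {j..l}) ` {k..l}"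
    unfolding two_line_def using \<open>k \<le> l\<close> by (intro Max_in) auto
  then obtain j where j: "j \<in> {k..l}" "two_line k l A B = sum A {k..j} + sum B {j..l}" by auto
  have "G k + sum A {k..j} \<le> last_passage G A j"
    unfolding last_passage_def using j by (intro cSUP_upper[OF _ stable_bdd_above[OF 1 G]]) simp
  moreover have "last_passage G A j + sum B {j..l} \<le> last_passage (last_passage G A) B l"
    unfolding last_passage_def[of "last_passage G A"] using j
    by (intro cSUP_upper[OF _ stable_bdd_above[OF 2 queue_map_primitive[OF 1 G]]]) simp
  ultimately show ?thesis using j by simp
qed

lemma last_passage_two_line_le:
  assumes "\<And>k. k \<le> l \<Longrightarrow> G k + two_line k l A B \<le> c"
  shows "last_passage (last_passage G A) B l \<le> c"
proof -
  have "last_passage G A j \<le> c - sum B {j..l}" if "j \<le> l" for j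
    unfolding last_passage_def
  proof (rule cSUP_least)
    fix k assume k: "k \<in> {..j}"
    have "sum A {k..j} + sum B {j..l} \<le> two_line k l A B"
      unfolding two_line_def using k that by (intro Max_ge) auto
    then show "G k + sum A {k..j} \<le> c - sum B {j..l}" using assms[of k] k that by simp
  qed simp
  then show ?thesis
    unfolding last_passage_def[of "last_passage G A"] by (intro cSUP_least) (auto simp: le_diff_eq)
qed

text \<open>Both series of queues start from the same primitive of \<open>X\<close>, and
  \<open>two_line\<close> takes the same values on \<open>(I, w)\<close> as on the dual service and
  the output. So even the last passage times agree, not only their increments. The stability
  assumptions guarantee that every \<open>queue_map\<close> involved is the actual queue and not the
  default value.\<close>

theorem queue_map_interchange:
  assumes "queue_stable I w" "queue_stable X I" "queue_stable (queue_map X I) w"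
    and "queue_stable X (dual_service I w)"
    and "queue_stable (queue_map X (dual_service I w)) (queue_map I w)"
  shows "queue_map (queue_map X I) w = queue_map (queue_map X (dual_service I w)) (queue_map I w)"
proof -
  let ?R = "dual_service I w" and ?D = "queue_map I w"
  have two: "two_line k l I w = two_line k l ?R ?D" if "k \<le> l" for k l
  proof -
    have "two_line k (k + int (nat (l - k))) I w = two_line k (k + int (nat (l - k))) ?R ?D"
      by (rule two_line_interchange[where J = "sojourn I w"])
        (rule queue_map_sojourn[OF assms(1)] sojourn_step[OF assms(1)], simp add: dual_service_def,
         rule sojourn_step[OF assms(1)])
    with that show ?thesis by simp
  qed
  note le1 = two_line_le_last_passage[OF assms(2,3) prim_diff]
  note le2 = two_line_le_last_passage[OF assms(4,5) prim_diff]
  have eq: "last_passage (last_passage (prim X) I) w = last_passage (last_passage (prim X) ?R) ?D"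
  proof (rule ext, rule antisym)
    fix l
    show "last_passage (last_passage (prim X) I) w l \<le> last_passage (last_passage (prim X) ?R) ?D l"
      by (rule last_passage_two_line_le) (simp only: two le2)
    show "last_passage (last_passage (prim X) ?R) ?D l \<le> last_passage (last_passage (prim X) I) w l"
      by (rule last_passage_two_line_le) (simp only: two[symmetric] le1)
  qed
  show ?thesis
    unfolding queue_map_eq[OF assms(3) queue_map_primitive[OF assms(2) prim_diff]]
      queue_map_eq[OF assms(5) queue_map_primitive[OF assms(4) prim_diff]] eq ..
qed

section \<open>Measurability\<close>

abbreviation seq_space :: "seq measure" where
  "seq_space \<equiv> \<Pi>\<^sub>M k\<in>(UNIV :: int set). (borel :: real measure)"

abbreviation expo :: "real \<Rightarrow> real measure" where
  "expo s \<equiv> density lborel (exponential_density (1 / s))"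

lemma space_seq_space [simp]: "space seq_space = UNIV"
  by (simp add: space_PiM)

lemma measurable_seqI:
  assumes "\<And>k. (\<lambda>x. f x k) \<in> borel_measurable M"
  shows "f \<in> M \<rightarrow>\<^sub>M seq_space"
  using assms by (intro measurable_PiM_single') (auto simp: space_PiM)

lemma measurable_prim [measurable (raw)]:
  assumes [measurable]: "f \<in> M \<rightarrow>\<^sub>M seq_space"
  shows "(\<lambda>x. prim (f x) k) \<in> borel_measurable M"
  unfolding prim_def by measurable

lemma measurable_seq_sum [measurable (raw)]:
  assumes [measurable]: "f \<in> M \<rightarrow>\<^sub>M seq_space"
  shows "(\<lambda>x. sum (f x) A) \<in> borel_measurable M"
  by (rule borel_measurable_sum) measurable

lemma measurable_shift [measurable (raw)]:
  assumes [measurable]: "f \<in> M \<rightarrow>\<^sub>M seq_space"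
  shows "(\<lambda>x. shift (f x)) \<in> M \<rightarrow>\<^sub>M seq_space"
  unfolding shift_def by (rule measurable_seqI) measurable

lemma measurable_gap [measurable (raw)]:
  assumes [measurable]: "f \<in> M \<rightarrow>\<^sub>M seq_space" "g \<in> M \<rightarrow>\<^sub>M seq_space"
  shows "(\<lambda>x. gap (f x) (g x) k) \<in> borel_measurable M"
  unfolding gap_def by measurable

lemma measurable_peak [measurable (raw)]:
  assumes [measurable]: "f \<in> M \<rightarrow>\<^sub>M seq_space" "g \<in> M \<rightarrow>\<^sub>M seq_space"
  shows "(\<lambda>x. peak (f x) (g x) k) \<in> borel_measurable M"
  unfolding peak_def by measurable

lemma measurable_sojourn [measurable (raw)]:
  assumes [measurable]: "f \<in> M \<rightarrow>\<^sub>M seq_space" "g \<in> M \<rightarrow>\<^sub>M seq_space"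
  shows "(\<lambda>x. sojourn (f x) (g x) k) \<in> borel_measurable M"
  unfolding sojourn_def by measurable

lemma measurable_dual_service [measurable (raw)]:
  assumes [measurable]: "f \<in> M \<rightarrow>\<^sub>M seq_space" "g \<in> M \<rightarrow>\<^sub>M seq_space"
  shows "(\<lambda>x. dual_service (f x) (g x)) \<in> M \<rightarrow>\<^sub>M seq_space"
  unfolding dual_service_def by (rule measurable_seqI) measurable

lemma measurable_queue_stable [measurable (raw)]:
  assumes [measurable]: "f \<in> M \<rightarrow>\<^sub>M seq_space" "g \<in> M \<rightarrow>\<^sub>M seq_space"
  shows "Measurable.pred M (\<lambda>x. queue_stable (f x) (g x))"
proof -
  have eq: "queue_stable I w \<longleftrightarrow> (\<forall>n::nat. \<exists>N::int. \<forall>j. j \<le> N \<longrightarrow> gap I w j \<le> - real n)" for I w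
    unfolding queue_stable_iff filterlim_at_bot eventually_at_bot_linorder
  proof (intro iffI allI)
    fix Z :: real
    assume *: "\<forall>n::nat. \<exists>N::int. \<forall>j. j \<le> N \<longrightarrow> gap I w j \<le> - real n"
    obtain n :: nat where n: "- Z \<le> real n" using real_arch_simple by blast
    obtain N where "\<forall>j\<le>N. gap I w j \<le> - real n" using * by blast
    then have "\<forall>j\<le>N. gap I w j \<le> Z" using n by (auto intro: order_trans)
    then show "\<exists>N. \<forall>n\<le>N. gap I w n \<le> Z" by blast
  qed blast
  show ?thesis unfolding eq by measurable
qed

lemma measurable_queue_map [measurable (raw)]:
  assumes [measurable]: "f \<in> M \<rightarrow>\<^sub>M seq_space" "g \<in> M \<rightarrow>\<^sub>M seq_space"
  shows "(\<lambda>x. queue_map (f x) (g x)) \<in> M \<rightarrow>\<^sub>M seq_space"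
proof (rule measurable_seqI)
  fix k
  \<comment> \<open>On unstable pairs the map is the constant \<open>undefined\<close>, so it is
    measurable on all pairs of sequences and not just almost everywhere.\<close>
  have eq: "queue_map I w k = (if queue_stable I w then w k
      + (peak I w k - peak I w (k - 1)) else undefined k)"
    for I w
    by (cases "queue_stable I w") (auto simp: queue_map_peak, simp add: queue_map_def)
  show "(\<lambda>x. queue_map (f x) (g x) k) \<in> borel_measurable M" unfolding eq by measurable
qed

lemma measurable_queue_map_at [measurable (raw)]:
  assumes [measurable]: "f \<in> M \<rightarrow>\<^sub>M seq_space" "g \<in> M \<rightarrow>\<^sub>M seq_space"
  shows "(\<lambda>x. queue_map (f x) (g x) k) \<in> borel_measurable M"
  by (rule measurable_compose[OF measurable_queue_map[OF assms] measurable_component_singleton])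
      simp

lemma measurable_dual_service_at [measurable (raw)]:
  assumes [measurable]: "f \<in> M \<rightarrow>\<^sub>M seq_space" "g \<in> M \<rightarrow>\<^sub>M seq_space"
  shows "(\<lambda>x. dual_service (f x) (g x) k) \<in> borel_measurable M"
  by (rule measurable_compose[OF measurable_dual_service[OF assms] measurable_component_singleton])
      simp

section \<open>Laws of i.i.d. exponential sequences\<close>

lemma prob_space_expo: "0 < s \<Longrightarrow> prob_space (expo s)"
  by (rule prob_space_exponential_density) simp

lemma sets_exp_seq [measurable_cong]: "sets (exp_seq s) = sets seq_space"
  unfolding exp_seq_def by (intro sets_PiM_cong) auto

lemma space_exp_seq [simp]: "space (exp_seq s) = UNIV"
  by (simp add: exp_seq_def space_PiM)

lemma prob_space_exp_seq: "0 < s \<Longrightarrow> prob_space (exp_seq s)"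
  unfolding exp_seq_def by (intro prob_space_PiM prob_space_expo)

lemma measurable_seq_upd [measurable (raw)]:
  assumes [measurable]: "f \<in> M \<rightarrow>\<^sub>M seq_space" "g \<in> borel_measurable M"
  shows "(\<lambda>x. (f x)(k := g x)) \<in> M \<rightarrow>\<^sub>M seq_space"
  by (rule measurable_seqI) (auto simp: fun_upd_def)

text \<open>Redrawing the coordinate at \<open>k\<close> leaves the law unchanged and exposes it as
  a variable independent of every quantity that does not look at \<open>k\<close>. This is how
  single sites are integrated out below.\<close>

lemma nn_integral_exp_seq_resample:
  assumes s: "0 < s" and F [measurable]: "F \<in> borel_measurable seq_space"
  shows "(\<integral>\<^sup>+z. F z \<partial>exp_seq s) = (\<integral>\<^sup>+z. \<integral>\<^sup>+x. F (z(k := x)) \<partial>expo s \<partial>exp_seq s)"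
proof -
  interpret E: prob_space "expo s" by (rule prob_space_expo[OF s])
  interpret S: prob_space "exp_seq s" by (rule prob_space_exp_seq[OF s])
  interpret P: pair_sigma_finite "expo s" "exp_seq s" ..
  have *: "exp_seq s = distr (expo s \<Otimes>\<^sub>M exp_seq s) (exp_seq s) (\<lambda>(x, X). X(k := x))"
    using distr_pair_PiM_eq_PiM[of UNIV "\<lambda>_::int. expo s" k] prob_space_expo[OF s]
    by (simp add: exp_seq_def)
  have "(\<integral>\<^sup>+z. F z \<partial>exp_seq s) = (\<integral>\<^sup>+p. F ((snd p)(k := fst p)) \<partial>(expo s \<Otimes>\<^sub>M exp_seq s))"
    by (subst *, subst nn_integral_distr) (auto simp: split_beta')
  also have "\<dots> = (\<integral>\<^sup>+z. \<integral>\<^sup>+x. F (z(k := x)) \<partial>expo s \<partial>exp_seq s)"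
    by (subst P.nn_integral_snd[symmetric]) (auto simp: split_beta')
  finally show ?thesis .
qed

lemma nn_integral_exp_seq_shift:
  assumes s: "0 < s" and F [measurable]: "F \<in> borel_measurable seq_space"
  shows "(\<integral>\<^sup>+z. F (shift z) \<partial>exp_seq s) = (\<integral>\<^sup>+z. F z \<partial>exp_seq s)"
proof -
  have *: "exp_seq s = distr (exp_seq s) (exp_seq s) shift"
    using distr_PiM_reindex[of UNIV "\<lambda>_. expo s" "\<lambda>k::int. k + 1" UNIV] prob_space_expo[OF s]
    by (simp add: exp_seq_def shift_def[abs_def] inj_on_def restrict_def)
  have "(\<integral>\<^sup>+z. F z \<partial>exp_seq s) = (\<integral>\<^sup>+z. F z \<partial>distr (exp_seq s) (exp_seq s) shift)"
    using * by (rule arg_cong)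
  also have "\<dots> = (\<integral>\<^sup>+z. F (shift z) \<partial>exp_seq s)"
    by (intro nn_integral_distr) auto
  finally show ?thesis ..
qed

section \<open>The law of large numbers for exponential sequences\<close>

lemma AE_expo_nonneg: "AE x in expo s. 0 \<le> x"
  by (subst AE_density) (auto simp: exponential_density_def)

lemma AE_exp_seq_nonneg:
  assumes "0 < s"
  shows "AE z in exp_seq s. \<forall>k. 0 \<le> z k"
  unfolding AE_all_countable exp_seq_def
  by (intro allI AE_PiM_component) (auto simp: prob_space_expo assms AE_expo_nonneg)

lemma nn_integral_expo:
  assumes "f \<in> borel_measurable borel"
  shows "(\<integral>\<^sup>+x. f x \<partial>expo s) = (\<integral>\<^sup>+x. ennreal (exponential_density (1 / s) x) * f x \<partial>lborel)"
  using assms by (intro nn_integral_density) auto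

lemma nn_integral_expo_exp:
  assumes s: "0 < s" and t: "\<theta> * s < 1"
  shows "(\<integral>\<^sup>+x. ennreal (exp (\<theta> * x)) \<partial>expo s) = ennreal (1 / (1 - \<theta> * s))"
proof -
  \<comment> \<open>Exponential tilting: the density times \<open>exp (\<theta> * x)\<close> is a
    multiple of the exponential density with rate \<open>l\<close>.\<close>
  define l where "l = 1 / s - \<theta>"
  have l: "0 < l" using assms by (simp add: l_def field_simps)
  interpret prob_space "density lborel (exponential_density l)"
    by (rule prob_space_exponential_density[OF l])
  have eq: "exponential_density (1 / s) x * exp (\<theta> * x) = 1 / (1 - \<theta> * s) * exponential_density l x"
      for x
  proof -
    have "1 / s * exp (- x * (1 / s)) * exp (\<theta> * x) = 1 / s * exp (- x * l)"
      unfolding l_def mult.assoc exp_add[symmetric] by (simp add: algebra_simps)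
    moreover have "1 / s = 1 / (1 - \<theta> * s) * l" using assms by (simp add: l_def field_simps)
    ultimately show ?thesis by (simp add: exponential_density_def)
  qed
  have "(\<integral>\<^sup>+x. ennreal (exp (\<theta> * x)) \<partial>expo s)
      = (\<integral>\<^sup>+x. ennreal (exponential_density (1 / s) x * exp (\<theta> * x)) \<partial>lborel)"
    using s by (subst nn_integral_expo) (auto simp: ennreal_mult' exponential_density_nonneg)
  also have "\<dots> = (\<integral>\<^sup>+x. ennreal (1 / (1 - \<theta> * s)) * ennreal (exponential_density l x) \<partial>lborel)"
    unfolding eq using t by (intro nn_integral_cong ennreal_mult') simp
  also have "\<dots> = ennreal (1 / (1 - \<theta> * s)) * emeasure (density lborel (exponential_density l)) UNIV"
    by (simp add: nn_integral_cmult emeasure_density)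
  finally show ?thesis using emeasure_space_1 by simp
qed

lemma nn_integral_exp_seq_component:
  assumes s: "0 < s" and [measurable]: "f \<in> borel_measurable borel"
  shows "(\<integral>\<^sup>+z. f (z k) \<partial>exp_seq s) = (\<integral>\<^sup>+x. f x \<partial>expo s)"
proof -
  interpret S: prob_space "exp_seq s" by (rule prob_space_exp_seq[OF s])
  show ?thesis by (subst nn_integral_exp_seq_resample[OF s, of _ k]) (auto simp:
      S.emeasure_space_1[simplified])
qed

lemma sum_neg_Suc: "(\<Sum>k=- int (Suc N)..0. f k) = f (- int (Suc N)) + (\<Sum>k=- int N..0. f k)"
proof -
  have "{- int (Suc N)..0} = insert (- int (Suc N)) {- int N..0}" by auto
  then show ?thesis by simp
qed

lemma nn_integral_exp_seq_sum:
  assumes s: "0 < s" and t: "\<theta> * s < 1"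
  shows "(\<integral>\<^sup>+z. ennreal (exp (\<theta> * (\<Sum>k=- int N..0. z k))) \<partial>exp_seq s)
    = ennreal ((1 / (1 - \<theta> * s)) ^ Suc N)"
proof (induction N)
  case 0
  show ?case
    using nn_integral_exp_seq_component[OF s, of
        "\<lambda>x. ennreal (exp (\<theta> * x))" 0] nn_integral_expo_exp[OF s t]
    by simp
next
  case (Suc N)
  let ?k = "- int (Suc N)"
  let ?S = "\<lambda>z::seq. \<Sum>k=- int N..0. z k"
  have S: "?S (z(?k := x)) = ?S z" for z x by (rule sum.cong) auto
  have "(\<integral>\<^sup>+z. ennreal (exp (\<theta> * (\<Sum>k=?k..0. z k))) \<partial>exp_seq s)
      = (\<integral>\<^sup>+z. \<integral>\<^sup>+x. ennreal (exp (\<theta> * ?S z)) * ennreal (exp (\<theta> * x)) \<partial>expo s \<partial>exp_seq s)"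
    unfolding sum_neg_Suc
    by (subst nn_integral_exp_seq_resample[OF s, of _ ?k], measurable)
      (intro nn_integral_cong, simp only: S fun_upd_same distrib_left exp_add ennreal_mult'[OF
          exp_ge_zero] mult.commute)
  also have "\<dots> = (\<integral>\<^sup>+z. ennreal (exp (\<theta> * ?S z)) * ennreal (1 / (1 - \<theta> * s)) \<partial>exp_seq s)"
    by (simp add: nn_integral_cmult nn_integral_expo_exp[OF s t])
  also have "\<dots> = ennreal ((1 / (1 - \<theta> * s)) ^ Suc N) * ennreal (1 / (1 - \<theta> * s))"
    by (subst nn_integral_multc) (simp_all add: Suc)
  also have "\<dots> = ennreal ((1 / (1 - \<theta> * s)) ^ Suc (Suc N))"
    using t by (subst ennreal_mult'[symmetric]) (simp_all add: mult.commute)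
  finally show ?case .
qed

text \<open>Averages along the sites \<open>- N\<close>, divided by the number of terms. By
  \<open>cesaro_iff_at_bot\<close> this is the limit in \<open>state_space\<close>, rewritten as the
  limit of an ordinary sequence.\<close>

definition cesaro :: "seq \<Rightarrow> real \<Rightarrow> bool" where
  "cesaro I L \<longleftrightarrow> (\<lambda>N. (\<Sum>k=- int N..0. I k) / real (Suc N)) \<longlonglongrightarrow> L"

text \<open>A Chernoff bound with the optimal exponent \<open>\<theta> = 1 / s - 1 / c\<close>, whose sign is that of
  \<open>c - s\<close>, so that both tails are covered.\<close>

lemma AE_exp_seq_chernoff:
  assumes s: "0 < s" and c: "0 < c" "c \<noteq> s"
  shows "AE z in exp_seq s. \<forall>\<^sub>F N in sequentially.
    (1 / s - 1 / c) * ((\<Sum>k=- int N..0. z k) - real (Suc N) * c) < 0"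
proof -
  define \<theta> where "\<theta> = 1 / s - 1 / c"
  \<comment> \<open>The mean of \<open>exp (\<theta> * (x - c))\<close> for one exponential variable
    \<open>x\<close>. It is below 1 because \<open>ln\<close> lies strictly below its tangent at 1,
    taken at \<open>c / s\<close>, which differs from 1.\<close>
  define q where "q = exp (- \<theta> * c) * (1 / (1 - \<theta> * s))"
  have t: "1 - \<theta> * s = s / c" using s c by (simp add: \<theta>_def field_simps)
  have t1: "\<theta> * s < 1" using t s c by (metis diff_gt_0_iff_gt divide_pos_pos)
  have q0: "0 \<le> q" using s c by (simp add: q_def t)
  have "ln q = ln (c / s) - (c / s - 1)"
    using s c by (simp add: q_def t ln_mult ln_div \<theta>_def field_simps)
  moreover have "ln (c / s) < c / s - 1"
    using ln_le_minus_one[of "c / s"] ln_eq_minus_one[of "c / s"] s c by (auto simp: less_le)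
  moreover have "0 < q" using s c by (simp add: q_def t)
  ultimately have q1: "q < 1" using ln_less_zero_iff[of q] by linarith
  define g where "g N z = exp (\<theta> * ((\<Sum>k=- int N..0. z k) - real (Suc N) * c))" for N and z :: seq
  have [measurable]: "g N \<in> borel_measurable seq_space" for N unfolding g_def by measurable
  have g: "(\<integral>\<^sup>+z. ennreal (g N z) \<partial>exp_seq s) = ennreal (q ^ Suc N)" for N
  proof -
    have "g N z = exp (- \<theta> * c) ^ Suc N * exp (\<theta> * (\<Sum>k=- int N..0. z k))" for z
      unfolding g_def exp_of_nat_mult[symmetric] exp_add[symmetric] by (simp add: algebra_simps)
    then have "(\<integral>\<^sup>+z. ennreal (g N z) \<partial>exp_seq s)
        = ennreal (exp (- \<theta> * c) ^ Suc N) * (\<integral>\<^sup>+z. ennreal (exp (\<theta> * (\<Sum>k=- int N..0. z k))) \<partial>exp_seq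
            s)"
      by (subst nn_integral_cmult[symmetric]) (auto simp: ennreal_mult')
    also have "\<dots> = ennreal (q ^ Suc N)"
      unfolding nn_integral_exp_seq_sum[OF s t1] q_def power_mult_distrib
      by (rule ennreal_mult'[symmetric]) simp
    finally show ?thesis .
  qed
  \<comment> \<open>The expectations of \<open>g N\<close> are summable, so almost surely
    \<open>g N\<close> tends to 0; and \<open>g N z < 1\<close> says precisely that the exponent is
    negative.\<close>
  have "(\<integral>\<^sup>+z. (\<Sum>N. ennreal (g N z)) \<partial>exp_seq s) = (\<Sum>N. ennreal (q ^ Suc N))"
    by (subst nn_integral_suminf) (auto simp: g)
  also have "\<dots> < \<infinity>"
  proof -
    have "summable (\<lambda>N. q ^ Suc N)" using q0 q1 by (simp add: summable_geometric)
    then show ?thesis using q0 by (simp add: ennreal_suminf_neq_top less_top)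
  qed
  finally have "AE z in exp_seq s. (\<Sum>N. ennreal (g N z)) \<noteq> \<infinity>"
    by (intro nn_integral_noteq_infinite) auto
  then show ?thesis
  proof eventually_elim
    case (elim z)
    have "summable (\<lambda>N. g N z)"
      by (rule summable_suminf_not_top) (use elim in \<open>auto simp: g_def\<close>)
    then have "(\<lambda>N. g N z) \<longlonglongrightarrow> 0" by (rule summable_LIMSEQ_zero)
    then have "\<forall>\<^sub>F N in sequentially. g N z < 1" by (rule order_tendstoD) simp
    then show ?case by (simp add: g_def \<theta>_def)
  qed
qed

lemma AE_exp_seq_cesaro:
  assumes s: "0 < s"
  shows "AE z in exp_seq s. cesaro z s"
proof -
  \<comment> \<open>Rational levels suffice to squeeze the limit, and keep the exceptional sets
    countable in number.\<close>
  have "AE z in exp_seq s. \<forall>c\<in>\<rat>. 0 < c \<and> c \<noteq> s \<longrightarrow> (\<forall>\<^sub>F N in sequentially.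
    (1 / s - 1 / c) * ((\<Sum>k=- int N..0. z k) - real (Suc N) * c) < 0)"
    by (subst AE_ball_countable[OF countable_rat])
      (use AE_exp_seq_chernoff[OF s] in \<open>auto simp del: of_nat_Suc\<close>)
  then show ?thesis
  proof eventually_elim
    case (elim z)
    show ?case unfolding cesaro_def
    proof (rule order_tendstoI)
      fix a assume "a < s"
      then obtain c where c: "c \<in> \<rat>" "max a (s / 2) < c" "c < s"
        using Rats_dense_in_real[of "max a (s / 2)" s] s by auto
      with s have c0: "0 < c" by simp
      have "1 / s - 1 / c < 0" using c c0 s by (simp add: field_simps)
      with elim c c0 have "\<forall>\<^sub>F N in sequentially. (\<Sum>k=- int N..0. z k) - real (Suc N) * c > 0"
        by (auto simp: mult_less_0_iff simp del: of_nat_Suc elim!: eventually_mono)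
      then show "\<forall>\<^sub>F N in sequentially. a < (\<Sum>k=- int N..0. z k) / real (Suc N)"
      proof eventually_elim
        case (elim N)
        then have "c < (\<Sum>k=- int N..0. z k) / real (Suc N)" by (simp add: field_simps)
        with c show ?case by simp
      qed
    next
      fix a assume "s < a"
      then obtain c where c: "c \<in> \<rat>" "s < c" "c < a"
        using Rats_dense_in_real[of s a] s by auto
      with s have c0: "0 < c" by simp
      have "1 / s - 1 / c > 0" using c c0 s by (simp add: field_simps)
      with elim c c0 have "\<forall>\<^sub>F N in sequentially. (\<Sum>k=- int N..0. z k) - real (Suc N) * c < 0"
        by (auto simp: mult_less_0_iff simp del: of_nat_Suc elim!: eventually_mono)
      then show "\<forall>\<^sub>F N in sequentially. (\<Sum>k=- int N..0. z k) / real (Suc N) < a"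
      proof eventually_elim
        case (elim N)
        then have "(\<Sum>k=- int N..0. z k) / real (Suc N) < c" by (simp add: field_simps)
        with c show ?case by simp
      qed
    qed
  qed
qed

lemma cesaro_unique: "cesaro I a \<Longrightarrow> cesaro I b \<Longrightarrow> a = b"
  unfolding cesaro_def by (rule LIMSEQ_unique)

lemma cesaro_iff_at_bot:
  "cesaro I L \<longleftrightarrow> ((\<lambda>m::int. (\<Sum>k=m..0. I k) / real_of_int \<bar>m\<bar>) \<longlongrightarrow> L) at_bot"
proof
  assume "cesaro I L"
  then have "(\<lambda>N. (\<Sum>k=- int N..0. I k) / real (Suc N) * (real (Suc N) / real N)) \<longlonglongrightarrow> L * 1"
    unfolding cesaro_def by (intro tendsto_mult LIMSEQ_Suc_n_over_n)
  moreover have "\<forall>\<^sub>F N in sequentially. (\<Sum>k=- int N..0. I k) / real (Suc N)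
      * (real (Suc N) / real N)
      = (\<Sum>k=- int N..0. I k) / real N"
    by (rule always_eventually) simp
  ultimately have 1: "(\<lambda>N. (\<Sum>k=- int N..0. I k) / real N) \<longlonglongrightarrow> L"
    using tendsto_cong by fastforce
  have "filterlim (\<lambda>m::int. nat (- m)) sequentially at_bot"
    unfolding filterlim_at_top eventually_at_bot_linorder
    by (intro allI, rule_tac x = "- int Z" in exI) auto
  from filterlim_compose[OF 1 this]
  have "((\<lambda>m. (\<Sum>k=- int (nat (- m))..0. I k) / real (nat (- m))) \<longlongrightarrow> L) at_bot" .
  moreover have "\<forall>\<^sub>F m in at_bot. (\<Sum>k=- int (nat (- m))..0. I k) / real (nat (- m))
      = (\<Sum>k=m..0. I k) / real_of_int \<bar>m\<bar>"
    by (rule eventually_mono[OF eventually_le_at_bot[of 0]]) auto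
  ultimately show "((\<lambda>m::int. (\<Sum>k=m..0. I k) / real_of_int \<bar>m\<bar>) \<longlongrightarrow> L) at_bot"
    using tendsto_cong by fastforce
next
  assume 1: "((\<lambda>m::int. (\<Sum>k=m..0. I k) / real_of_int \<bar>m\<bar>) \<longlongrightarrow> L) at_bot"
  have "filterlim (\<lambda>N. - int N) at_bot sequentially"
    unfolding filterlim_at_bot eventually_sequentially
    by (intro allI, rule_tac x = "nat (- Z)" in exI) auto
  from filterlim_compose[OF 1 this]
  have "(\<lambda>N. (\<Sum>k=- int N..0. I k) / real_of_int \<bar>- int N\<bar>) \<longlonglongrightarrow> L" .
  from tendsto_mult[OF this LIMSEQ_n_over_Suc_n]
  have "(\<lambda>N. (\<Sum>k=- int N..0. I k) / real_of_int \<bar>- int N\<bar> * (real N / real (Suc N))) \<longlonglongrightarrow> L" by simp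
  moreover have "\<forall>\<^sub>F N in sequentially. (\<Sum>k=- int N..0. I k) / real_of_int \<bar>- int N\<bar>
      * (real N / real (Suc N))
      = (\<Sum>k=- int N..0. I k) / real (Suc N)"
    by (rule eventually_mono[OF eventually_gt_at_top[of 0]]) auto
  ultimately show "cesaro I L" unfolding cesaro_def using tendsto_cong by fastforce
qed

lemma state_space_iff:
  "\<eta> \<in> state_space n \<longleftrightarrow> \<eta> \<in> space (config_space n) \<and>
    (\<forall>i\<in>{1..n}. (\<forall>k. 0 \<le> \<eta> i k) \<and> (\<exists>L>1. cesaro (\<eta> i) L))"
  by (simp add: state_space_def cesaro_iff_at_bot)

text \<open>The gap at \<open>- N\<close> is \<open>N + 1\<close> times an average that tends to
  \<open>b - a < 0\<close>, plus the single term \<open>I (- N)\<close>. That term is of smaller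
  order, because it is the difference of two consecutive partial sums with the same linear
  growth.\<close>

lemma cesaro_queue_stable:
  assumes I: "cesaro I a" and w: "cesaro w b" and "b < a"
  shows "queue_stable I w"
proof -
  define T where "T N = (\<Sum>k=- int N..0. w k - I k) / real (Suc N)" for N
  have T: "T \<longlonglongrightarrow> b - a"
    using tendsto_diff[OF w[unfolded cesaro_def] I[unfolded cesaro_def]]
    by (simp add: T_def[abs_def] sum_subtractf diff_divide_distrib)
  have gap_eq: "gap I w (- int N) = real (Suc N) * T N + I (- int N)" for N
    using sum_prim'[of "- int N" 0 I] sum_prim'[of "- int N" 0 w] prim_step[of I "- int N"]
    by (simp add: T_def sum_subtractf gap_def prim_def[of _ 0])
  have I0: "(\<lambda>N. I (- int N) / real (Suc N)) \<longlonglongrightarrow> 0"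
  proof -
    have eq: "I (- int (Suc N)) / real (Suc (Suc N))
        = (\<Sum>k=- int (Suc N)..0. I k) / real (Suc (Suc N))
        - (\<Sum>k=- int N..0. I k) / real (Suc N) * (real (Suc N) / real (Suc (Suc N)))" for N
      by (simp add: sum_neg_Suc add_divide_distrib del: of_nat_Suc)
    have "(\<lambda>N. (\<Sum>k=- int (Suc N)..0. I k) / real (Suc (Suc N))
        - (\<Sum>k=- int N..0. I k) / real (Suc N) * (real (Suc N) / real (Suc (Suc N)))) \<longlonglongrightarrow> a - a * 1"
      using LIMSEQ_Suc[OF I[unfolded cesaro_def]] LIMSEQ_Suc[OF LIMSEQ_n_over_Suc_n]
      by (intro tendsto_diff tendsto_mult I[unfolded cesaro_def])
    then have "(\<lambda>N. I (- int (Suc N)) / real (Suc (Suc N))) \<longlonglongrightarrow> 0" unfolding eq by simp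
    then show ?thesis by (rule LIMSEQ_imp_Suc)
  qed
  have "(\<lambda>N. T N + I (- int N) / real (Suc N)) \<longlonglongrightarrow> b - a + 0" by (intro tendsto_add T I0)
  then have "filterlim (\<lambda>N. (T N + I (- int N) / real (Suc N)) * real (Suc N)) at_bot sequentially"
    using \<open>b < a\<close>
    by (intro filterlim_tendsto_neg_mult_at_bot[OF _ _ filterlim_compose[OF
        filterlim_real_sequentially filterlim_Suc]]) auto
  moreover have "(T N + I (- int N) / real (Suc N)) * real (Suc N) = gap I w (- int N)" for N
    unfolding gap_eq by (simp add: field_simps del: of_nat_Suc)
  ultimately have 1: "filterlim (\<lambda>N. gap I w (- int N)) at_bot sequentially" by simp
  have 2: "filterlim (\<lambda>m::int. nat (- m)) sequentially at_bot"
    unfolding filterlim_at_top eventually_at_bot_linorder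
    by (intro allI, rule_tac x = "- int Z" in exI) auto
  have 3: "filterlim (\<lambda>m. gap I w (- int (nat (- m)))) at_bot at_bot"
    by (rule filterlim_compose[OF 1 2])
  have ev: "\<forall>\<^sub>F m::int in at_bot. m \<le> 0" by (rule eventually_le_at_bot)
  have "filterlim (\<lambda>m. gap I w (- int (nat (- m)))) at_bot at_bot
      \<longleftrightarrow> filterlim (gap I w) at_bot at_bot"
    by (rule filterlim_cong[OF refl refl], rule eventually_mono[OF ev]) auto
  with 3 show ?thesis by (simp add: queue_stable_iff)
qed

lemma sum_shift: "(\<Sum>k=- int (Suc N)..0. shift I k) = (\<Sum>k=- int N..0. I k) + I 1"
proof -
  have "(\<Sum>k=- int (Suc N)..0. shift I k) = (\<Sum>k=- int N..1. I k)"
    unfolding shift_def by (rule sum.reindex_bij_witness[of _ "\<lambda>i. i - 1" "\<lambda>i. i + 1"]) auto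
  moreover have "{- int N..1} = insert 1 {- int N..0}" by auto
  ultimately show ?thesis by simp
qed

lemma cesaro_shift: "cesaro (shift I) L \<longleftrightarrow> cesaro I L"
proof
  assume "cesaro I L"
  then have "(\<lambda>N. (\<Sum>k=- int N..0. I k) / real (Suc N) * (real (Suc N) / real (Suc (Suc N)))
      + I 1 * (1 / real (Suc (Suc N)))) \<longlonglongrightarrow> L * 1 + I 1 * 0"
    using LIMSEQ_Suc[OF LIMSEQ_n_over_Suc_n] LIMSEQ_Suc[OF lim_1_over_n[THEN LIMSEQ_Suc]]
    unfolding cesaro_def by (intro tendsto_intros) (auto simp del: of_nat_Suc)
  moreover have "(\<Sum>k=- int N..0. I k) / real (Suc N) * (real (Suc N) / real (Suc (Suc N)))
      + I 1 * (1 / real (Suc (Suc N))) = (\<Sum>k=- int (Suc N)..0. shift I k) / real (Suc (Suc N))"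
          for N
    unfolding sum_shift by (simp add: add_divide_distrib del: of_nat_Suc)
  ultimately have "(\<lambda>N. (\<Sum>k=- int (Suc N)..0. shift I k) / real (Suc (Suc N))) \<longlonglongrightarrow> L" by simp
  then show "cesaro (shift I) L" unfolding cesaro_def by (rule LIMSEQ_imp_Suc)
next
  assume "cesaro (shift I) L"
  from LIMSEQ_Suc[OF this[unfolded cesaro_def]]
  have "(\<lambda>N. (\<Sum>k=- int (Suc N)..0. shift I k) / real (Suc (Suc N))
      * (real (Suc (Suc N)) / real (Suc N))
      - I 1 * (1 / real (Suc N))) \<longlonglongrightarrow> L * 1 - I 1 * 0"
    using LIMSEQ_Suc[OF LIMSEQ_Suc_n_over_n] lim_1_over_n[THEN LIMSEQ_Suc]
    by (intro tendsto_diff tendsto_mult tendsto_const) (auto simp del: of_nat_Suc)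
  moreover have "(\<Sum>k=- int (Suc N)..0. shift I k) / real (Suc (Suc N))
      * (real (Suc (Suc N)) / real (Suc N))
      - I 1 * (1 / real (Suc N)) = (\<Sum>k=- int N..0. I k) / real (Suc N)" for N
    unfolding sum_shift by (simp flip: diff_divide_distrib del: of_nat_Suc)
  ultimately show "cesaro I L" unfolding cesaro_def by simp
qed

section \<open>Burke's theorem\<close>

lemma lborel3_swap:
  fixes G :: "real \<Rightarrow> real \<Rightarrow> real \<Rightarrow> ennreal"
  assumes G: "(\<lambda>(x, y, z). G x y z) \<in> borel_measurable (borel \<Otimes>\<^sub>M (borel \<Otimes>\<^sub>M borel))"
  shows "(\<integral>\<^sup>+x. \<integral>\<^sup>+y. \<integral>\<^sup>+z. G x y z \<partial>lborel \<partial>lborel \<partial>lborel)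
      = (\<integral>\<^sup>+y. \<integral>\<^sup>+x. \<integral>\<^sup>+z. G x y z \<partial>lborel \<partial>lborel \<partial>lborel)"
    "(\<integral>\<^sup>+x. \<integral>\<^sup>+y. \<integral>\<^sup>+z. G x y z \<partial>lborel \<partial>lborel \<partial>lborel)
        = (\<integral>\<^sup>+x. \<integral>\<^sup>+z. \<integral>\<^sup>+y. G x y z \<partial>lborel \<partial>lborel \<partial>lborel)"
proof -
  define G' where "G' = (\<lambda>(x, y, z). G x y z)"
  have [measurable]: "G' \<in> borel_measurable (borel \<Otimes>\<^sub>M (borel \<Otimes>\<^sub>M borel))"
    using G by (simp add: G'_def)
  have 1: "(\<integral>\<^sup>+x. \<integral>\<^sup>+y. \<integral>\<^sup>+z. G' (x, y, z) \<partial>lborel \<partial>lborel \<partial>lborel)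
      = (\<integral>\<^sup>+y. \<integral>\<^sup>+x. \<integral>\<^sup>+z. G' (x, y, z) \<partial>lborel \<partial>lborel \<partial>lborel)"
    by (rule lborel_pair.Fubini') measurable
  have 2: "(\<integral>\<^sup>+x. \<integral>\<^sup>+y. \<integral>\<^sup>+z. G' (x, y, z) \<partial>lborel \<partial>lborel \<partial>lborel)
      = (\<integral>\<^sup>+x. \<integral>\<^sup>+z. \<integral>\<^sup>+y. G' (x, y, z) \<partial>lborel \<partial>lborel \<partial>lborel)"
    by (intro nn_integral_cong lborel_pair.Fubini') measurable
  show "(\<integral>\<^sup>+x. \<integral>\<^sup>+y. \<integral>\<^sup>+z. G x y z \<partial>lborel \<partial>lborel \<partial>lborel)
      = (\<integral>\<^sup>+y. \<integral>\<^sup>+x. \<integral>\<^sup>+z. G x y z \<partial>lborel \<partial>lborel \<partial>lborel)"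
    "(\<integral>\<^sup>+x. \<integral>\<^sup>+y. \<integral>\<^sup>+z. G x y z \<partial>lborel \<partial>lborel \<partial>lborel)
        = (\<integral>\<^sup>+x. \<integral>\<^sup>+z. \<integral>\<^sup>+y. G x y z \<partial>lborel \<partial>lborel \<partial>lborel)"
    using 1 2 by (simp_all add: G'_def)
qed

lemma lborel_shift:
  fixes f :: "real \<Rightarrow> ennreal"
  assumes "f \<in> borel_measurable borel"
  shows "(\<integral>\<^sup>+x. f (x + t) \<partial>lborel) = (\<integral>\<^sup>+x. f x \<partial>lborel)"
  using nn_integral_real_affine[OF assms, of 1 t] by (simp add: add.commute)

text \<open>The map below is piecewise linear with determinant \<open>\<plusminus>1\<close>, and an involution up to the order of
  its components.\<close>

lemma lborel3_queue:
  fixes G :: "real \<times> real \<times> real \<Rightarrow> ennreal"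
  assumes [measurable]: "G \<in> borel_measurable (borel \<Otimes>\<^sub>M (borel \<Otimes>\<^sub>M borel))"
  shows "(\<integral>\<^sup>+J. \<integral>\<^sup>+I. \<integral>\<^sup>+w. G (w + max 0 (I - J), w
      + max 0 (J - I), min I J) \<partial>lborel \<partial>lborel \<partial>lborel)
    = (\<integral>\<^sup>+J. \<integral>\<^sup>+I. \<integral>\<^sup>+w. G (I, J, w) \<partial>lborel \<partial>lborel \<partial>lborel)" (is "?L = ?R")
proof -
  \<comment> \<open>The sign of \<open>I - J\<close> is also the sign of the difference of the first
    two output components. So the halves \<open>?K1\<close> and \<open>?K2\<close> correspond to the
    halves \<open>?G1\<close> and \<open>?G2\<close> of the image, and on each half a single
    translation of one variable does the change of variables.\<close>
  let ?G1 = "\<lambda>I J w. if J \<le> I then G (I, J, w) else 0"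
  let ?G2 = "\<lambda>I J w. if I < J then G (I, J, w) else 0"
  let ?K1 = "\<lambda>I J w. if J \<le> I then G (w + (I - J), w, J) else 0"
  let ?K2 = "\<lambda>I J w. if I < J then G (w, w + (J - I), I) else 0"
  have "?L = (\<integral>\<^sup>+J. \<integral>\<^sup>+I. \<integral>\<^sup>+w. ?K1 I J w + ?K2 I J w \<partial>lborel \<partial>lborel \<partial>lborel)"
    by (intro nn_integral_cong) (auto simp: max_def min_def)
  also have "\<dots> = (\<integral>\<^sup>+J. \<integral>\<^sup>+I. \<integral>\<^sup>+w. ?K1 I J w \<partial>lborel \<partial>lborel \<partial>lborel)
      + (\<integral>\<^sup>+J. \<integral>\<^sup>+I. \<integral>\<^sup>+w. ?K2 I J w \<partial>lborel \<partial>lborel \<partial>lborel)"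
    by (simp add: nn_integral_add)
  also have "(\<integral>\<^sup>+J. \<integral>\<^sup>+I. \<integral>\<^sup>+w. ?K1 I J w \<partial>lborel \<partial>lborel \<partial>lborel)
      = (\<integral>\<^sup>+J. \<integral>\<^sup>+w. \<integral>\<^sup>+I. ?K1 I J w \<partial>lborel \<partial>lborel \<partial>lborel)"
    by (rule lborel3_swap) measurable
  also have "\<dots> = (\<integral>\<^sup>+J. \<integral>\<^sup>+w. \<integral>\<^sup>+x. ?G1 x w J \<partial>lborel \<partial>lborel \<partial>lborel)"
  proof (rule nn_integral_cong, rule nn_integral_cong)
    fix J w :: real
    have "(\<integral>\<^sup>+I. ?K1 I J w \<partial>lborel) = (\<integral>\<^sup>+I. ?G1 (I + (w - J)) w J \<partial>lborel)"
      by (intro nn_integral_cong) (auto simp: algebra_simps)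
    also have "\<dots> = (\<integral>\<^sup>+x. ?G1 x w J \<partial>lborel)" by (rule lborel_shift) measurable
    finally show "(\<integral>\<^sup>+I. ?K1 I J w \<partial>lborel) = (\<integral>\<^sup>+x. ?G1 x w J \<partial>lborel)" .
  qed
  also have "\<dots> = (\<integral>\<^sup>+w. \<integral>\<^sup>+J. \<integral>\<^sup>+x. ?G1 x w J \<partial>lborel \<partial>lborel \<partial>lborel)"
    by (rule lborel3_swap) measurable
  also have "\<dots> = (\<integral>\<^sup>+w. \<integral>\<^sup>+x. \<integral>\<^sup>+J. ?G1 x w J \<partial>lborel \<partial>lborel \<partial>lborel)"
    by (rule lborel3_swap) measurable
  also have "(\<integral>\<^sup>+J. \<integral>\<^sup>+I. \<integral>\<^sup>+w. ?K2 I J w \<partial>lborel \<partial>lborel \<partial>lborel)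
      = (\<integral>\<^sup>+I. \<integral>\<^sup>+J. \<integral>\<^sup>+w. ?K2 I J w \<partial>lborel \<partial>lborel \<partial>lborel)"
    by (rule lborel3_swap) measurable
  also have "\<dots> = (\<integral>\<^sup>+I. \<integral>\<^sup>+w. \<integral>\<^sup>+J. ?K2 I J w \<partial>lborel \<partial>lborel \<partial>lborel)"
    by (rule lborel3_swap) measurable
  also have "\<dots> = (\<integral>\<^sup>+I. \<integral>\<^sup>+w. \<integral>\<^sup>+y. ?G2 w y I \<partial>lborel \<partial>lborel \<partial>lborel)"
  proof (rule nn_integral_cong, rule nn_integral_cong)
    fix I w :: real
    have "(\<integral>\<^sup>+J. ?K2 I J w \<partial>lborel) = (\<integral>\<^sup>+J. ?G2 w (J + (w - I)) I \<partial>lborel)"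
      by (intro nn_integral_cong) (auto simp: algebra_simps)
    also have "\<dots> = (\<integral>\<^sup>+y. ?G2 w y I \<partial>lborel)" by (rule lborel_shift) measurable
    finally show "(\<integral>\<^sup>+J. ?K2 I J w \<partial>lborel) = (\<integral>\<^sup>+y. ?G2 w y I \<partial>lborel)" .
  qed
  also have "\<dots> = (\<integral>\<^sup>+I. \<integral>\<^sup>+y. \<integral>\<^sup>+w. ?G2 w y I \<partial>lborel \<partial>lborel \<partial>lborel)"
    by (rule lborel3_swap) measurable
  also have "\<dots> = (\<integral>\<^sup>+y. \<integral>\<^sup>+I. \<integral>\<^sup>+w. ?G2 w y I \<partial>lborel \<partial>lborel \<partial>lborel)"
    by (rule lborel3_swap) measurable
  also have "\<dots> = (\<integral>\<^sup>+y. \<integral>\<^sup>+w. \<integral>\<^sup>+I. ?G2 w y I \<partial>lborel \<partial>lborel \<partial>lborel)"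
    by (rule lborel3_swap) measurable
  also have "(\<integral>\<^sup>+w. \<integral>\<^sup>+x. \<integral>\<^sup>+J. ?G1 x w J \<partial>lborel \<partial>lborel \<partial>lborel)
      + (\<integral>\<^sup>+y. \<integral>\<^sup>+w. \<integral>\<^sup>+I. ?G2 w y I \<partial>lborel \<partial>lborel \<partial>lborel)
      = (\<integral>\<^sup>+J. \<integral>\<^sup>+I. \<integral>\<^sup>+w. ?G1 I J w + ?G2 I J w \<partial>lborel \<partial>lborel \<partial>lborel)"
    by (simp add: nn_integral_add)
  also have "\<dots> = ?R"
    by (intro nn_integral_cong) auto
  finally show ?thesis .
qed

lemma expo3_lborel3:
  fixes F :: "real \<Rightarrow> real \<Rightarrow> real \<Rightarrow> ennreal"
  assumes F: "(\<lambda>(J, I, w). F J I w) \<in> borel_measurable (borel \<Otimes>\<^sub>M (borel \<Otimes>\<^sub>M borel))"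
  shows "(\<integral>\<^sup>+J. \<integral>\<^sup>+I. \<integral>\<^sup>+w. F J I w \<partial>expo b \<partial>expo a \<partial>expo g)
    = (\<integral>\<^sup>+J. \<integral>\<^sup>+I. \<integral>\<^sup>+w. ennreal (exponential_density (1 / g) J) * (ennreal (exponential_density (1
        / a) I)
        * (ennreal (exponential_density (1 / b) w) * F J I w)) \<partial>lborel \<partial>lborel \<partial>lborel)"
proof -
  define F' where "F' = (\<lambda>(J, I, w). F J I w)"
  have [measurable]: "F' \<in> borel_measurable (borel \<Otimes>\<^sub>M (borel \<Otimes>\<^sub>M borel))"
    using F by (simp add: F'_def)
  have "(\<integral>\<^sup>+J. \<integral>\<^sup>+I. \<integral>\<^sup>+w. F' (J, I, w) \<partial>expo b \<partial>expo a \<partial>expo g)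
    = (\<integral>\<^sup>+J. \<integral>\<^sup>+I. \<integral>\<^sup>+w. ennreal (exponential_density (1 / g) J) * (ennreal (exponential_density (1
        / a) I)
        * (ennreal (exponential_density (1 / b) w) * F' (J, I, w))) \<partial>lborel \<partial>lborel \<partial>lborel)"
    by (simp add: nn_integral_expo nn_integral_cmult)
  then show ?thesis by (simp add: F'_def)
qed

text \<open>The product density is a constant times the exponential of
  \<open>- (J / g + I / a + w / b)\<close> on the positive orthant. The rate relation makes this
  exponent invariant under the queueing step: what \<open>min I J\<close> loses at rate
  \<open>1 / b\<close> is restored at the rates \<open>1 / a\<close> and \<open>1 / g\<close>. The
  step preserves Lebesgue measure by \<open>lborel3_queue\<close>.\<close>

lemma local_burke:
  fixes F :: "real \<times> real \<times> real \<Rightarrow> ennreal"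
  assumes F [measurable]: "F \<in> borel_measurable (borel \<Otimes>\<^sub>M (borel \<Otimes>\<^sub>M borel))"
    and pos: "0 < a" "0 < b" "0 < g" and rates: "1 / b = 1 / a + 1 / g"
  shows "(\<integral>\<^sup>+J. \<integral>\<^sup>+I. \<integral>\<^sup>+w. F (w + max 0 (I - J), w
      + max 0 (J - I), min I J) \<partial>expo b \<partial>expo a \<partial>expo g)
    = (\<integral>\<^sup>+J. \<integral>\<^sup>+I. \<integral>\<^sup>+w. F (I, J, w) \<partial>expo b \<partial>expo a \<partial>expo g)"
proof -
  define h where "h = (\<lambda>(I, J, w). exponential_density (1 / g) J * (exponential_density (1 / a) I
      * exponential_density (1 / b) w))"
  have h: "ennreal (exponential_density (1 / g) J) * (ennreal (exponential_density (1 / a) I)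
        * (ennreal (exponential_density (1 / b) w) * c)) = ennreal (h (I, J, w)) * c" for I J w c
    using pos unfolding h_def
    by (simp add: ennreal_mult' exponential_density_nonneg mult.assoc)
  have inv: "h (w + max 0 (I - J), w + max 0 (J - I), min I J) = h (I, J, w)" for I J w
  proof (cases "0 \<le> I \<and> 0 \<le> J \<and> 0 \<le> w")
    case True
    have "(w + max 0 (J - I)) * (1 / g) + ((w + max 0 (I - J)) * (1 / a) + min I J * (1 / b))
      = J * (1 / g) + (I * (1 / a) + w * (1 / b))"
      unfolding rates by (cases "I \<le> J") (auto simp: max_def min_def algebra_simps
          add_divide_distrib)
    moreover have "h (I, J, w) = 1 / g * (1 / a) * (1 / b) * exp (- (J * (1 / g) + (I * (1 / a) + w
        * (1 / b))))"
      if "0 \<le> I" "0 \<le> J" "0 \<le> w" for I J w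
    proof -
      have "exp (- (J * (1 / g) + (I * (1 / a) + w * (1 / b))))
          = exp (- J * (1 / g)) * (exp (- I * (1 / a)) * exp (- w * (1 / b)))"
        unfolding mult_exp_exp by simp
      then show ?thesis using that by (simp add: h_def exponential_density_def)
    qed
    ultimately show ?thesis using True by auto
  next
    case False
    \<comment> \<open>The step also respects the complement of the orthant: \<open>w\<close> is the
      smaller of the first two output components, so a negative input forces a negative
      output.\<close>
    then have "\<not> (0 \<le> w + max 0 (I - J) \<and> 0 \<le> w + max 0 (J - I) \<and> 0 \<le> min I J)"
      by (auto simp: max_def min_def)
    with False show ?thesis by (auto simp: h_def exponential_density_def)
  qed
  have [measurable]: "h \<in> borel_measurable (borel \<Otimes>\<^sub>M (borel \<Otimes>\<^sub>M borel))"
    unfolding h_def by measurable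
  have "(\<integral>\<^sup>+J. \<integral>\<^sup>+I. \<integral>\<^sup>+w. F (w + max 0 (I - J), w
      + max 0 (J - I), min I J) \<partial>expo b \<partial>expo a \<partial>expo g)
    = (\<integral>\<^sup>+J. \<integral>\<^sup>+I. \<integral>\<^sup>+w. ennreal (h (I, J, w)) * F (w + max 0 (I - J), w + max 0 (J - I), min I J)
        \<partial>lborel \<partial>lborel \<partial>lborel)"
    by (subst expo3_lborel3) (measurable, simp only: h)
  also have "\<dots> = (\<integral>\<^sup>+J. \<integral>\<^sup>+I. \<integral>\<^sup>+w. ennreal (h (w + max 0 (I - J), w + max 0 (J - I), min I J))
      * F (w + max 0 (I - J), w + max 0 (J - I), min I J) \<partial>lborel \<partial>lborel \<partial>lborel)"
    by (simp only: inv)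
  also have "\<dots> = (\<integral>\<^sup>+J. \<integral>\<^sup>+I. \<integral>\<^sup>+w. ennreal (h (I, J, w)) * F (I, J, w) \<partial>lborel \<partial>lborel \<partial>lborel)"
    by (rule lborel3_queue) measurable
  also have "\<dots> = (\<integral>\<^sup>+J. \<integral>\<^sup>+I. \<integral>\<^sup>+w. F (I, J, w) \<partial>expo b \<partial>expo a \<partial>expo g)"
    by (subst expo3_lborel3) (measurable, simp only: h)
  finally show ?thesis .
qed

text \<open>The assumption about \<open>M'\<close> expresses that the maps \<open>X j\<close>
  generate the sigma-algebra. Conditions with closed sets are chosen because their indicators are
  limits of Lipschitz functions, the kind of function that a small coupling distance
  controls.\<close>

lemma measure_eqI_cylinder:
  fixes X :: "'j \<Rightarrow> 'a \<Rightarrow> real"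
  assumes M: "finite_measure M" and sets: "sets N = sets M"
    and X: "\<And>j. j \<in> J \<Longrightarrow> X j \<in> borel_measurable M"
    and gen: "\<And>M'. space M' = space M \<Longrightarrow> (\<And>j. j \<in> J \<Longrightarrow> X j \<in> borel_measurable M')
        \<Longrightarrow> (\<lambda>x. x) \<in> M' \<rightarrow>\<^sub>M M"
    and eq: "\<And>S A. finite S \<Longrightarrow> S \<subseteq> J \<Longrightarrow> (\<And>j. closed (A j)) \<Longrightarrow>
      emeasure M {x \<in> space M. \<forall>j\<in>S. X j x \<in> A j} = emeasure N {x \<in> space M. \<forall>j\<in>S. X j x \<in> A j}"
  shows "M = N"
proof -
  define E where "E = {{x \<in> space M. \<forall>j\<in>S. X j x \<in> A j} | S A. finite S \<and> S \<subseteq> J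
      \<and> (\<forall>j. closed (A j))}"
  have EI: "{x \<in> space M. \<forall>j\<in>S. X j x \<in> A j} \<in> E"
    if "finite S" "S \<subseteq> J" "\<And>j. closed (A j)" for S A
    unfolding E_def using that by blast
  have EPow: "E \<subseteq> Pow (space M)" by (auto simp: E_def)
  have Esets: "E \<subseteq> sets M"
  proof
    fix B assume "B \<in> E"
    then obtain S A where B: "B = {x \<in> space M. \<forall>j\<in>S. X j x \<in> A j}" "finite S" "S \<subseteq> J"
        "\<forall>j. closed (A j)"
      unfolding E_def by blast
    have "{x \<in> space M. X j x \<in> A j} \<in> sets M" if "j \<in> S" for j
      using measurable_sets[OF X, of j "A j"] that B by (auto simp: vimage_def Int_def conj_commute)
    then show "B \<in> sets M" unfolding B(1) using B(2) by (intro sets.sets_Collect_finite_All) auto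
  qed
  have gen': "sets M = sigma_sets (space M) E"
  proof
    have "X j \<in> borel_measurable (sigma (space M) E)" if "j \<in> J" for j
      unfolding borel_eq_closed
    proof (rule measurable_measure_of)
      fix A :: "real set" assume "A \<in> Collect closed"
      then have "{x \<in> space M. \<forall>i\<in>{j}. X i x \<in> A} \<in> E" using that by (intro EI) auto
      then have "{x \<in> space M. \<forall>i\<in>{j}. X i x \<in> A} \<in> sigma_sets (space M) E"
        by (rule sigma_sets.Basic)
      moreover have "{x \<in> space M. \<forall>i\<in>{j}. X i x \<in> A} = X j -` A \<inter> space M" by auto
      ultimately show "X j -` A \<inter> space (sigma (space M) E) \<in> sets (sigma (space M) E)"
        using EPow by simp
    qed auto
    then have idm: "(\<lambda>x. x) \<in> sigma (space M) E \<rightarrow>\<^sub>M M" using EPow by (intro gen) auto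
    have id: "(\<lambda>x. x) -` B \<inter> space M \<in> sigma_sets (space M) E" if "B \<in> sets M" for B
      using measurable_sets[OF idm that] EPow by simp
    show "sets M \<subseteq> sigma_sets (space M) E"
    proof
      fix B assume "B \<in> sets M"
      then show "B \<in> sigma_sets (space M) E" using id[of B] sets.sets_into_space[of B M]
        by (simp add: Int_absorb2)
    qed
    show "sigma_sets (space M) E \<subseteq> sets M" by (rule sets.sigma_sets_subset[OF Esets])
  qed
  show ?thesis
  proof (rule measure_eqI_generator_eq[where A = "\<lambda>_. space M"])
    show "Int_stable E"
    proof (rule Int_stableI)
      fix B C assume "B \<in> E" "C \<in> E"
      then obtain S A S' A' where
        B: "B = {x \<in> space M. \<forall>j\<in>S. X j x \<in> A j}" "finite S" "S \<subseteq> J" "\<forall>j. closed (A j)" and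
        C: "C = {x \<in> space M. \<forall>j\<in>S'. X j x \<in> A' j}" "finite S'" "S' \<subseteq> J" "\<forall>j. closed (A' j)"
        unfolding E_def by blast
      have "B \<inter> C = {x \<in> space M. \<forall>j\<in>S \<union> S'. X j x \<in> (if j \<in> S then A j else UNIV) \<inter> (if j \<in> S' then
          A' j else UNIV)}"
        unfolding B(1) C(1) by auto
      also have "\<dots> \<in> E" using B C by (intro EI) auto
      finally show "B \<inter> C \<in> E" .
    qed
    show "emeasure M B = emeasure N B" if "B \<in> E" for B
      using that eq unfolding E_def by blast
    show "range (\<lambda>_. space M) \<subseteq> E" using EI[of "{}" "\<lambda>_. UNIV"] by auto
    show "emeasure M (space M) \<noteq> \<infinity>" for i :: nat
      using finite_measure.emeasure_finite[OF M] by simp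
  qed (use gen' sets EPow in auto)
qed

section \<open>Burke's theorem for the recursion with a finite start\<close>

lemma lindley_cong:
  assumes "\<And>j. j \<le> s + int n \<Longrightarrow> I j = I' j" "\<And>j. j \<le> s + int n \<Longrightarrow> w j = w' j"
  shows "lindley I w x s n = lindley I' w' x s n"
  using assms by (induction n) auto

lemma measurable_lindley [measurable (raw)]:
  assumes [measurable]: "f \<in> M \<rightarrow>\<^sub>M seq_space" "g \<in> M \<rightarrow>\<^sub>M seq_space" "h \<in> borel_measurable M"
  shows "(\<lambda>x. lindley (f x) (g x) (h x) s n) \<in> borel_measurable M"
  by (induction n) simp_all

definition lindley_out :: "seq \<Rightarrow> seq \<Rightarrow> real \<Rightarrow> int \<Rightarrow> nat \<Rightarrow> real" where
  "lindley_out I w x s n = w (s + int n + 1) + max 0 (I (s + int n + 1) - lindley I w x s n)"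

definition lindley_dual :: "seq \<Rightarrow> seq \<Rightarrow> real \<Rightarrow> int \<Rightarrow> nat \<Rightarrow> real" where
  "lindley_dual I w x s n = min (I (s + int n + 1)) (lindley I w x s n)"

lemma measurable_lindley_out [measurable (raw)]:
  assumes [measurable]: "f \<in> M \<rightarrow>\<^sub>M seq_space" "g \<in> M \<rightarrow>\<^sub>M seq_space" "h \<in> borel_measurable M"
  shows "(\<lambda>x. lindley_out (f x) (g x) (h x) s n) \<in> borel_measurable M"
  unfolding lindley_out_def by measurable

lemma measurable_lindley_dual [measurable (raw)]:
  assumes [measurable]: "f \<in> M \<rightarrow>\<^sub>M seq_space" "g \<in> M \<rightarrow>\<^sub>M seq_space" "h \<in> borel_measurable M"
  shows "(\<lambda>x. lindley_dual (f x) (g x) (h x) s n) \<in> borel_measurable M"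
  unfolding lindley_dual_def by measurable

definition lindley_cyl :: "(nat \<Rightarrow> real set) \<Rightarrow> (nat \<Rightarrow> real set) \<Rightarrow> seq \<Rightarrow> seq \<Rightarrow> real \<Rightarrow> int \<Rightarrow> nat \<Rightarrow>
    ennreal" where
  "lindley_cyl A B I w x s n =
    (\<Prod>j<n. indicator (A j) (lindley_out I w x s j) * indicator (B j) (lindley_dual I w x s j))"

lemma measurable_lindley_cyl [measurable (raw)]:
  assumes [measurable]: "f \<in> M \<rightarrow>\<^sub>M seq_space" "g \<in> M \<rightarrow>\<^sub>M seq_space" "h \<in> borel_measurable M"
    "\<And>j. A j \<in> sets borel" "\<And>j. B j \<in> sets borel"
  shows "(\<lambda>x. lindley_cyl A B (f x) (g x) (h x) s n) \<in> borel_measurable M"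
  unfolding lindley_cyl_def by measurable

lemma lindley_cyl_cong:
  assumes "\<And>j. j \<le> s + int n \<Longrightarrow> I j = I' j" "\<And>j. j \<le> s + int n \<Longrightarrow> w j = w' j"
  shows "lindley_cyl A B I w x s n = lindley_cyl A B I' w' x s n"
proof -
  have "lindley I w x s j = lindley I' w' x s j" if "j < n" for j
    using that assms by (intro lindley_cong) auto
  moreover have "I (s + int j + 1) = I' (s + int j + 1)" "w (s + int j + 1) = w' (s + int j + 1)"
      if "j < n" for j
    using that assms by auto
  ultimately show ?thesis unfolding lindley_cyl_def lindley_out_def lindley_dual_def by simp
qed

text \<open>The test function \<open>H\<close> of the current sojourn time carries the induction.
  One step turns \<open>H\<close> into \<open>H'\<close>, and by \<open>local_burke\<close> the new
  output and dual service are independent of each other and of the new sojourn time, which keeps the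
  law \<open>expo g\<close>.\<close>

lemma lindley_burke:
  assumes pos: "0 < a" "0 < b" "0 < g" and rates: "1 / b = 1 / a + 1 / g"
    and A [measurable]: "\<And>j. A j \<in> sets borel" and B [measurable]: "\<And>j. B j \<in> sets borel"
    and H: "H \<in> borel_measurable borel"
  shows "(\<integral>\<^sup>+x. \<integral>\<^sup>+I. \<integral>\<^sup>+w. lindley_cyl A B I w x s n
      * H (lindley I w x s n) \<partial>exp_seq b \<partial>exp_seq a \<partial>expo g)
    = (\<Prod>j<n. emeasure (expo a) (A j) * emeasure (expo b) (B j)) * (\<integral>\<^sup>+J. H J \<partial>expo g)"
  using H
proof (induction n arbitrary: H)
  case 0
  interpret Sa: prob_space "exp_seq a" by (rule prob_space_exp_seq[OF pos(1)])
  interpret Sb: prob_space "exp_seq b" by (rule prob_space_exp_seq[OF pos(2)])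
  show ?case by (simp add: lindley_cyl_def Sa.emeasure_space_1[simplified]
      Sb.emeasure_space_1[simplified])
next
  case (Suc n)
  note [measurable] = Suc.prems
  interpret Sa: prob_space "exp_seq a" by (rule prob_space_exp_seq[OF pos(1)])
  interpret Sb: prob_space "exp_seq b" by (rule prob_space_exp_seq[OF pos(2)])
  interpret Ea: prob_space "expo a" by (rule prob_space_expo[OF pos(1)])
  interpret Eb: prob_space "expo b" by (rule prob_space_expo[OF pos(2)])
  interpret Eg: prob_space "expo g" by (rule prob_space_expo[OF pos(3)])
  interpret P: pair_sigma_finite "expo a" "exp_seq b" ..
  \<comment> \<open>The site used by step \<open>n\<close>. The earlier steps look only at sites up
    to \<open>s + n\<close>, so both sequences may be redrawn at \<open>k\<close>.\<close>
  define k where "k = s + int n + 1"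
  define K :: "real \<times> real \<times> real \<Rightarrow> ennreal" where
      "K = (\<lambda>(J, i, v). indicator (A n) (v + max 0 (i - J))
    * indicator (B n) (min i J) * H (v + max 0 (J - i)))"
  define H' where "H' J = (\<integral>\<^sup>+i. \<integral>\<^sup>+v. K (J, i, v) \<partial>expo b \<partial>expo a)" for J
  have [measurable]: "K \<in> borel_measurable (borel \<Otimes>\<^sub>M (borel \<Otimes>\<^sub>M borel))"
    unfolding K_def by measurable
  have H' [measurable]: "H' \<in> borel_measurable borel" unfolding H'_def by measurable
  let ?U = "\<lambda>I w x. lindley_cyl A B I w x s n" and ?J = "\<lambda>I w x. lindley I w x s n"
  have step: "lindley_cyl A B I w x s (Suc n) * H (lindley I w x s (Suc n))
    = ?U I w x * K (?J I w x, I k, w k)" for I w x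
    by (simp add: lindley_cyl_def K_def lindley_out_def lindley_dual_def k_def mult.assoc)
  have U: "?U (I(k := i)) (w(k := v)) x = ?U I w x" "?J (I(k := i)) (w(k := v)) x = ?J I w x"
    "?U I (w(k := v)) x = ?U I w x" "?J I (w(k := v)) x = ?J I w x"
    "?U (I(k := i)) w x = ?U I w x" "?J (I(k := i)) w x = ?J I w x" for I w x i v
    by (rule lindley_cyl_cong lindley_cong; simp add: k_def)+
  have "(\<integral>\<^sup>+I. \<integral>\<^sup>+w. lindley_cyl A B I w x s (Suc n)
      * H (lindley I w x s (Suc n)) \<partial>exp_seq b \<partial>exp_seq a)
    = (\<integral>\<^sup>+I. \<integral>\<^sup>+w. ?U I w x * H' (?J I w x) \<partial>exp_seq b \<partial>exp_seq a)" for x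
  proof -
    have "(\<integral>\<^sup>+I. \<integral>\<^sup>+w. lindley_cyl A B I w x s (Suc n)
        * H (lindley I w x s (Suc n)) \<partial>exp_seq b \<partial>exp_seq a)
      = (\<integral>\<^sup>+I. \<integral>\<^sup>+w. \<integral>\<^sup>+v. ?U I w x * K (?J I w x, I k, v) \<partial>expo b \<partial>exp_seq b \<partial>exp_seq a)"
      unfolding step
      by (subst nn_integral_exp_seq_resample[OF pos(2), of _ k]) (measurable, simp only: U
          fun_upd_same)
    also have "\<dots> = (\<integral>\<^sup>+I. \<integral>\<^sup>+i. \<integral>\<^sup>+w. \<integral>\<^sup>+v. ?U I w x
        * K (?J I w x, i, v) \<partial>expo b \<partial>exp_seq b \<partial>expo a \<partial>exp_seq a)"
      by (subst nn_integral_exp_seq_resample[OF pos(1), of _ k]) (measurable, simp only: U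
          fun_upd_same)
    also have "\<dots> = (\<integral>\<^sup>+I. \<integral>\<^sup>+w. \<integral>\<^sup>+i. \<integral>\<^sup>+v. ?U I w x
        * K (?J I w x, i, v) \<partial>expo b \<partial>expo a \<partial>exp_seq b \<partial>exp_seq a)"
      by (intro nn_integral_cong P.Fubini'[symmetric]) measurable
    also have "\<dots> = (\<integral>\<^sup>+I. \<integral>\<^sup>+w. ?U I w x * H' (?J I w x) \<partial>exp_seq b \<partial>exp_seq a)"
      by (simp add: nn_integral_cmult H'_def)
    finally show ?thesis .
  qed
  then have "(\<integral>\<^sup>+x. \<integral>\<^sup>+I. \<integral>\<^sup>+w. lindley_cyl A B I w x s (Suc n)
      * H (lindley I w x s (Suc n)) \<partial>exp_seq b \<partial>exp_seq a \<partial>expo g)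
    = (\<Prod>j<n. emeasure (expo a) (A j) * emeasure (expo b) (B j)) * (\<integral>\<^sup>+J. H' J \<partial>expo g)"
    using Suc.IH[OF H'] by simp
  also have "(\<integral>\<^sup>+J. H' J \<partial>expo g)
      = (\<integral>\<^sup>+J. \<integral>\<^sup>+I. \<integral>\<^sup>+w. indicator (A n) I * indicator (B n) w * H J \<partial>expo b \<partial>expo a \<partial>expo g)"
    unfolding H'_def K_def
    using local_burke[OF _ pos rates, of "\<lambda>(I, J, w). indicator (A n) I * indicator (B n) w * H J"]
      by simp
  also have "\<dots> = (\<integral>\<^sup>+J. \<integral>\<^sup>+I. indicator (A n) I * (emeasure (expo b) (B n) * H J) \<partial>expo a \<partial>expo g)"
    by (simp add: nn_integral_cmult nn_integral_multc mult.assoc)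
  also have "\<dots> = emeasure (expo a) (A n) * emeasure (expo b) (B n) * (\<integral>\<^sup>+J. H J \<partial>expo g)"
    by (simp add: nn_integral_multc nn_integral_cmult mult.assoc)
  finally show ?case by (simp add: mult.assoc)
qed

section \<open>Burke's theorem for two-sided sequences\<close>

abbreviation seq2_space :: "(seq \<times> seq) measure" where
  "seq2_space \<equiv> seq_space \<Otimes>\<^sub>M seq_space"

lemma measurable_cesaro_ex:
  assumes [measurable]: "f \<in> M \<rightarrow>\<^sub>M seq_space" "Measurable.pred borel P"
  shows "Measurable.pred M (\<lambda>x. \<exists>L. P L \<and> cesaro (f x) L)"
proof -
  \<comment> \<open>The existential ranges over uncountably many limits; the Cauchy property
    together with a condition on \<open>lim\<close> is measurable.\<close>
  have eq: "(\<exists>L. P L \<and> cesaro z L) \<longleftrightarrow> Cauchy (\<lambda>N. sum z {- int N..0} / real (Suc N))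
      \<and> P (lim (\<lambda>N. sum z {- int N..0} / real (Suc N)))" for z
    unfolding cesaro_def Cauchy_convergent_iff by (auto simp: convergent_def limI)
  have Y: "(\<lambda>x. sum (f x) {- int N..0} / real (Suc N)) \<in> borel_measurable M" for N
    by measurable
  have [measurable]: "Measurable.pred M (\<lambda>x. Cauchy (\<lambda>N. sum (f x) {- int N..0} / real (Suc N)))"
    unfolding pred_def by (rule sets_Collect_Cauchy[OF Y])
  have [measurable]: "(\<lambda>x. lim (\<lambda>N. sum (f x) {- int N..0} / real (Suc N))) \<in> borel_measurable M"
    by (rule borel_measurable_lim_metric[OF Y])
  show ?thesis unfolding eq by measurable
qed

lemma measurable_cesaro [measurable (raw)]:
  assumes "f \<in> M \<rightarrow>\<^sub>M seq_space"
  shows "Measurable.pred M (\<lambda>x. cesaro (f x) L)"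
  using measurable_cesaro_ex[OF assms, of "\<lambda>K. K = L"] by simp

definition admissible :: "seq \<Rightarrow> seq \<Rightarrow> bool" where
  "admissible I w \<longleftrightarrow> queue_stable I w \<and> (\<forall>k. 0 \<le> I k) \<and> (\<forall>k. 0 \<le> w k)"

lemma measurable_admissible [measurable (raw)]:
  assumes [measurable]: "f \<in> M \<rightarrow>\<^sub>M seq_space" "g \<in> M \<rightarrow>\<^sub>M seq_space"
  shows "Measurable.pred M (\<lambda>x. admissible (f x) (g x))"
  unfolding admissible_def by measurable

lemma AE_admissible:
  assumes "0 < b" "b < a"
  shows "AE p in exp_seq a \<Otimes>\<^sub>M exp_seq b. admissible (fst p) (snd p)"
proof -
  interpret Sa: prob_space "exp_seq a" using assms by (intro prob_space_exp_seq) simp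
  interpret Sb: prob_space "exp_seq b" using assms by (intro prob_space_exp_seq) simp
  interpret P: pair_sigma_finite "exp_seq a" "exp_seq b" ..
  have a: "0 < a" using assms by simp
  have "AE I in exp_seq a. AE w in exp_seq b. admissible I w"
    using AE_exp_seq_cesaro[OF a] AE_exp_seq_nonneg[OF a]
  proof eventually_elim
    case (elim I)
    show ?case using AE_exp_seq_cesaro[OF assms(1)] AE_exp_seq_nonneg[OF assms(1)]
    proof eventually_elim
      case (elim w)
      then show ?case using cesaro_queue_stable[OF \<open>cesaro I a\<close> _ assms(2)] \<open>\<forall>k. 0 \<le> I k\<close>
        by (auto simp: admissible_def)
    qed
  qed
  then show ?thesis by (intro P.AE_pair_measure) auto
qed

lemma emeasure_expo_UNIV: "0 < s \<Longrightarrow> emeasure (expo s) UNIV = 1"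
  using prob_space.emeasure_space_1[OF prob_space_expo, of s] by simp

text \<open>Start the recursion in its stationary law \<open>expo g\<close> far to the left. By
  \<open>lindley_burke\<close> the integral then equals the right-hand side for every start, and by
  coalescence it converges to the left-hand side as the start recedes.\<close>

lemma queue_cylinder:
  assumes pos: "0 < b" "b < a" and fin: "finite S"
    and A [measurable]: "\<And>k. A k \<in> sets borel" and B [measurable]: "\<And>k. B k \<in> sets borel"
  shows "(\<integral>\<^sup>+p. (\<Prod>k\<in>S. indicator (A k) (queue_map (fst p) (snd p) k)
      * indicator (B k) (dual_service (fst p) (snd p) k))
      \<partial>(exp_seq a \<Otimes>\<^sub>M exp_seq b)) = (\<Prod>k\<in>S. emeasure (expo a) (A k) * emeasure (expo b) (B k))"
    (is "?L = ?R")
proof -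
  \<comment> \<open>The solution of \<open>1 / b = 1 / a + 1 / g\<close>; it is positive because the
    service mean \<open>b\<close> is below \<open>a\<close>.\<close>
  define g where "g = a * b / (a - b)"
  have g: "0 < g" and rates: "1 / b = 1 / a + 1 / g" and a: "0 < a" using pos
    by (auto simp: g_def field_simps)
  interpret Sa: prob_space "exp_seq a" by (rule prob_space_exp_seq[OF a])
  interpret Sb: prob_space "exp_seq b" by (rule prob_space_exp_seq[OF pos(1)])
  interpret Eg: prob_space "expo g" by (rule prob_space_expo[OF g])
  interpret P: prob_space "exp_seq a \<Otimes>\<^sub>M exp_seq b" by (rule prob_space_pair) unfold_locales
  interpret P2: pair_sigma_finite "exp_seq a" "exp_seq b" ..
  let ?P = "exp_seq a \<Otimes>\<^sub>M exp_seq b"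
  obtain K where K: "\<And>k. k \<in> S \<Longrightarrow> - int K \<le> k \<and> k \<le> int K"
  proof -
    define K where "K = Max (insert 0 ((\<lambda>k. nat \<bar>k\<bar>) ` S))"
    have "nat \<bar>k\<bar> \<le> K" if "k \<in> S" for k unfolding K_def using fin that by (intro Max_ge) auto
    then show ?thesis by (intro that[of K]) force
  qed
  \<comment> \<open>The \<open>n M\<close> steps after \<open>s M\<close> end exactly at site
    \<open>K\<close>. Visited sites outside \<open>S\<close> get the trivial condition
    \<open>UNIV\<close>, so the product over the window reduces to the product over
    \<open>S\<close>.\<close>
  define s where "s M = - int K - 1 - int M" for M
  define n where "n M = 2 * K + 1 + M" for M
  define A' where "A' M j = (if s M + int j + 1 \<in> S then A (s M + int j + 1) else UNIV)" for M j
  define B' where "B' M j = (if s M + int j + 1 \<in> S then B (s M + int j + 1) else UNIV)" for M j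
  have prod_window: "(\<Prod>j<n M. f (s M + int j + 1)) = (\<Prod>k\<in>S. f k)"
    if "\<And>k. k \<notin> S \<Longrightarrow> f k = 1" for f :: "int \<Rightarrow> ennreal" and M
  proof -
    have "(\<Prod>j<n M. f (s M + int j + 1)) = (\<Prod>k\<in>{s M + 1..int K}. f k)"
      by (rule prod.reindex_bij_witness[of _ "\<lambda>k. nat (k - s M - 1)" "\<lambda>j. s M + int j + 1"])
        (auto simp: s_def n_def)
    also have "\<dots> = (\<Prod>k\<in>S. f k)"
    proof (rule prod.mono_neutral_right)
      show "S \<subseteq> {s M + 1..int K}" using K by (force simp: s_def)
    qed (use that in auto)
    finally show ?thesis .
  qed
  define Y where "Y M x p = lindley_cyl (A' M) (B' M) (fst p) (snd p) x (s M) (n M)" for M x p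
  define X where "X p = (\<Prod>k\<in>S. indicator (A k) (queue_map (fst p) (snd p) k)
      * indicator (B k) (dual_service (fst p) (snd p) k) :: ennreal)" for p
  have [measurable]: "A' M j \<in> sets borel" "B' M j \<in> sets borel" for M j
    by (auto simp: A'_def B'_def)
  have [measurable]: "(\<lambda>p. Y M x p) \<in> borel_measurable ?P" for M x
    unfolding Y_def by measurable
  have [measurable]: "X \<in> borel_measurable ?P"
    unfolding X_def by measurable
  have Y_int: "(\<integral>\<^sup>+x. \<integral>\<^sup>+p. Y M x p \<partial>?P \<partial>expo g) = ?R" for M
  proof -
    have "(\<integral>\<^sup>+x. \<integral>\<^sup>+p. Y M x p \<partial>?P \<partial>expo g)
      = (\<integral>\<^sup>+x. \<integral>\<^sup>+I. \<integral>\<^sup>+w. lindley_cyl (A' M) (B' M) I w x (s M) (n M) * (\<lambda>_. 1) (lindley I w x (s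
          M) (n M)) \<partial>exp_seq b \<partial>exp_seq a \<partial>expo g)"
      by (subst Sb.nn_integral_fst[symmetric]) (auto simp: Y_def)
    also have "\<dots> = (\<Prod>j<n M. emeasure (expo a) (A' M j) * emeasure (expo b) (B' M j))"
      by (subst lindley_burke[OF a pos(1) g rates]) (auto simp: emeasure_expo_UNIV g)
    also have "\<dots> = (\<Prod>j<n M. (\<lambda>k. emeasure (expo a) (if k \<in> S then A k else UNIV)
        * emeasure (expo b) (if k \<in> S then B k else UNIV)) (s M + int j + 1))"
      by (simp add: A'_def B'_def)
    also have "\<dots> = ?R"
      by (subst prod_window) (auto simp: emeasure_expo_UNIV a pos)
    finally show ?thesis .
  qed
  have Y_le: "Y M x p \<le> 1" for M x p
    unfolding Y_def lindley_cyl_def by (intro prod_le_1) (auto simp: indicator_def)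
  have Y_eq: "\<forall>\<^sub>F M in sequentially. Y M x p = X p" if adm: "admissible (fst p) (snd p)" for x p
  proof -
    obtain I w where p: "p = (I, w)" by (cases p)
    from adm have st: "queue_stable I w" and w: "\<And>k. 0 \<le> w k" by (auto simp: admissible_def p)
    obtain s0 where s0: "\<And>s n. s \<le> s0 \<Longrightarrow> - int K - 1 \<le> s + int n \<Longrightarrow> lindley I w x s n = sojourn I w (s
        + int n)"
      using lindley_coalesces[OF st w, of "- int K - 1" x] by blast
    have "Y M x p = X p" if M: "nat (- s0) \<le> M" for M
    proof -
      have sM: "s M \<le> s0" using M by (simp add: s_def)
      have eq: "lindley_out I w x (s M) j = queue_map I w (s M + int j + 1)"
        "lindley_dual I w x (s M) j = dual_service I w (s M + int j + 1)"
        if "s M + int j + 1 \<in> S" for j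
        using K[OF that] s0[OF sM, of j]
        by (simp_all add: lindley_out_def lindley_dual_def queue_map_sojourn[OF st]
            dual_service_def)
      have "Y M x p = (\<Prod>j<n M. (\<lambda>k. if k \<in> S then indicator (A k) (queue_map I w k)
          * indicator (B k) (dual_service I w k) else 1)
          (s M + int j + 1))"
        unfolding Y_def lindley_cyl_def p
        by (rule prod.cong) (auto simp: A'_def B'_def eq)
      also have "\<dots> = X p" by (subst prod_window) (auto simp: X_def p)
      finally show ?thesis .
    qed
    then show ?thesis unfolding eventually_sequentially by blast
  qed
  \<comment> \<open>How far to the left one must start depends on the starting value
    \<open>x\<close>. The limit is therefore taken for fixed \<open>x\<close> first and integrated
    over \<open>x\<close> afterwards, by dominated convergence both times.\<close>
  have lim: "(\<lambda>M. \<integral>\<^sup>+p. Y M x p \<partial>?P) \<longlonglongrightarrow> (\<integral>\<^sup>+p. X p \<partial>?P)" for x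
  proof (rule nn_integral_dominated_convergence[where w = "\<lambda>_. 1"])
    show "AE p in ?P. (\<lambda>M. Y M x p) \<longlonglongrightarrow> X p"
      using AE_admissible[OF pos] by eventually_elim (rule tendsto_eventually[OF Y_eq])
  qed (auto simp: Y_le P.emeasure_space_1)
  have [measurable]: "(\<lambda>x. \<integral>\<^sup>+p. Y M x p \<partial>?P) \<in> borel_measurable borel" for M
    unfolding Y_def by measurable
  have "(\<lambda>M. \<integral>\<^sup>+x. \<integral>\<^sup>+p. Y M x p \<partial>?P \<partial>expo g) \<longlonglongrightarrow> (\<integral>\<^sup>+x. \<integral>\<^sup>+p. X p \<partial>?P \<partial>expo g)"
  proof (rule nn_integral_dominated_convergence[where w = "\<lambda>_. 1"])
    show "AE x in expo g. (\<lambda>M. \<integral>\<^sup>+p. Y M x p \<partial>?P) \<longlonglongrightarrow> (\<integral>\<^sup>+p. X p \<partial>?P)"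
      using lim by simp
    have "(\<integral>\<^sup>+p. Y M x p \<partial>?P) \<le> (\<integral>\<^sup>+p. 1 \<partial>?P)" for M x
      by (intro nn_integral_mono Y_le)
    then show "AE x in expo g. (\<integral>\<^sup>+p. Y M x p \<partial>?P) \<le> 1" for M
      by (simp add: P.emeasure_space_1)
  qed (auto simp: Eg.emeasure_space_1[simplified] emeasure_expo_UNIV g)
  then have "?R = (\<integral>\<^sup>+x. \<integral>\<^sup>+p. X p \<partial>?P \<partial>expo g)"
    unfolding Y_int by (simp add: LIMSEQ_const_iff)
  then show ?thesis by (simp add: X_def emeasure_expo_UNIV g)
qed

lemma exp_seq_cylinder:
  assumes pos: "0 < a" "0 < b" and fin: "finite S"
    and A [measurable]: "\<And>k. A k \<in> sets borel" and B [measurable]: "\<And>k. B k \<in> sets borel"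
  shows "(\<integral>\<^sup>+p. (\<Prod>k\<in>S. indicator (A k) (fst p k)
      * indicator (B k) (snd p k)) \<partial>(exp_seq a \<Otimes>\<^sub>M exp_seq b))
    = (\<Prod>k\<in>S. emeasure (expo a) (A k) * emeasure (expo b) (B k))"
proof -
  interpret Sa: prob_space "exp_seq a" by (rule prob_space_exp_seq[OF pos(1)])
  interpret Sb: prob_space "exp_seq b" by (rule prob_space_exp_seq[OF pos(2)])
  have one: "(\<integral>\<^sup>+z. (\<Prod>k\<in>S. indicator (C k) (z k)) \<partial>exp_seq s) = (\<Prod>k\<in>S. emeasure (expo s) (C k))"
    if s: "0 < s" and [measurable]: "\<And>k. C k \<in> sets borel" for C s
  proof -
    interpret product_prob_space "\<lambda>_::int. expo s" UNIV
      by (rule product_prob_spaceI[OF prob_space_expo[OF s]])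
    have "(\<integral>\<^sup>+z. (\<Prod>k\<in>S. indicator (C k) (z k)) \<partial>exp_seq s)
        = (\<integral>\<^sup>+z. indicator {z \<in> space (exp_seq s). \<forall>k\<in>S. z k \<in> C k} z \<partial>exp_seq s)"
      by (intro nn_integral_cong) (auto simp: indicator_def prod_zero_iff[OF fin] fin)
    also have "\<dots> = emeasure (exp_seq s) {z \<in> space (exp_seq s). \<forall>k\<in>S. z k \<in> C k}"
      using fin by (intro nn_integral_indicator) measurable
    also have "\<dots> = (\<Prod>k\<in>S. emeasure (expo s) (C k))"
      unfolding exp_seq_def using fin by (intro emeasure_PiM_Collect) auto
    finally show ?thesis .
  qed
  have "(\<integral>\<^sup>+p. (\<Prod>k\<in>S. indicator (A k) (fst p k)
      * indicator (B k) (snd p k)) \<partial>(exp_seq a \<Otimes>\<^sub>M exp_seq b))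
    = (\<integral>\<^sup>+I. \<integral>\<^sup>+w. (\<Prod>k\<in>S. indicator (A k) (I k)) * (\<Prod>k\<in>S. indicator (B k) (w k)) \<partial>exp_seq b \<partial>exp_seq
        a)"
    by (subst Sb.nn_integral_fst[symmetric]) (auto simp: prod.distrib)
  also have "\<dots> = (\<Prod>k\<in>S. emeasure (expo a) (A k)) * (\<Prod>k\<in>S. emeasure (expo b) (B k))"
    by (simp add: nn_integral_cmult nn_integral_multc one pos)
  finally show ?thesis by (simp add: prod.distrib)
qed

theorem burke:
  assumes pos: "0 < b" "b < a"
  shows "distr (exp_seq a \<Otimes>\<^sub>M exp_seq b) seq2_space (\<lambda>p. (queue_map (fst p) (snd p), dual_service
      (fst p) (snd p)))
    = exp_seq a \<Otimes>\<^sub>M exp_seq b"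
proof (rule sym, rule measure_eqI_cylinder[where J = "UNIV :: (int + int) set"
      and X = "\<lambda>j p. case j of Inl k \<Rightarrow> fst p k | Inr k \<Rightarrow> snd p k"])
  have a: "0 < a" using pos by simp
  interpret Sa: prob_space "exp_seq a" by (rule prob_space_exp_seq[OF a])
  interpret Sb: prob_space "exp_seq b" by (rule prob_space_exp_seq[OF pos(1)])
  interpret P: prob_space "exp_seq a \<Otimes>\<^sub>M exp_seq b" by (rule prob_space_pair) unfold_locales
  let ?P = "exp_seq a \<Otimes>\<^sub>M exp_seq b"
  let ?X = "\<lambda>j p. case j of Inl k \<Rightarrow> fst p k | Inr k \<Rightarrow> snd p k"
  let ?q = "\<lambda>p. (queue_map (fst p) (snd p), dual_service (fst p) (snd p))"
  show "finite_measure ?P" by unfold_locales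
  show sets: "sets (distr ?P seq2_space ?q) = sets ?P"
    by (simp add: sets_pair_measure_cong[OF sets_exp_seq sets_exp_seq])
  show "?X j \<in> borel_measurable ?P" for j by (cases j) auto
  show "(\<lambda>x. x) \<in> M' \<rightarrow>\<^sub>M ?P"
    if "space M' = space ?P" and X: "\<And>j. j \<in> UNIV \<Longrightarrow> ?X j \<in> borel_measurable M'" for M'
  proof -
    have "(\<lambda>p. (fst p, snd p)) \<in> M' \<rightarrow>\<^sub>M seq2_space"
      using X[of "Inl _"] X[of "Inr _"] by (intro measurable_Pair measurable_seqI) auto
    then show ?thesis by (simp cong: measurable_cong_sets add: sets_pair_measure_cong[OF
        sets_exp_seq sets_exp_seq])
  qed
  fix S :: "(int + int) set" and A :: "int + int \<Rightarrow> real set"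
  assume fin: "finite S" and cl: "\<And>j. closed (A j)"
  then have A [measurable]: "A j \<in> sets borel" for j by simp
  \<comment> \<open>A cylinder may constrain a site in one of the two rows only; the other row is
    padded with \<open>UNIV\<close>, so that both rows are indexed by the same set of sites.\<close>
  define T where "T = {k. Inl k \<in> S \<or> Inr k \<in> S}"
  define A1 where "A1 k = (if Inl k \<in> S then A (Inl k) else UNIV)" for k
  define A2 where "A2 k = (if Inr k \<in> S then A (Inr k) else UNIV)" for k
  have T: "finite T"
  proof -
    have "T = Inl -` S \<union> Inr -` S" by (auto simp: T_def)
    then show ?thesis using fin by (simp add: finite_vimageI)
  qed
  have [measurable]: "A1 k \<in> sets borel" "A2 k \<in> sets borel" for k by (auto simp: A1_def A2_def)
  define C where "C = {p \<in> space ?P. \<forall>j\<in>S. ?X j p \<in> A j}"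
  have X [measurable]: "?X j \<in> borel_measurable seq2_space" for j by (cases j) auto
  have C': "C = {p \<in> space seq2_space. \<forall>j\<in>S. ?X j p \<in> A j}"
    by (simp add: C_def space_pair_measure)
  have C2 [measurable]: "C \<in> sets seq2_space" unfolding C' using fin by measurable
  have C1 [measurable]: "C \<in> sets ?P" using C2
    by (simp add: sets_pair_measure_cong[OF sets_exp_seq sets_exp_seq])
  have CT: "indicator C p = (\<Prod>k\<in>T. indicator (A1 k) (fst p k)
      * indicator (A2 k) (snd p k) :: ennreal)" for p
  proof -
    have "p \<in> C \<longleftrightarrow> (\<forall>k\<in>T. fst p k \<in> A1 k \<and> snd p k \<in> A2 k)"
    proof
      assume "p \<in> C"
      then have *: "\<And>j. j \<in> S \<Longrightarrow> ?X j p \<in> A j" by (auto simp: C_def)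
      show "\<forall>k\<in>T. fst p k \<in> A1 k \<and> snd p k \<in> A2 k"
        using *[of "Inl _"] *[of "Inr _"] by (auto simp: T_def A1_def A2_def)
    next
      assume *: "\<forall>k\<in>T. fst p k \<in> A1 k \<and> snd p k \<in> A2 k"
      have "?X j p \<in> A j" if "j \<in> S" for j
        using * that by (cases j) (auto simp: T_def A1_def A2_def split: if_splits)
      then show "p \<in> C" by (auto simp: C_def space_pair_measure)
    qed
    then show ?thesis using T by (auto simp: indicator_def prod_zero_iff)
  qed
  have "emeasure ?P C = (\<integral>\<^sup>+p. indicator C p \<partial>?P)" by simp
  also have "\<dots> = (\<Prod>k\<in>T. emeasure (expo a) (A1 k) * emeasure (expo b) (A2 k))"
    unfolding CT by (intro exp_seq_cylinder a pos T) auto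
  also have "\<dots> = (\<integral>\<^sup>+p. indicator C (?q p) \<partial>?P)"
    unfolding CT fst_conv snd_conv by (intro queue_cylinder[symmetric] pos T) auto
  also have "\<dots> = (\<integral>\<^sup>+p. indicator C p \<partial>distr ?P seq2_space ?q)"
    by (intro nn_integral_distr[symmetric]) auto
  also have "\<dots> = emeasure (distr ?P seq2_space ?q) C" by simp
  finally show "emeasure ?P {p \<in> space ?P. \<forall>j\<in>S. ?X j p \<in> A j}
    = emeasure (distr ?P seq2_space ?q) {p \<in> space ?P. \<forall>j\<in>S. ?X j p \<in> A j}"
    unfolding C_def .
qed

lemma nn_integral_burke:
  assumes pos: "0 < b" "b < a" and F [measurable]: "F \<in> borel_measurable seq2_space"
  shows "(\<integral>\<^sup>+I. \<integral>\<^sup>+w. F (queue_map I w, dual_service I w) \<partial>exp_seq b \<partial>exp_seq a)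
    = (\<integral>\<^sup>+I. \<integral>\<^sup>+w. F (I, w) \<partial>exp_seq b \<partial>exp_seq a)"
proof -
  interpret Sb: prob_space "exp_seq b" by (rule prob_space_exp_seq[OF pos(1)])
  have "(\<integral>\<^sup>+I. \<integral>\<^sup>+w. F (queue_map I w, dual_service I w) \<partial>exp_seq b \<partial>exp_seq a)
    = (\<integral>\<^sup>+p. F (queue_map (fst p) (snd p), dual_service (fst p) (snd p)) \<partial>(exp_seq a \<Otimes>\<^sub>M exp_seq
        b))"
    by (subst Sb.nn_integral_fst[symmetric]) auto
  also have "\<dots> = (\<integral>\<^sup>+p. F p \<partial>distr (exp_seq a \<Otimes>\<^sub>M exp_seq b) seq2_space (\<lambda>p. (queue_map (fst p) (snd
      p), dual_service (fst p) (snd p))))"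
    by (intro nn_integral_distr[symmetric]) auto
  also have "\<dots> = (\<integral>\<^sup>+I. \<integral>\<^sup>+w. F (I, w) \<partial>exp_seq b \<partial>exp_seq a)"
    unfolding burke[OF pos] by (subst Sb.nn_integral_fst) auto
  finally show ?thesis .
qed

section \<open>The multiline process\<close>

lemma measurable_config_component:
  assumes "f \<in> M \<rightarrow>\<^sub>M config_space n" "i \<in> {1..n}"
  shows "(\<lambda>x. f x i) \<in> M \<rightarrow>\<^sub>M seq_space"
  using measurable_compose[OF assms(1)[unfolded config_space_def] measurable_component_singleton[OF
      assms(2)]] .

lemma measurable_configI:
  assumes "\<And>i. i \<in> {1..n} \<Longrightarrow> (\<lambda>x. f x i) \<in> M \<rightarrow>\<^sub>M seq_space"
  shows "(\<lambda>x. \<lambda>i\<in>{1..n}. f x i) \<in> M \<rightarrow>\<^sub>M config_space n"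
  unfolding config_space_def using assms by (intro measurable_restrict)

lemma space_config: "I \<in> space (config_space n) \<longleftrightarrow> I \<in> extensional {1..n}"
  by (auto simp: config_space_def space_PiM PiE_def)

lemma measurable_config_upd:
  assumes f: "f \<in> M \<rightarrow>\<^sub>M config_space n" and g: "g \<in> M \<rightarrow>\<^sub>M seq_space"
  shows "(\<lambda>x. (f x)(Suc n := g x)) \<in> M \<rightarrow>\<^sub>M config_space (Suc n)"
  unfolding config_space_def
  by (rule measurable_fun_upd[OF _ f[unfolded config_space_def] g]) auto

lemma measurable_config_restrict:
  assumes f: "f \<in> M \<rightarrow>\<^sub>M config_space n" and "m \<le> n"
  shows "(\<lambda>x. restrict (f x) {1..m}) \<in> M \<rightarrow>\<^sub>M config_space m"
proof -
  have "(\<lambda>x. \<lambda>i\<in>{1..m}. f x i) \<in> M \<rightarrow>\<^sub>M config_space m"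
    using assms by (intro measurable_configI measurable_config_component[OF f]) auto
  then show ?thesis by simp
qed

lemma sets_exp_config [measurable_cong]: "sets (exp_config m \<sigma>) = sets (config_space m)"
  unfolding exp_config_def config_space_def by (intro sets_PiM_cong sets_exp_seq) auto

lemma space_exp_config: "space (exp_config m \<sigma>) = space (config_space m)"
  using sets_exp_config by (rule sets_eq_imp_space_eq)

lemma prob_space_exp_config: "(\<And>i. 0 < \<sigma> i) \<Longrightarrow> prob_space (exp_config m \<sigma>)"
  unfolding exp_config_def by (intro prob_space_PiM prob_space_exp_seq) auto

lemma nn_integral_exp_config_Suc:
  assumes \<sigma>: "\<And>i. 0 < \<sigma> i" and F: "F \<in> borel_measurable (config_space (Suc m))"
  shows "(\<integral>\<^sup>+I. F I \<partial>exp_config (Suc m) \<sigma>)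
    = (\<integral>\<^sup>+I. \<integral>\<^sup>+z. F (I(Suc m := z)) \<partial>exp_seq (\<sigma> (Suc m)) \<partial>exp_config m \<sigma>)"
proof -
  interpret product_prob_space "\<lambda>i. exp_seq (\<sigma> i)"
    by (rule product_prob_spaceI[OF prob_space_exp_seq[OF \<sigma>]])
  have ins: "{1..Suc m} = insert (Suc m) {1..m}" by auto
  have "F \<in> borel_measurable (exp_config (Suc m) \<sigma>)"
    using F unfolding measurable_cong_sets[OF sets_exp_config refl] .
  then have F': "F \<in> borel_measurable (Pi\<^sub>M (insert (Suc m) {1..m}) (\<lambda>i. exp_seq (\<sigma> i)))"
    unfolding exp_config_def ins .
  show ?thesis
    unfolding exp_config_def ins
    by (rule product_nn_integral_insert[OF _ _ F']) auto
qed

primrec drive :: "config \<Rightarrow> seq \<Rightarrow> nat \<Rightarrow> seq" where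
  "drive I w 0 = w"
| "drive I w (Suc i) = dual_service (I (Suc i)) (drive I w i)"

definition lines :: "nat \<Rightarrow> config \<Rightarrow> seq \<Rightarrow> config" where
  "lines m I w = (\<lambda>i\<in>{1..m}. queue_map (I i) (drive I w (i - 1)))"

lemma drive_cong:
  assumes "\<And>j. 1 \<le> j \<Longrightarrow> j \<le> i \<Longrightarrow> I j = I' j"
  shows "drive I w i = drive I' w i"
  using assms by (induction i) auto

lemma measurable_drive:
  assumes f: "f \<in> M \<rightarrow>\<^sub>M config_space n" and g: "g \<in> M \<rightarrow>\<^sub>M seq_space" and "i \<le> n"
  shows "(\<lambda>x. drive (f x) (g x) i) \<in> M \<rightarrow>\<^sub>M seq_space"
  using \<open>i \<le> n\<close>
proof (induction i)
  case (Suc i)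
  then show ?case
    using measurable_dual_service[OF measurable_config_component[OF f, of "Suc i"]] by simp
qed (simp add: g)

lemma measurable_lines:
  assumes f: "f \<in> M \<rightarrow>\<^sub>M config_space n" and g: "g \<in> M \<rightarrow>\<^sub>M seq_space" and "m \<le> n"
  shows "(\<lambda>x. lines m (f x) (g x)) \<in> M \<rightarrow>\<^sub>M config_space m"
  unfolding lines_def using \<open>m \<le> n\<close>
  by (intro measurable_configI measurable_queue_map measurable_config_component[OF f]
      measurable_drive[OF f g]) auto

lemma lines_Suc:
  "lines (Suc m) (I(Suc m := z)) w = (lines m I w)(Suc m := queue_map z (drive I w m))"
proof
  fix i
  have "drive (I(Suc m := z)) w j = drive I w j" if "j \<le> m" for j
    using that by (intro drive_cong) auto
  then show "lines (Suc m) (I(Suc m := z)) w i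
      = ((lines m I w)(Suc m := queue_map z (drive I w m))) i"
    by (auto simp: lines_def restrict_def le_Suc_eq)
qed

text \<open>Behind \<open>m\<close> lines the drive is independent of their outputs and again i.i.d.
  exponential with mean 1. The next line is thus served as if it were the first, and
  \<open>nn_integral_burke\<close> applies to it alone. All lines have mean above 1, so their mutual
  order does not matter here.\<close>

theorem multiline_burke:
  assumes \<sigma>: "\<And>i. 1 < \<sigma> i" and F: "F \<in> borel_measurable (config_space m \<Otimes>\<^sub>M seq_space)"
  shows "(\<integral>\<^sup>+I. \<integral>\<^sup>+w. F (lines m I w, drive I w m) \<partial>exp_seq 1 \<partial>exp_config m \<sigma>)
    = (\<integral>\<^sup>+I. \<integral>\<^sup>+w. F (I, w) \<partial>exp_seq 1 \<partial>exp_config m \<sigma>)"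
  using F
proof (induction m arbitrary: F)
  case 0
  have "lines 0 I w = I" if "I \<in> space (exp_config 0 \<sigma>)" for I w
    using that by (auto simp: lines_def space_exp_config space_config extensional_def)
  then show ?case by (intro nn_integral_cong) simp
next
  case (Suc m)
  have \<sigma>0: "0 < \<sigma> i" for i using \<sigma>[of i] by simp
  note F = Suc.prems
  interpret S1: prob_space "exp_seq 1" by (rule prob_space_exp_seq) simp
  interpret Ss: prob_space "exp_seq (\<sigma> (Suc m))" by (rule prob_space_exp_seq[OF \<sigma>0])
  interpret Em: prob_space "exp_config m \<sigma>" by (rule prob_space_exp_config[OF \<sigma>0])
  interpret P: pair_sigma_finite "exp_seq (\<sigma> (Suc m))" "exp_seq 1" ..
  \<comment> \<open>Line \<open>Suc m\<close> is integrated out first, which leaves a function of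
    the outputs and the drive of the first \<open>m\<close> lines, as in the induction
    hypothesis.\<close>
  define H where "H p = (\<integral>\<^sup>+z. F ((fst p)(Suc m := queue_map z (snd p)), dual_service z (snd p))
      \<partial>exp_seq (\<sigma> (Suc m)))"
    for p
  have H: "H \<in> borel_measurable (config_space m \<Otimes>\<^sub>M seq_space)"
    unfolding H_def
    by (rule Ss.borel_measurable_nn_integral, unfold split_beta',
        rule measurable_compose[OF measurable_Pair[OF measurable_config_upd] F]) measurable
  have "(\<integral>\<^sup>+I. \<integral>\<^sup>+w. F (lines (Suc m) I w, drive I w (Suc m)) \<partial>exp_seq 1 \<partial>exp_config (Suc m) \<sigma>)
      = (\<integral>\<^sup>+I. \<integral>\<^sup>+z. \<integral>\<^sup>+w. F ((lines m I w)(Suc m := queue_map z (drive I w m)), dual_service z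
          (drive I w m))
          \<partial>exp_seq 1 \<partial>exp_seq (\<sigma> (Suc m)) \<partial>exp_config m \<sigma>)"
  proof (subst nn_integral_exp_config_Suc[OF \<sigma>0])
    show "(\<lambda>I. \<integral>\<^sup>+w. F (lines (Suc m) I w, drive I w (Suc m)) \<partial>exp_seq 1) \<in> borel_measurable
        (config_space (Suc m))"
      by (rule S1.borel_measurable_nn_integral, unfold split_beta',
        rule measurable_compose[OF measurable_Pair[OF measurable_lines measurable_drive] F])
            measurable
  next
    have "drive (I(Suc m := z)) w m = drive I w m" for I z w
      by (intro drive_cong) auto
    then show "(\<integral>\<^sup>+I. \<integral>\<^sup>+z. \<integral>\<^sup>+w. F (lines (Suc m) (I(Suc m := z)) w, drive (I(Suc m := z)) w (Suc
        m))
          \<partial>exp_seq 1 \<partial>exp_seq (\<sigma> (Suc m)) \<partial>exp_config m \<sigma>)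
      = (\<integral>\<^sup>+I. \<integral>\<^sup>+z. \<integral>\<^sup>+w. F ((lines m I w)(Suc m := queue_map z (drive I w m)), dual_service z
          (drive I w m))
          \<partial>exp_seq 1 \<partial>exp_seq (\<sigma> (Suc m)) \<partial>exp_config m \<sigma>)"
      by (simp add: lines_Suc)
  qed
  also have "\<dots> = (\<integral>\<^sup>+I. \<integral>\<^sup>+w. H (lines m I w, drive I w m) \<partial>exp_seq 1 \<partial>exp_config m \<sigma>)"
    unfolding H_def fst_conv snd_conv
  proof (intro nn_integral_cong P.Fubini'[symmetric])
    fix I assume I: "I \<in> space (exp_config m \<sigma>)"
    then have [measurable]: "(\<lambda>p. I) \<in> exp_seq (\<sigma> (Suc m)) \<Otimes>\<^sub>M exp_seq 1 \<rightarrow>\<^sub>M config_space m"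
      by (simp add: space_exp_config)
    show "(\<lambda>(z, w). F ((lines m I w)(Suc m := queue_map z (drive I w m)), dual_service z (drive I w
        m)))
      \<in> borel_measurable (exp_seq (\<sigma> (Suc m)) \<Otimes>\<^sub>M exp_seq 1)"
      unfolding split_beta'
      by (rule measurable_compose[OF measurable_Pair[OF measurable_config_upd[OF
          measurable_lines[where n = m]
              measurable_queue_map[OF _ measurable_drive[where n = m]]]
            measurable_dual_service[OF _ measurable_drive[where n = m]]] F]) (simp_all, measurable)
  qed
  also have "\<dots> = (\<integral>\<^sup>+I. \<integral>\<^sup>+w. H (I, w) \<partial>exp_seq 1 \<partial>exp_config m \<sigma>)"
    by (rule Suc.IH[OF H])
  also have "\<dots> = (\<integral>\<^sup>+I. \<integral>\<^sup>+z. \<integral>\<^sup>+w. F (I(Suc m := queue_map z w), dual_service z w) \<partial>exp_seq 1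
      \<partial>exp_seq (\<sigma> (Suc m)) \<partial>exp_config m \<sigma>)"
    unfolding H_def fst_conv snd_conv
  proof (intro nn_integral_cong P.Fubini')
    fix I assume I: "I \<in> space (exp_config m \<sigma>)"
    then have [measurable]: "(\<lambda>p. I) \<in> exp_seq (\<sigma> (Suc m)) \<Otimes>\<^sub>M exp_seq 1 \<rightarrow>\<^sub>M config_space m"
      by (simp add: space_exp_config)
    show "(\<lambda>(z, w). F (I(Suc m := queue_map z w), dual_service z w)) \<in> borel_measurable (exp_seq (\<sigma>
        (Suc m)) \<Otimes>\<^sub>M exp_seq 1)"
      unfolding split_beta'
      by (rule measurable_compose[OF measurable_Pair[OF measurable_config_upd] F]) measurable
  qed
  also have "\<dots> = (\<integral>\<^sup>+I. \<integral>\<^sup>+z. \<integral>\<^sup>+w. F (I(Suc m := z), w) \<partial>exp_seq 1 \<partial>exp_seq (\<sigma> (Suc m)) \<partial>exp_config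
      m \<sigma>)"
  proof (rule nn_integral_cong)
    fix I assume I: "I \<in> space (exp_config m \<sigma>)"
    then have [measurable]: "(\<lambda>p. I) \<in> seq2_space \<rightarrow>\<^sub>M config_space m"
      by (simp add: space_exp_config)
    define F' where "F' p = F (I(Suc m := fst p), snd p)" for p
    have "F' \<in> borel_measurable seq2_space"
      unfolding F'_def by (rule measurable_compose[OF measurable_Pair[OF measurable_config_upd] F])
          measurable
    from nn_integral_burke[OF _ \<sigma> this]
    show "(\<integral>\<^sup>+z. \<integral>\<^sup>+w. F (I(Suc m := queue_map z w), dual_service z w) \<partial>exp_seq 1 \<partial>exp_seq (\<sigma> (Suc
        m)))
      = (\<integral>\<^sup>+z. \<integral>\<^sup>+w. F (I(Suc m := z), w) \<partial>exp_seq 1 \<partial>exp_seq (\<sigma> (Suc m)))"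
      by (simp add: F'_def)
  qed
  also have "\<dots> = (\<integral>\<^sup>+I. \<integral>\<^sup>+w. F (I, w) \<partial>exp_seq 1 \<partial>exp_config (Suc m) \<sigma>)"
  proof (rule nn_integral_exp_config_Suc[OF \<sigma>0, symmetric])
    show "(\<lambda>I. \<integral>\<^sup>+w. F (I, w) \<partial>exp_seq 1) \<in> borel_measurable (config_space (Suc m))"
      by (rule S1.borel_measurable_nn_integral, unfold split_beta', rule measurable_compose[OF
          measurable_Pair F]) measurable
  qed
  finally show ?case .
qed

section \<open>The multiclass map, queue by queue\<close>

lemma nn_integral_exp_config_restrict:
  assumes \<sigma>: "\<And>i. 0 < \<sigma> i" and "i \<le> m" and F: "F \<in> borel_measurable (config_space i)"
  shows "(\<integral>\<^sup>+I. F (restrict I {1..i}) \<partial>exp_config m \<sigma>) = (\<integral>\<^sup>+I. F I \<partial>exp_config i \<sigma>)"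
  using \<open>i \<le> m\<close>
proof (induction m rule: dec_induct)
  case base
  have "restrict I {1..i} = I" if "I \<in> space (exp_config i \<sigma>)" for I
    using that by (simp add: space_exp_config space_config extensional_restrict)
  then show ?case by (intro nn_integral_cong) simp
next
  case (step m)
  interpret Ss: prob_space "exp_seq (\<sigma> (Suc m))" by (rule prob_space_exp_seq[OF \<sigma>])
  have "(\<integral>\<^sup>+I. F (restrict I {1..i}) \<partial>exp_config (Suc m) \<sigma>)
    = (\<integral>\<^sup>+I. \<integral>\<^sup>+z. F (restrict (I(Suc m := z)) {1..i}) \<partial>exp_seq (\<sigma> (Suc m)) \<partial>exp_config m \<sigma>)"
    using step by (intro nn_integral_exp_config_Suc[OF \<sigma>] measurable_compose[OF
        measurable_config_restrict[OF measurable_ident] F, unfolded id_def]) simp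
  also have "\<dots> = (\<integral>\<^sup>+I. F (restrict I {1..i}) \<partial>exp_config m \<sigma>)"
  proof -
    have "restrict (I(Suc m := z)) {1..i} = restrict I {1..i}" for I :: config and z
      using step by (auto simp: restrict_def)
    then show ?thesis by (simp add: Ss.emeasure_space_1[simplified])
  qed
  finally show ?case using step.IH by (rule trans)
qed

text \<open>Line \<open>i\<close> after \<open>d\<close> queues, served in turn by the lines
  \<open>i - 1\<close>, ..., \<open>i - d\<close>. Since \<open>queue_iter\<close> gets its
  arguments in reversed order, fixing \<open>i\<close> and counting the queues gives inductions in
  which only \<open>d\<close> moves.\<close>

primrec tandem :: "nat \<Rightarrow> config \<Rightarrow> nat \<Rightarrow> seq" where
  "tandem i I 0 = I i"
| "tandem i I (Suc d) = queue_map (tandem i I d) (I (i - Suc d))"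

lemma queue_iter_tandem: "queue_iter (Suc d) (\<lambda>j. I (i + 1 - j)) = tandem i I d"
  by (induction d) auto

lemma multi_queue_tandem: "i \<in> {1..m} \<Longrightarrow> multi_queue m I i = tandem i I (i - 1)"
  using queue_iter_tandem[of "i - 1" I i] by (simp add: multi_queue_def)

lemma measurable_tandem:
  assumes f: "f \<in> M \<rightarrow>\<^sub>M config_space n" and "i \<le> n" "d < i"
  shows "(\<lambda>x. tandem i (f x) d) \<in> M \<rightarrow>\<^sub>M seq_space"
  using \<open>d < i\<close>
proof (induction d)
  case 0
  then show ?case using measurable_config_component[OF f, of i] \<open>i \<le> n\<close> by simp
next
  case (Suc d)
  have "i - Suc d \<in> {1..n}" using Suc.prems \<open>i \<le> n\<close> by auto
  with Suc show ?case
    using measurable_queue_map[OF Suc.IH measurable_config_component[OF f, of "i - Suc d"]] by simp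
qed

text \<open>Each queue consumes one line: by Burke's theorem its output has the law of its input,
  mean \<open>\<sigma> i\<close>, and it has nothing to do with the lines not yet used. The
  statement keeps those lines in \<open>F\<close>, because the next queue is served by the last of
  them.\<close>

lemma nn_integral_tandem:
  assumes \<sigma>: "\<And>i. 0 < \<sigma> i" and mono: "strict_mono_on {1..m} \<sigma>" and i: "i \<in> {1..m}"
    and "d < i" and F: "F \<in> borel_measurable (config_space (i - 1 - d) \<Otimes>\<^sub>M seq_space)"
  shows "(\<integral>\<^sup>+I. F (restrict I {1..i - 1 - d}, tandem i I d) \<partial>exp_config m \<sigma>)
    = (\<integral>\<^sup>+I. \<integral>\<^sup>+X. F (I, X) \<partial>exp_seq (\<sigma> i) \<partial>exp_config (i - 1 - d) \<sigma>)"
  using \<open>d < i\<close> F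
proof (induction d arbitrary: F)
  case 0
  obtain p where p: "i = Suc p" using i by (cases i) auto
  note F = 0(2)[unfolded p, simplified]
  define F' where "F' I = F (restrict I {1..p}, I (Suc p))" for I :: config
  have F': "F' \<in> borel_measurable (config_space (Suc p))"
    unfolding F'_def
    by (rule measurable_compose[OF measurable_Pair[OF measurable_config_restrict[where f = "\<lambda>I. I"
        and n = "Suc p"]
        measurable_config_component[where f = "\<lambda>I. I" and n = "Suc p"]] F]) auto
  have "(\<integral>\<^sup>+I. F (restrict I {1..p}, I (Suc p)) \<partial>exp_config m \<sigma>)
      = (\<integral>\<^sup>+I. F' (restrict I {1..Suc p}) \<partial>exp_config m \<sigma>)"
    by (intro nn_integral_cong) (simp add: F'_def Int_absorb1)
  also have "\<dots> = (\<integral>\<^sup>+I. F' I \<partial>exp_config (Suc p) \<sigma>)"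
    using i p by (intro nn_integral_exp_config_restrict[OF \<sigma> _ F']) simp
  also have "\<dots> = (\<integral>\<^sup>+I. \<integral>\<^sup>+z. F' (I(Suc p := z)) \<partial>exp_seq (\<sigma> (Suc p)) \<partial>exp_config p \<sigma>)"
    by (rule nn_integral_exp_config_Suc[OF \<sigma> F'])
  also have "\<dots> = (\<integral>\<^sup>+I. \<integral>\<^sup>+X. F (I, X) \<partial>exp_seq (\<sigma> (Suc p)) \<partial>exp_config p \<sigma>)"
  proof -
    have "restrict (I(Suc p := z)) {1..p} = I" if "I \<in> space (exp_config p \<sigma>)" for I :: config and z
      using that by (auto simp: space_exp_config space_config extensional_def restrict_def)
    then show ?thesis by (intro nn_integral_cong) (simp add: F'_def)
  qed
  finally show ?case by (simp only: p tandem.simps diff_Suc_1 diff_zero)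
next
  case (Suc d)
  define q where "q = i - 1 - Suc d"
  have q: "i - 1 - d = Suc q" "i - Suc d = Suc q" using Suc.prems by (auto simp: q_def)
  note F = Suc.prems(2)[folded q_def]
  \<comment> \<open>Strict monotonicity of the means is what makes this queue stable: the server has
    the smaller mean.\<close>
  have less: "\<sigma> (Suc q) < \<sigma> i" using i Suc.prems q
    by (intro strict_mono_onD[OF mono]) auto
  interpret Si: prob_space "exp_seq (\<sigma> i)" by (rule prob_space_exp_seq[OF \<sigma>])
  interpret Sq: prob_space "exp_seq (\<sigma> (Suc q))" by (rule prob_space_exp_seq[OF \<sigma>])
  interpret P: pair_sigma_finite "exp_seq (\<sigma> (Suc q))" "exp_seq (\<sigma> i)" ..
  define F' where "F' p = F (restrict (fst p) {1..q}, queue_map (snd p) (fst p (Suc q)))" for p ::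
      "config \<times> seq"
  have F': "F' \<in> borel_measurable (config_space (Suc q) \<Otimes>\<^sub>M seq_space)"
    unfolding F'_def
    by (rule measurable_compose[OF measurable_Pair[OF measurable_config_restrict
        measurable_queue_map[OF _ measurable_config_component]] F])
      auto
  have "(\<integral>\<^sup>+I. F (restrict I {1..q}, tandem i I (Suc d)) \<partial>exp_config m \<sigma>)
    = (\<integral>\<^sup>+I. F' (restrict I {1..Suc q}, tandem i I d) \<partial>exp_config m \<sigma>)"
    by (intro nn_integral_cong) (simp add: F'_def q Int_absorb1)
  also have "\<dots> = (\<integral>\<^sup>+I. \<integral>\<^sup>+X. F' (I, X) \<partial>exp_seq (\<sigma> i) \<partial>exp_config (Suc q) \<sigma>)"
    by (rule Suc.IH[unfolded q, OF Suc_lessD[OF Suc.prems(1)] F'])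
  also have "\<dots> = (\<integral>\<^sup>+I. \<integral>\<^sup>+z. \<integral>\<^sup>+X. F' (I(Suc q := z), X) \<partial>exp_seq (\<sigma> i) \<partial>exp_seq (\<sigma> (Suc q))
      \<partial>exp_config q \<sigma>)"
  proof (rule nn_integral_exp_config_Suc[OF \<sigma>])
    show "(\<lambda>I. \<integral>\<^sup>+X. F' (I, X) \<partial>exp_seq (\<sigma> i)) \<in> borel_measurable (config_space (Suc q))"
      by (rule Si.borel_measurable_nn_integral, unfold split_beta', rule measurable_compose[OF
          measurable_Pair F']) measurable
  qed
  also have "\<dots> = (\<integral>\<^sup>+I. \<integral>\<^sup>+X. F (I, X) \<partial>exp_seq (\<sigma> i) \<partial>exp_config q \<sigma>)"
  proof (rule nn_integral_cong)
    fix I assume I: "I \<in> space (exp_config q \<sigma>)"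
    then have [measurable]: "(\<lambda>p. I) \<in> M \<rightarrow>\<^sub>M config_space q" for M :: "(seq \<times> seq) measure"
      by (simp add: space_exp_config)
    have r: "restrict I {1..q} = I"
      using I by (simp add: space_exp_config space_config extensional_restrict)
    define G where "G p = F (I, fst p)" for p :: "seq \<times> seq"
    have G [measurable]: "G \<in> borel_measurable seq2_space"
      unfolding G_def by (rule measurable_compose[OF measurable_Pair F]) measurable
    have "(\<integral>\<^sup>+z. \<integral>\<^sup>+X. F' (I(Suc q := z), X) \<partial>exp_seq (\<sigma> i) \<partial>exp_seq (\<sigma> (Suc q)))
      = (\<integral>\<^sup>+z. \<integral>\<^sup>+X. G (queue_map X z, dual_service X z) \<partial>exp_seq (\<sigma> i) \<partial>exp_seq (\<sigma> (Suc q)))"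
      using r by (simp add: F'_def G_def)
    also have "\<dots> = (\<integral>\<^sup>+X. \<integral>\<^sup>+z. G (queue_map X z, dual_service X z) \<partial>exp_seq (\<sigma> (Suc q)) \<partial>exp_seq (\<sigma>
        i))"
      by (intro P.Fubini'[symmetric]) measurable
    also have "\<dots> = (\<integral>\<^sup>+X. \<integral>\<^sup>+z. G (X, z) \<partial>exp_seq (\<sigma> (Suc q)) \<partial>exp_seq (\<sigma> i))"
      by (rule nn_integral_burke[OF \<sigma> less G])
    also have "\<dots> = (\<integral>\<^sup>+X. F (I, X) \<partial>exp_seq (\<sigma> i))"
      by (simp add: G_def Sq.emeasure_space_1[simplified])
    finally show "(\<integral>\<^sup>+z. \<integral>\<^sup>+X. F' (I(Suc q := z), X) \<partial>exp_seq (\<sigma> i) \<partial>exp_seq (\<sigma> (Suc q)))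
      = (\<integral>\<^sup>+X. F (I, X) \<partial>exp_seq (\<sigma> i))" .
  qed
  finally show ?case unfolding q_def .
qed

text \<open>The three sequences come from disjoint inputs: the tandem from the lines
  \<open>q + 2\<close>, ..., \<open>i\<close>, the middle one is line \<open>q + 1\<close>, and the
  drive uses \<open>w\<close> and the lines \<open>1\<close>, ..., \<open>q\<close>. Hence they are
  independent, and the laws of the tandem and of the drive are known.\<close>

lemma nn_integral_tandem_drive:
  assumes \<sigma>: "\<And>i. 1 < \<sigma> i" and mono: "strict_mono_on {1..m} \<sigma>" and i: "i \<in> {1..m}"
    and d: "i = Suc (Suc (q + d))"
    and G [measurable]: "G \<in> borel_measurable (seq_space \<Otimes>\<^sub>M seq2_space)"
  shows "(\<integral>\<^sup>+I. \<integral>\<^sup>+w. G (tandem i I d, I (Suc q), drive I w q) \<partial>exp_seq 1 \<partial>exp_config m \<sigma>)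
    = (\<integral>\<^sup>+X. \<integral>\<^sup>+z. \<integral>\<^sup>+w. G (X, z, w) \<partial>exp_seq 1 \<partial>exp_seq (\<sigma> (Suc q)) \<partial>exp_seq (\<sigma> i))"
proof -
  have \<sigma>0: "0 < \<sigma> i" for i using \<sigma>[of i] by simp
  interpret S1: prob_space "exp_seq 1" by (rule prob_space_exp_seq) simp
  interpret Si: prob_space "exp_seq (\<sigma> i)" by (rule prob_space_exp_seq[OF \<sigma>0])
  interpret Sq: prob_space "exp_seq (\<sigma> (Suc q))" by (rule prob_space_exp_seq[OF \<sigma>0])
  interpret Eq: prob_space "exp_config q \<sigma>" by (rule prob_space_exp_config[OF \<sigma>0])
  interpret P1: pair_sigma_finite "exp_seq 1" "exp_seq (\<sigma> i)" ..
  interpret P2: pair_sigma_finite "exp_seq (\<sigma> (Suc q))" "exp_seq 1" ..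
  interpret P3: pair_sigma_finite "exp_seq (\<sigma> (Suc q))" "exp_seq (\<sigma> i)" ..
  have q: "i - 1 - d = Suc q" and di: "d < i" using d by auto
  define F where "F p = (\<integral>\<^sup>+w. G (snd p, fst p (Suc q), drive (fst p) w q) \<partial>exp_seq 1)" for p ::
      "config \<times> seq"
  have F: "F \<in> borel_measurable (config_space (Suc q) \<Otimes>\<^sub>M seq_space)"
    unfolding F_def
    by (rule S1.borel_measurable_nn_integral, unfold split_beta',
        rule measurable_compose[OF measurable_Pair[OF _ measurable_Pair[OF
            measurable_config_component[where n = "Suc q"] measurable_drive[where n = "Suc q"]]] G])
      auto
  have "(\<integral>\<^sup>+I. \<integral>\<^sup>+w. G (tandem i I d, I (Suc q), drive I w q) \<partial>exp_seq 1 \<partial>exp_config m \<sigma>)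
    = (\<integral>\<^sup>+I. F (restrict I {1..Suc q}, tandem i I d) \<partial>exp_config m \<sigma>)"
  proof -
    have "drive (restrict I {1..Suc q}) w q = drive I w q" for I w
      by (rule drive_cong) auto
    then show ?thesis unfolding F_def fst_conv snd_conv by simp
  qed
  also have "\<dots> = (\<integral>\<^sup>+I. \<integral>\<^sup>+X. F (I, X) \<partial>exp_seq (\<sigma> i) \<partial>exp_config (Suc q) \<sigma>)"
    by (rule nn_integral_tandem[OF \<sigma>0 mono i di, unfolded q, OF F])
  also have "\<dots> = (\<integral>\<^sup>+I. \<integral>\<^sup>+z. \<integral>\<^sup>+X. F (I(Suc q := z), X) \<partial>exp_seq (\<sigma> i) \<partial>exp_seq (\<sigma> (Suc q))
      \<partial>exp_config q \<sigma>)"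
  proof (rule nn_integral_exp_config_Suc[OF \<sigma>0])
    show "(\<lambda>I. \<integral>\<^sup>+X. F (I, X) \<partial>exp_seq (\<sigma> i)) \<in> borel_measurable (config_space (Suc q))"
      by (rule Si.borel_measurable_nn_integral, unfold split_beta', rule measurable_compose[OF
          measurable_Pair F]) measurable
  qed
  also have "\<dots> = (\<integral>\<^sup>+I. \<integral>\<^sup>+w. \<integral>\<^sup>+z. \<integral>\<^sup>+X. G (X, z, drive I w q) \<partial>exp_seq (\<sigma> i) \<partial>exp_seq (\<sigma> (Suc q))
      \<partial>exp_seq 1 \<partial>exp_config q \<sigma>)"
  proof (rule nn_integral_cong)
    fix I assume "I \<in> space (exp_config q \<sigma>)"
    then have I: "(\<lambda>p. I) \<in> M \<rightarrow>\<^sub>M config_space q" for M :: "seq measure"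
      by (simp add: space_exp_config)
    have [measurable]: "(\<lambda>w. drive I w q) \<in> seq_space \<rightarrow>\<^sub>M seq_space"
      by (rule measurable_drive[OF I]) auto
    have "drive (I(Suc q := z)) w q = drive I w q" for z w
      by (rule drive_cong) auto
    then have "(\<integral>\<^sup>+z. \<integral>\<^sup>+X. F (I(Suc q := z), X) \<partial>exp_seq (\<sigma> i) \<partial>exp_seq (\<sigma> (Suc q)))
      = (\<integral>\<^sup>+z. \<integral>\<^sup>+X. \<integral>\<^sup>+w. G (X, z, drive I w q) \<partial>exp_seq 1 \<partial>exp_seq (\<sigma> i) \<partial>exp_seq (\<sigma> (Suc q)))"
      by (simp add: F_def)
    also have "\<dots> = (\<integral>\<^sup>+z. \<integral>\<^sup>+w. \<integral>\<^sup>+X. G (X, z, drive I w q) \<partial>exp_seq (\<sigma> i) \<partial>exp_seq 1 \<partial>exp_seq (\<sigma>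
        (Suc q)))"
      by (intro nn_integral_cong P1.Fubini') measurable
    also have "\<dots> = (\<integral>\<^sup>+w. \<integral>\<^sup>+z. \<integral>\<^sup>+X. G (X, z, drive I w q) \<partial>exp_seq (\<sigma> i) \<partial>exp_seq (\<sigma> (Suc q))
        \<partial>exp_seq 1)"
      by (rule P2.Fubini'[symmetric]) measurable
    finally show "(\<integral>\<^sup>+z. \<integral>\<^sup>+X. F (I(Suc q := z), X) \<partial>exp_seq (\<sigma> i) \<partial>exp_seq (\<sigma> (Suc q))) = \<dots>" .
  qed
  also have "\<dots> = (\<integral>\<^sup>+I. \<integral>\<^sup>+w. \<integral>\<^sup>+z. \<integral>\<^sup>+X. G (X, z, w) \<partial>exp_seq (\<sigma> i) \<partial>exp_seq (\<sigma> (Suc q)) \<partial>exp_seq 1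
      \<partial>exp_config q \<sigma>)"
    using multiline_burke[OF \<sigma>, where m = q and F =
        "\<lambda>p. \<integral>\<^sup>+z. \<integral>\<^sup>+X. G (X, z, snd p) \<partial>exp_seq (\<sigma> i) \<partial>exp_seq (\<sigma> (Suc q))"] by simp
  also have "\<dots> = (\<integral>\<^sup>+w. \<integral>\<^sup>+z. \<integral>\<^sup>+X. G (X, z, w) \<partial>exp_seq (\<sigma> i) \<partial>exp_seq (\<sigma> (Suc q)) \<partial>exp_seq 1)"
    by (simp add: Eq.emeasure_space_1)
  also have "\<dots> = (\<integral>\<^sup>+z. \<integral>\<^sup>+w. \<integral>\<^sup>+X. G (X, z, w) \<partial>exp_seq (\<sigma> i) \<partial>exp_seq 1 \<partial>exp_seq (\<sigma> (Suc q)))"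
    by (rule P2.Fubini') measurable
  also have "\<dots> = (\<integral>\<^sup>+z. \<integral>\<^sup>+X. \<integral>\<^sup>+w. G (X, z, w) \<partial>exp_seq 1 \<partial>exp_seq (\<sigma> i) \<partial>exp_seq (\<sigma> (Suc q)))"
    by (intro nn_integral_cong P1.Fubini'[symmetric]) measurable
  also have "\<dots> = (\<integral>\<^sup>+X. \<integral>\<^sup>+z. \<integral>\<^sup>+w. G (X, z, w) \<partial>exp_seq 1 \<partial>exp_seq (\<sigma> (Suc q)) \<partial>exp_seq (\<sigma> i))"
    by (rule P3.Fubini'[symmetric]) measurable
  finally show ?thesis .
qed

section \<open>Almost sure stability of all queues involved\<close>

definition interchangeable :: "seq \<times> seq \<times> seq \<Rightarrow> bool" where
  "interchangeable = (\<lambda>(X, I, w). queue_stable I w \<and> queue_stable X I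
      \<and> queue_stable (queue_map X I) w \<and>
    queue_stable X (dual_service I w) \<and> queue_stable (queue_map X (dual_service I w)) (queue_map I
        w))"

lemma measurable_interchangeable [measurable]:
    "Measurable.pred (seq_space \<Otimes>\<^sub>M seq2_space) interchangeable"
  unfolding interchangeable_def by measurable

text \<open>With values in \<open>ennreal\<close>, instability can be transported through the
  integral form of Burke's theorem: that an output is stable almost surely becomes the same claim
  for an exponential sequence.\<close>

definition unstable :: "seq \<times> seq \<Rightarrow> ennreal" where
  "unstable = (\<lambda>(I, w). if queue_stable I w then 0 else 1)"

lemma measurable_unstable [measurable]: "unstable \<in> borel_measurable seq2_space"
  unfolding unstable_def by measurable

lemma nn_integral_unstable:
  assumes "0 < b" "b < a"
  shows "(\<integral>\<^sup>+I. \<integral>\<^sup>+w. unstable (I, w) \<partial>exp_seq b \<partial>exp_seq a) = 0"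
proof -
  interpret Sb: prob_space "exp_seq b" using assms by (intro prob_space_exp_seq) simp
  have "(\<integral>\<^sup>+I. \<integral>\<^sup>+w. unstable (I, w) \<partial>exp_seq b \<partial>exp_seq a)
      = (\<integral>\<^sup>+p. unstable p \<partial>(exp_seq a \<Otimes>\<^sub>M exp_seq b))"
    by (rule Sb.nn_integral_fst) measurable
  also have "AE p in exp_seq a \<Otimes>\<^sub>M exp_seq b. unstable p = 0"
    using AE_admissible[OF assms] by eventually_elim (auto simp: unstable_def admissible_def)
  then have "(\<integral>\<^sup>+p. unstable p \<partial>(exp_seq a \<Otimes>\<^sub>M exp_seq b)) = (\<integral>\<^sup>+p. 0 \<partial>(exp_seq a \<Otimes>\<^sub>M exp_seq b))"
    by (rule nn_integral_cong_AE)
  finally show ?thesis by simp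
qed

text \<open>A union bound over the five queues. At most two uses of Burke's theorem turn each of
  them into a queue with independent exponential arrivals and services, the services having the
  smaller mean.\<close>

lemma nn_integral_interchangeable:
  assumes c: "0 < c" "c < b" "b < a"
  shows "(\<integral>\<^sup>+X. \<integral>\<^sup>+z. \<integral>\<^sup>+w. indicator {p. \<not> interchangeable p} (X, z, w) \<partial>exp_seq c \<partial>exp_seq b
      \<partial>exp_seq a) = 0"
proof -
  have pos: "0 < a" "0 < b" "c < a" using c by auto
  interpret Sa: prob_space "exp_seq a" by (rule prob_space_exp_seq[OF pos(1)])
  interpret Sb: prob_space "exp_seq b" by (rule prob_space_exp_seq[OF pos(2)])
  interpret Sc: prob_space "exp_seq c" by (rule prob_space_exp_seq[OF c(1)])
  interpret Pab: pair_sigma_finite "exp_seq a" "exp_seq b" ..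
  interpret Pbc: pair_sigma_finite "exp_seq b" "exp_seq c" ..
  have 1: "(\<integral>\<^sup>+X. \<integral>\<^sup>+z. \<integral>\<^sup>+w. unstable (z, w) \<partial>exp_seq c \<partial>exp_seq b \<partial>exp_seq a) = 0"
    by (simp add: nn_integral_unstable[OF c(1,2)])
  have 2: "(\<integral>\<^sup>+X. \<integral>\<^sup>+z. \<integral>\<^sup>+w. unstable (X, z) \<partial>exp_seq c \<partial>exp_seq b \<partial>exp_seq a) = 0"
    by (simp add: nn_integral_unstable[OF pos(2) c(3)] Sc.emeasure_space_1[simplified])
  have 3: "(\<integral>\<^sup>+X. \<integral>\<^sup>+z. \<integral>\<^sup>+w. unstable (queue_map X z, w) \<partial>exp_seq c \<partial>exp_seq b \<partial>exp_seq a) = 0"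
    using nn_integral_burke[OF pos(2) c(3), of "\<lambda>p. \<integral>\<^sup>+w. unstable (fst p, w) \<partial>exp_seq c"]
    by (simp add: nn_integral_unstable[OF c(1) pos(3)] Sb.emeasure_space_1[simplified])
  have 4: "(\<integral>\<^sup>+X. \<integral>\<^sup>+z. \<integral>\<^sup>+w. unstable (X, dual_service z w) \<partial>exp_seq c \<partial>exp_seq b \<partial>exp_seq a) = 0"
  proof -
    have "(\<integral>\<^sup>+z. \<integral>\<^sup>+w. unstable (X, dual_service z w) \<partial>exp_seq c \<partial>exp_seq b)
        = (\<integral>\<^sup>+w. unstable (X, w) \<partial>exp_seq c)" for X
      using nn_integral_burke[OF c(1,2), of "\<lambda>p. unstable (X, snd p)"]
      by (simp add: Sb.emeasure_space_1[simplified])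
    then show ?thesis by (simp add: nn_integral_unstable[OF c(1) pos(3)])
  qed
  \<comment> \<open>Burke for \<open>(z, w)\<close> replaces the output and the dual service by
    \<open>z\<close> and \<open>w\<close>. After Fubini, Burke for \<open>(X, w)\<close> replaces
    \<open>queue_map X w\<close> by \<open>X\<close>.\<close>
  have 5: "(\<integral>\<^sup>+X. \<integral>\<^sup>+z. \<integral>\<^sup>+w. unstable (queue_map X (dual_service z w), queue_map z w) \<partial>exp_seq c
      \<partial>exp_seq b \<partial>exp_seq a) = 0"
  proof -
    have "(\<integral>\<^sup>+z. \<integral>\<^sup>+w. unstable (queue_map X (dual_service z w), queue_map z w) \<partial>exp_seq c \<partial>exp_seq
        b)
      = (\<integral>\<^sup>+z. \<integral>\<^sup>+w. unstable (queue_map X w, z) \<partial>exp_seq c \<partial>exp_seq b)" for X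
      using nn_integral_burke[OF c(1,2), of "\<lambda>p. unstable (queue_map X (snd p), fst p)"] by simp
    then have "(\<integral>\<^sup>+X. \<integral>\<^sup>+z. \<integral>\<^sup>+w. unstable (queue_map X (dual_service z w), queue_map z w) \<partial>exp_seq
        c \<partial>exp_seq b \<partial>exp_seq a)
      = (\<integral>\<^sup>+X. \<integral>\<^sup>+z. \<integral>\<^sup>+w. unstable (queue_map X w, z) \<partial>exp_seq c \<partial>exp_seq b \<partial>exp_seq a)" by simp
    also have "\<dots> = (\<integral>\<^sup>+X. \<integral>\<^sup>+w. \<integral>\<^sup>+z. unstable (queue_map X w, z) \<partial>exp_seq b \<partial>exp_seq c \<partial>exp_seq a)"
      by (intro nn_integral_cong Pbc.Fubini'[symmetric]) measurable
    also have "\<dots> = (\<integral>\<^sup>+X. \<integral>\<^sup>+w. \<integral>\<^sup>+z. unstable (X, z) \<partial>exp_seq b \<partial>exp_seq c \<partial>exp_seq a)"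
      using nn_integral_burke[OF c(1) pos(3), of "\<lambda>p. \<integral>\<^sup>+z. unstable (fst p, z) \<partial>exp_seq b"] by simp
    also have "\<dots> = 0"
      by (simp add: nn_integral_unstable[OF pos(2) c(3)] Sc.emeasure_space_1[simplified])
    finally show ?thesis .
  qed
  have add0: "(\<integral>\<^sup>+X. \<integral>\<^sup>+z. \<integral>\<^sup>+w. F X z w + G X z w \<partial>exp_seq c \<partial>exp_seq b \<partial>exp_seq a) = 0"
    if F: "(\<lambda>(X, z, w). F X z w) \<in> borel_measurable (seq_space \<Otimes>\<^sub>M seq2_space)"
      and G: "(\<lambda>(X, z, w). G X z w) \<in> borel_measurable (seq_space \<Otimes>\<^sub>M seq2_space)"
      and F0: "(\<integral>\<^sup>+X. \<integral>\<^sup>+z. \<integral>\<^sup>+w. F X z w \<partial>exp_seq c \<partial>exp_seq b \<partial>exp_seq a) = 0"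
      and G0: "(\<integral>\<^sup>+X. \<integral>\<^sup>+z. \<integral>\<^sup>+w. G X z w \<partial>exp_seq c \<partial>exp_seq b \<partial>exp_seq a) = 0"
    for F G :: "seq \<Rightarrow> seq \<Rightarrow> seq \<Rightarrow> ennreal"
  proof -
    define F' where "F' = (\<lambda>(X, z, w). F X z w)"
    define G' where "G' = (\<lambda>(X, z, w). G X z w)"
    have [measurable]: "F' \<in> borel_measurable (seq_space \<Otimes>\<^sub>M seq2_space)"
        "G' \<in> borel_measurable (seq_space \<Otimes>\<^sub>M seq2_space)"
      using F G by (simp_all add: F'_def G'_def)
    have "(\<integral>\<^sup>+X. \<integral>\<^sup>+z. \<integral>\<^sup>+w. F' (X, z, w) + G' (X, z, w) \<partial>exp_seq c \<partial>exp_seq b \<partial>exp_seq a)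
      = (\<integral>\<^sup>+X. \<integral>\<^sup>+z. \<integral>\<^sup>+w. F' (X, z, w) \<partial>exp_seq c \<partial>exp_seq b \<partial>exp_seq a)
      + (\<integral>\<^sup>+X. \<integral>\<^sup>+z. \<integral>\<^sup>+w. G' (X, z, w) \<partial>exp_seq c \<partial>exp_seq b \<partial>exp_seq a)"
      by (simp add: nn_integral_add)
    then show ?thesis using F0 G0 by (simp add: F'_def G'_def)
  qed
  have "(\<integral>\<^sup>+X. \<integral>\<^sup>+z. \<integral>\<^sup>+w. indicator {p. \<not> interchangeable p} (X, z, w) \<partial>exp_seq c \<partial>exp_seq b
      \<partial>exp_seq a)
    \<le> (\<integral>\<^sup>+X. \<integral>\<^sup>+z. \<integral>\<^sup>+w. unstable (z, w) + (unstable (X, z) + (unstable (queue_map X z, w)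
        + (unstable (X, dual_service z w) + unstable (queue_map X (dual_service z w), queue_map z
            w))))
        \<partial>exp_seq c \<partial>exp_seq b \<partial>exp_seq a)"
    by (intro nn_integral_mono) (auto simp: interchangeable_def unstable_def add.assoc[symmetric]
        split: split_indicator)
  also have "\<dots> = 0"
    by (intro add0 1 2 3 4 5; measurable)
  finally show ?thesis by simp
qed

lemma AE_interchangeable:
  assumes \<sigma>: "\<And>i. 1 < \<sigma> i" and mono: "strict_mono_on {1..m} \<sigma>" and i: "i \<in> {1..m}"
    and d: "Suc d < i"
  shows "AE p in exp_config m \<sigma> \<Otimes>\<^sub>M exp_seq 1.
    interchangeable (tandem i (fst p) d, fst p (i - Suc d), drive (fst p) (snd p) (i - Suc (Suc
        d)))"
proof -
  have \<sigma>0: "0 < \<sigma> i" for i using \<sigma>[of i] by simp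
  interpret S1: prob_space "exp_seq 1" by (rule prob_space_exp_seq) simp
  define q where "q = i - Suc (Suc d)"
  have q: "i = Suc (Suc (q + d))" "i - Suc d = Suc q" using d by (auto simp: q_def)
  have less: "\<sigma> (Suc q) < \<sigma> i" using i q
    by (intro strict_mono_onD[OF mono]) auto
  define N where "N = (indicator {p. \<not> interchangeable p} :: seq \<times> seq \<times> seq \<Rightarrow> ennreal)"
  have N: "N \<in> borel_measurable (seq_space \<Otimes>\<^sub>M seq2_space)" unfolding N_def by measurable
  define N' where "N' p = N (tandem i (fst p) d, fst p (Suc q), drive (fst p) (snd p) q)" for p
  have N': "N' \<in> borel_measurable (config_space m \<Otimes>\<^sub>M seq_space)"
    unfolding N'_def using i q
    by (intro measurable_compose[OF measurable_Pair[OF measurable_tandem[where n = m]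
        measurable_Pair[OF measurable_config_component[where n = m] measurable_drive[where n = m]]]
            N]) auto
  have N'': "N' \<in> borel_measurable (exp_config m \<sigma> \<Otimes>\<^sub>M exp_seq 1)"
    using N' by (simp cong: measurable_cong_sets add: sets_pair_measure_cong[OF sets_exp_config
        sets_exp_seq])
  have "(\<integral>\<^sup>+p. N' p \<partial>(exp_config m \<sigma> \<Otimes>\<^sub>M exp_seq 1))
    = (\<integral>\<^sup>+I. \<integral>\<^sup>+w. N (tandem i I d, I (Suc q), drive I w q) \<partial>exp_seq 1 \<partial>exp_config m \<sigma>)"
    by (subst S1.nn_integral_fst[symmetric]) (auto simp: N'_def N'')
  also have "\<dots> = (\<integral>\<^sup>+X. \<integral>\<^sup>+z. \<integral>\<^sup>+w. N (X, z, w) \<partial>exp_seq 1 \<partial>exp_seq (\<sigma> (Suc q)) \<partial>exp_seq (\<sigma> i))"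
    by (rule nn_integral_tandem_drive[OF \<sigma> mono i q(1) N])
  also have "\<dots> = 0" unfolding N_def by (rule nn_integral_interchangeable[OF _ \<sigma> less]) simp
  finally have "AE p in exp_config m \<sigma> \<Otimes>\<^sub>M exp_seq 1. N' p = 0"
    using nn_integral_0_iff_AE[OF N''] by simp
  then show ?thesis
    by eventually_elim (auto simp: N'_def N_def q(2) q_def[symmetric] split: split_indicator_asm)
qed

text \<open>The service is passed through the tandem one queue at a time: every interchange trades a
  line together with its service for the dual service and the output. At \<open>d = i - 1\<close>
  the drive is \<open>w\<close> itself, and the claim says that the multiclass map intertwines the
  lines with the coupled process.\<close>

lemma tandem_lines:
  assumes ok: "\<And>d. Suc d < i \<Longrightarrow> interchangeable (tandem i I d, I (i - Suc d), drive I w (i - Suc (Suc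
      d)))"
    and i: "i \<in> {1..m}" and "d < i"
  shows "tandem i (lines m I w) d = queue_map (tandem i I d) (drive I w (i - Suc d))"
  using \<open>d < i\<close>
proof (induction d)
  case 0
  then show ?case using i by (simp add: lines_def)
next
  case (Suc d)
  define q where "q = i - Suc (Suc d)"
  have q: "i - Suc d = Suc q" using Suc.prems by (simp add: q_def)
  have "Suc q \<in> {1..m}" using i q Suc.prems by auto
  then have "lines m I w (Suc q) = queue_map (I (Suc q)) (drive I w q)"
    by (simp add: lines_def)
  moreover have "queue_map (queue_map (tandem i I d) (I (Suc q))) (drive I w q)
    = queue_map (queue_map (tandem i I d) (dual_service (I (Suc q)) (drive I w q))) (queue_map (I
        (Suc q)) (drive I w q))"
    using ok[OF Suc.prems] unfolding q q_def[symmetric] interchangeable_def prod.case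
    by (intro queue_map_interchange) auto
  ultimately show ?case using Suc by (simp add: q q_def[symmetric])
qed

lemma tandem_shift:
  assumes ok: "\<And>d. Suc d < i \<Longrightarrow> interchangeable (tandem i I d, I (i - Suc d), drive I w (i - Suc (Suc
      d)))"
    and I: "\<And>j. j \<in> {1..m} \<Longrightarrow> I' j = shift (I j)" and i: "i \<in> {1..m}" and "d < i"
  shows "tandem i I' d = shift (tandem i I d)"
  using \<open>d < i\<close>
proof (induction d)
  case 0
  then show ?case using i I by simp
next
  case (Suc d)
  have "i - Suc d \<in> {1..m}" using i Suc.prems by auto
  moreover have "queue_stable (tandem i I d) (I (i - Suc d))"
    using ok[OF Suc.prems] by (simp add: interchangeable_def)
  ultimately show ?case using Suc I by (simp add: queue_map_shift)
qed

section \<open>Translation invariance of the input lines\<close>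

lemma translate_1: "translate n 1 I = (\<lambda>i\<in>{1..n}. shift (I i))"
  by (simp add: translate_def shift_def)

lemma measurable_translate:
  assumes "f \<in> M \<rightarrow>\<^sub>M config_space n"
  shows "(\<lambda>x. translate n 1 (f x)) \<in> M \<rightarrow>\<^sub>M config_space n"
  unfolding translate_1 by (intro measurable_configI measurable_shift measurable_config_component[OF
      assms])

lemma nn_integral_exp_config_translate:
  assumes \<sigma>: "\<And>i. 0 < \<sigma> i" and F: "F \<in> borel_measurable (config_space m)"
  shows "(\<integral>\<^sup>+I. F (translate m 1 I) \<partial>exp_config m \<sigma>) = (\<integral>\<^sup>+I. F I \<partial>exp_config m \<sigma>)"
  using F
proof (induction m arbitrary: F)
  case 0
  have "translate 0 1 I = I" if "I \<in> space (exp_config 0 \<sigma>)" for I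
    using that by (auto simp: translate_def space_exp_config space_config extensional_def)
  then show ?case by (intro nn_integral_cong) simp
next
  case (Suc m)
  note F = Suc.prems
  interpret Ss: prob_space "exp_seq (\<sigma> (Suc m))" by (rule prob_space_exp_seq[OF \<sigma>])
  define H where "H I = (\<integral>\<^sup>+z. F (I(Suc m := z)) \<partial>exp_seq (\<sigma> (Suc m)))" for I
  have H: "H \<in> borel_measurable (config_space m)"
    unfolding H_def
    by (rule Ss.borel_measurable_nn_integral, unfold split_beta',
        rule measurable_compose[OF measurable_config_upd F]) measurable
  have tr: "translate (Suc m) 1 (I(Suc m := z)) = (translate m 1 I)(Suc m := shift z)" for I z
    by (auto simp: translate_1 restrict_def fun_eq_iff)
  have "(\<integral>\<^sup>+I. F (translate (Suc m) 1 I) \<partial>exp_config (Suc m) \<sigma>)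
    = (\<integral>\<^sup>+I. \<integral>\<^sup>+z. F ((translate m 1 I)(Suc m := shift z)) \<partial>exp_seq (\<sigma> (Suc m)) \<partial>exp_config m \<sigma>)"
    using measurable_compose[OF measurable_translate[OF measurable_ident] F]
    by (subst nn_integral_exp_config_Suc[OF \<sigma>]) (auto simp: tr)
  also have "\<dots> = (\<integral>\<^sup>+I. H (translate m 1 I) \<partial>exp_config m \<sigma>)"
    unfolding H_def
  proof (rule nn_integral_cong)
    fix I assume "I \<in> space (exp_config m \<sigma>)"
    then have "translate m 1 I \<in> space (config_space m)" by (simp add: space_config translate_1)
    then have c: "(\<lambda>z. translate m 1 I) \<in> seq_space \<rightarrow>\<^sub>M config_space m" by simp
    show "(\<integral>\<^sup>+z. F ((translate m 1 I)(Suc m := shift z)) \<partial>exp_seq (\<sigma> (Suc m)))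
      = (\<integral>\<^sup>+z. F ((translate m 1 I)(Suc m := z)) \<partial>exp_seq (\<sigma> (Suc m)))"
      by (rule nn_integral_exp_seq_shift[OF \<sigma> measurable_compose[OF measurable_config_upd[OF c] F]])
          measurable
  qed
  also have "\<dots> = (\<integral>\<^sup>+I. H I \<partial>exp_config m \<sigma>)" by (rule Suc.IH[OF H])
  also have "\<dots> = (\<integral>\<^sup>+I. F I \<partial>exp_config (Suc m) \<sigma>)"
    unfolding H_def by (rule nn_integral_exp_config_Suc[OF \<sigma> F, symmetric])
  finally show ?case .
qed

section \<open>Invariance of the multiclass measures\<close>

definition step :: "nat \<Rightarrow> config \<Rightarrow> seq \<Rightarrow> config" where
  "step n \<eta> w = (\<lambda>i\<in>{1..n}. queue_map (\<eta> i) w)"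

lemma measurable_step:
  assumes "f \<in> M \<rightarrow>\<^sub>M config_space n" "g \<in> M \<rightarrow>\<^sub>M seq_space"
  shows "(\<lambda>x. step n (f x) (g x)) \<in> M \<rightarrow>\<^sub>M config_space n"
  unfolding step_def
  by (intro measurable_configI measurable_queue_map measurable_config_component[OF assms(1)]
      assms(2))

lemma measure_eqI_nn_integral:
  assumes "sets M = sets N" "\<And>F. F \<in> borel_measurable M \<Longrightarrow> (\<integral>\<^sup>+x. F x \<partial>M) = (\<integral>\<^sup>+x. F x \<partial>N)"
  shows "M = N"
proof (rule measure_eqI[OF assms(1)])
  fix A assume A: "A \<in> sets M"
  then show "emeasure M A = emeasure N A"
    using assms(2)[of "indicator A"] assms(1) by simp
qed

text \<open>One step of the chain reads only the driving sequence of time 0, which has law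
  \<open>exp_seq 1\<close> and is independent of the initial state.\<close>

lemma distr_chain_space:
  assumes \<mu>: "prob_space \<mu>" and sets: "sets \<mu> = sets (config_space n)"
  shows "distr (chain_space \<mu>) (config_space n) (\<lambda>(\<eta>, w). coupled_process n \<eta> w 1)
    = distr (\<mu> \<Otimes>\<^sub>M exp_seq 1) (config_space n) (\<lambda>p. step n (fst p) (snd p))"
proof -
  let ?W = "\<Pi>\<^sub>M t\<in>(UNIV :: nat set). exp_seq 1"
  have p1: "prob_space (exp_seq 1)" by (rule prob_space_exp_seq) simp
  have W: "distr ?W (exp_seq 1) (\<lambda>w. w 0) = exp_seq 1"
    by (rule distr_PiM_component) (auto simp: p1)
  have "\<mu> \<Otimes>\<^sub>M exp_seq 1 = distr \<mu> \<mu> (\<lambda>x. x) \<Otimes>\<^sub>M distr ?W (exp_seq 1) (\<lambda>w. w 0)"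
    unfolding W by (simp add: distr_id)
  also have "\<dots> = distr (chain_space \<mu>) (\<mu> \<Otimes>\<^sub>M exp_seq 1) (\<lambda>(\<eta>, w). (\<eta>, w 0))"
    unfolding chain_space_def using p1
    by (intro pair_measure_distr) (auto simp: W prob_space_imp_sigma_finite)
  finally have eq: "\<mu> \<Otimes>\<^sub>M exp_seq 1 = distr (chain_space \<mu>) (\<mu> \<Otimes>\<^sub>M exp_seq 1) (\<lambda>(\<eta>, w). (\<eta>, w 0))" .
  have f: "(\<lambda>p. fst p) \<in> \<mu> \<Otimes>\<^sub>M exp_seq 1 \<rightarrow>\<^sub>M config_space n"
    by (rule measurable_compose[OF measurable_fst]) (simp add: sets cong: measurable_cong_sets)
  have m: "(\<lambda>p. step n (fst p) (snd p)) \<in> \<mu> \<Otimes>\<^sub>M exp_seq 1 \<rightarrow>\<^sub>M config_space n"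
    by (rule measurable_step[OF f]) measurable
  have "distr (\<mu> \<Otimes>\<^sub>M exp_seq 1) (config_space n) (\<lambda>p. step n (fst p) (snd p))
    = distr (chain_space \<mu>) (config_space n) ((\<lambda>p. step n (fst p) (snd p)) \<circ> (\<lambda>(\<eta>, w). (\<eta>, w 0)))"
    by (subst eq, rule distr_distr[OF m]) (simp add: chain_space_def, measurable)
  also have "(\<lambda>p. step n (fst p) (snd p)) \<circ> (\<lambda>(\<eta>, w). (\<eta>, w 0))
      = (\<lambda>(\<eta>, w). coupled_process n \<eta> w 1)"
    by (auto simp: step_def fun_eq_iff)
  finally show ?thesis by simp
qed

text \<open>\<open>\<kappa>\<close> assigns to each component the index of its mean among the
  distinct means. Repeated means and any order of the components thus have one common form.\<close>

definition multi_law :: "nat \<Rightarrow> nat \<Rightarrow> (nat \<Rightarrow> real) \<Rightarrow> (nat \<Rightarrow> nat) \<Rightarrow> config measure" where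
  "multi_law n m \<sigma> \<kappa> = distr (exp_config m \<sigma>) (config_space n) (\<lambda>I. \<lambda>i\<in>{1..n}. multi_queue m I (\<kappa>
      i))"

lemma sets_multi_law [simp]: "sets (multi_law n m \<sigma> \<kappa>) = sets (config_space n)"
  by (simp add: multi_law_def)

context
  fixes n m :: nat and \<sigma> :: "nat \<Rightarrow> real" and \<kappa> :: "nat \<Rightarrow> nat"
  assumes \<sigma>: "\<And>i. 1 < \<sigma> i" and mono: "strict_mono_on {1..m} \<sigma>" and \<kappa>:
      "\<And>i. i \<in> {1..n} \<Longrightarrow> \<kappa> i \<in> {1..m}"
begin

lemma sigma_pos: "0 < \<sigma> i"
  using \<sigma>[of i] by simp

lemma measurable_multi_queue_at:
  assumes f: "f \<in> M \<rightarrow>\<^sub>M config_space m" and "i \<in> {1..m}"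
  shows "(\<lambda>x. multi_queue m (f x) i) \<in> M \<rightarrow>\<^sub>M seq_space"
proof -
  have "(\<lambda>x. tandem i (f x) (i - 1)) \<in> M \<rightarrow>\<^sub>M seq_space"
    using assms(2) by (intro measurable_tandem[OF f]) auto
  then show ?thesis using assms(2) by (simp add: multi_queue_tandem)
qed

lemma measurable_multi_queue:
  assumes f: "f \<in> M \<rightarrow>\<^sub>M config_space m"
  shows "(\<lambda>x. \<lambda>i\<in>{1..n}. multi_queue m (f x) (\<kappa> i)) \<in> M \<rightarrow>\<^sub>M config_space n"
  by (intro measurable_configI measurable_multi_queue_at[OF f] \<kappa>)

lemma measurable_multi_queue_exp:
  "(\<lambda>I. \<lambda>i\<in>{1..n}. multi_queue m I (\<kappa> i)) \<in> exp_config m \<sigma> \<rightarrow>\<^sub>M config_space n"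
  using measurable_multi_queue[OF measurable_ident]
    by (simp add: measurable_cong_sets[OF sets_exp_config refl])

lemma prob_space_multi_law: "prob_space (multi_law n m \<sigma> \<kappa>)"
  unfolding multi_law_def
  by (rule prob_space.prob_space_distr[OF prob_space_exp_config[OF sigma_pos]
      measurable_multi_queue_exp])

lemma nn_integral_multi_law:
  assumes F: "F \<in> borel_measurable (config_space n)"
  shows "(\<integral>\<^sup>+\<eta>. F \<eta> \<partial>multi_law n m \<sigma> \<kappa>)
      = (\<integral>\<^sup>+I. F (\<lambda>i\<in>{1..n}. multi_queue m I (\<kappa> i)) \<partial>exp_config m \<sigma>)"
  unfolding multi_law_def using F by (intro nn_integral_distr measurable_multi_queue_exp) simp

lemma nn_integral_multi_law_component:
  assumes i: "i \<in> {1..n}" and F: "F \<in> borel_measurable seq_space"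
  shows "(\<integral>\<^sup>+\<eta>. F (\<eta> i) \<partial>multi_law n m \<sigma> \<kappa>) = (\<integral>\<^sup>+z. F z \<partial>exp_seq (\<sigma> (\<kappa> i)))"
proof -
  interpret E0: prob_space "exp_config 0 \<sigma>" by (rule prob_space_exp_config[OF sigma_pos])
  let ?j = "\<kappa> i"
  have j: "?j \<in> {1..m}" "?j - 1 < ?j" using \<kappa>[OF i] by auto
  have 0: "?j - 1 - (?j - 1) = 0" by simp
  have "(\<integral>\<^sup>+\<eta>. F (\<eta> i) \<partial>multi_law n m \<sigma> \<kappa>) = (\<integral>\<^sup>+I. F (tandem ?j I (?j - 1)) \<partial>exp_config m \<sigma>)"
    using measurable_compose[OF measurable_config_component[OF measurable_ident i] F] i j
    by (subst nn_integral_multi_law) (auto simp: multi_queue_tandem)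
  also have "\<dots> = (\<integral>\<^sup>+I. \<integral>\<^sup>+X. F X \<partial>exp_seq (\<sigma> ?j) \<partial>exp_config 0 \<sigma>)"
    using nn_integral_tandem[OF sigma_pos mono j(1) j(2), where F = "\<lambda>p. F (snd p)", unfolded 0] F
      by simp
  finally show ?thesis by (simp add: E0.emeasure_space_1)
qed

lemma AE_multi_law_component:
  assumes i: "i \<in> {1..n}" and P [measurable]: "Measurable.pred seq_space P"
      and "AE z in exp_seq (\<sigma> (\<kappa> i)). P z"
  shows "AE \<eta> in multi_law n m \<sigma> \<kappa>. P (\<eta> i)"
proof -
  define F :: "seq \<Rightarrow> ennreal" where "F = indicator {z. \<not> P z}"
  have F [measurable]: "F \<in> borel_measurable seq_space" unfolding F_def by measurable
  have "(\<integral>\<^sup>+z. F z \<partial>exp_seq (\<sigma> (\<kappa> i))) = (\<integral>\<^sup>+z. 0 \<partial>exp_seq (\<sigma> (\<kappa> i)))"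
    using assms(3) by (intro nn_integral_cong_AE) (auto simp: F_def)
  then have "(\<integral>\<^sup>+\<eta>. F (\<eta> i) \<partial>multi_law n m \<sigma> \<kappa>) = 0"
    by (simp add: nn_integral_multi_law_component[OF i F])
  moreover have "(\<lambda>\<eta>. F (\<eta> i)) \<in> borel_measurable (multi_law n m \<sigma> \<kappa>)"
    using measurable_compose[OF measurable_config_component[OF measurable_ident i] F]
    by (simp add: measurable_cong_sets[OF sets_multi_law refl])
  ultimately have "AE \<eta> in multi_law n m \<sigma> \<kappa>. F (\<eta> i) = 0"
    by (simp add: nn_integral_0_iff_AE)
  then show ?thesis by eventually_elim (auto simp: F_def split: split_indicator_asm)
qed

lemma AE_multi_law_nonneg: "AE \<eta> in multi_law n m \<sigma> \<kappa>. \<forall>i\<in>{1..n}. \<forall>k. 0 \<le> \<eta> i k"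
  by (intro AE_finite_allI finite_atLeastAtMost AE_multi_law_component[where P = "\<lambda>z. \<forall>k. 0 \<le> z k"]
      AE_exp_seq_nonneg sigma_pos) measurable

lemma AE_multi_law_cesaro: "AE \<eta> in multi_law n m \<sigma> \<kappa>. \<forall>i\<in>{1..n}. cesaro (\<eta> i) (\<sigma> (\<kappa> i))"
  by (intro AE_finite_allI finite_atLeastAtMost AE_multi_law_component[where P = "\<lambda>z. cesaro z _"]
      AE_exp_seq_cesaro sigma_pos) measurable

lemma prob_on_states_multi_law: "prob_on_states n (multi_law n m \<sigma> \<kappa>)"
proof -
  have "AE \<eta> in multi_law n m \<sigma> \<kappa>. \<eta> \<in> state_space n"
    using AE_space AE_multi_law_nonneg AE_multi_law_cesaro
  proof eventually_elim
    case (elim \<eta>)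
    have "\<eta> \<in> space (config_space n)"
      using elim(1) sets_eq_imp_space_eq[OF sets_multi_law] by simp
    with elim \<sigma> show ?case unfolding state_space_iff by blast
  qed
  then show ?thesis by (simp add: prob_on_states_def prob_space_multi_law)
qed

lemma AE_interchangeable_all:
  "AE p in exp_config m \<sigma> \<Otimes>\<^sub>M exp_seq 1. \<forall>i\<in>{1..m}. \<forall>d. Suc d < i \<longrightarrow>
    interchangeable (tandem i (fst p) d, fst p (i - Suc d), drive (fst p) (snd p) (i - Suc (Suc
        d)))"
proof (intro AE_finite_allI finite_atLeastAtMost)
  fix i assume "i \<in> {1..m}"
  then show "AE p in exp_config m \<sigma> \<Otimes>\<^sub>M exp_seq 1. \<forall>d. Suc d < i \<longrightarrow>
    interchangeable (tandem i (fst p) d, fst p (i - Suc d), drive (fst p) (snd p) (i - Suc (Suc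
        d)))"
    unfolding AE_all_countable using AE_interchangeable[OF \<sigma> mono] by (intro allI AE_impI)
qed

lemma multi_law_step:
  "distr (multi_law n m \<sigma> \<kappa> \<Otimes>\<^sub>M exp_seq 1) (config_space n) (\<lambda>p. step n (fst p) (snd p))
      = multi_law n m \<sigma> \<kappa>"
proof (rule measure_eqI_nn_integral)
  interpret S1: prob_space "exp_seq 1" by (rule prob_space_exp_seq) simp
  interpret Em: prob_space "exp_config m \<sigma>" by (rule prob_space_exp_config[OF sigma_pos])
  let ?Q = "\<lambda>I. \<lambda>i\<in>{1..n}. multi_queue m I (\<kappa> i)"
  fix F :: "config \<Rightarrow> ennreal" assume "F \<in> borel_measurable (distr (multi_law n m \<sigma> \<kappa> \<Otimes>\<^sub>M exp_seq 1)
      (config_space n) (\<lambda>p. step n (fst p) (snd p)))"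
  then have F: "F \<in> borel_measurable (config_space n)" by simp
  have F': "(\<lambda>p. F (step n (fst p) (snd p))) \<in> borel_measurable (config_space n \<Otimes>\<^sub>M seq_space)"
    by (rule measurable_compose[OF measurable_step F]) measurable
  have FQ: "(\<lambda>I. F (?Q I)) \<in> borel_measurable (config_space m)"
    using measurable_compose[OF measurable_multi_queue[OF measurable_ident] F] by simp
  have cong1: "sets (multi_law n m \<sigma> \<kappa> \<Otimes>\<^sub>M exp_seq 1) = sets (config_space n \<Otimes>\<^sub>M seq_space)"
    by (rule sets_pair_measure_cong[OF sets_multi_law sets_exp_seq])
  have cong2: "sets (exp_config m \<sigma> \<Otimes>\<^sub>M exp_seq 1) = sets (config_space m \<Otimes>\<^sub>M seq_space)"
    by (rule sets_pair_measure_cong[OF sets_exp_config sets_exp_seq])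
  have st: "(\<lambda>p. step n (fst p) (snd p)) \<in> config_space n \<Otimes>\<^sub>M seq_space \<rightarrow>\<^sub>M config_space n"
    by (rule measurable_step) measurable
  have "(\<integral>\<^sup>+\<eta>. F \<eta> \<partial>distr (multi_law n m \<sigma> \<kappa> \<Otimes>\<^sub>M exp_seq 1) (config_space n) (\<lambda>p. step n (fst p)
      (snd p)))
    = (\<integral>\<^sup>+p. F (step n (fst p) (snd p)) \<partial>(multi_law n m \<sigma> \<kappa> \<Otimes>\<^sub>M exp_seq 1))"
    using st F by (intro nn_integral_distr) (simp_all add: measurable_cong_sets[OF cong1 refl])
  also have "\<dots> = (\<integral>\<^sup>+\<eta>. \<integral>\<^sup>+w. F (step n \<eta> w) \<partial>exp_seq 1 \<partial>multi_law n m \<sigma> \<kappa>)"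
    using F' by (subst S1.nn_integral_fst[symmetric]) (auto simp: measurable_cong_sets[OF cong1
        refl])
  also have "\<dots> = (\<integral>\<^sup>+I. \<integral>\<^sup>+w. F (step n (?Q I) w) \<partial>exp_seq 1 \<partial>exp_config m \<sigma>)"
  proof (rule nn_integral_multi_law)
    show "(\<lambda>\<eta>. \<integral>\<^sup>+w. F (step n \<eta> w) \<partial>exp_seq 1) \<in> borel_measurable (config_space n)"
      using F' by (intro S1.borel_measurable_nn_integral) (simp add: split_beta'
          measurable_cong_sets[OF sets_pair_measure_cong[OF refl sets_exp_seq] refl])
  qed
  also have "\<dots> = (\<integral>\<^sup>+p. F (step n (?Q (fst p)) (snd p)) \<partial>(exp_config m \<sigma> \<Otimes>\<^sub>M exp_seq 1))"
  proof -
    have "(\<lambda>p. F (step n (?Q (fst p)) (snd p))) \<in> borel_measurable (config_space m \<Otimes>\<^sub>M seq_space)"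
      by (rule measurable_compose[OF measurable_step[OF measurable_multi_queue] F]) measurable
    then show ?thesis
      by (subst S1.nn_integral_fst[symmetric]) (auto simp: measurable_cong_sets[OF cong2 refl])
  qed
  also have "\<dots> = (\<integral>\<^sup>+p. F (?Q (lines m (fst p) (snd p))) \<partial>(exp_config m \<sigma> \<Otimes>\<^sub>M exp_seq 1))"
  proof (rule nn_integral_cong_AE)
    show "AE p in exp_config m \<sigma> \<Otimes>\<^sub>M exp_seq 1. F (step n (?Q (fst p)) (snd p))
        = F (?Q (lines m (fst p) (snd p)))"
      using AE_interchangeable_all
    proof eventually_elim
      case (elim p)
      have "queue_map (multi_queue m (fst p) i) (snd p) = multi_queue m (lines m (fst p) (snd p)) i"
          if i: "i \<in> {1..m}" for i
      proof -
        have "tandem i (lines m (fst p) (snd p)) (i - 1)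
            = queue_map (tandem i (fst p) (i - 1)) (drive (fst p) (snd p) (i - Suc (i - 1)))"
          using elim i by (intro tandem_lines) auto
        then show ?thesis using i by (simp add: multi_queue_tandem)
      qed
      then have "step n (?Q (fst p)) (snd p) = ?Q (lines m (fst p) (snd p))"
        using \<kappa> by (auto simp: step_def restrict_def fun_eq_iff)
      then show ?case by simp
    qed
  qed
  also have "\<dots> = (\<integral>\<^sup>+I. \<integral>\<^sup>+w. F (?Q (lines m I w)) \<partial>exp_seq 1 \<partial>exp_config m \<sigma>)"
  proof -
    have "(\<lambda>p. F (?Q (lines m (fst p) (snd p)))) \<in> borel_measurable (config_space m \<Otimes>\<^sub>M seq_space)"
      by (rule measurable_compose[OF measurable_multi_queue[OF measurable_lines[where n = m]] F])
          measurable
    then show ?thesis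
      by (subst S1.nn_integral_fst[symmetric]) (auto simp: measurable_cong_sets[OF cong2 refl])
  qed
  also have "\<dots> = (\<integral>\<^sup>+I. \<integral>\<^sup>+w. F (?Q I) \<partial>exp_seq 1 \<partial>exp_config m \<sigma>)"
    by (rule multiline_burke[OF \<sigma> measurable_compose[OF measurable_fst FQ], unfolded fst_conv])
  also have "\<dots> = (\<integral>\<^sup>+\<eta>. F \<eta> \<partial>multi_law n m \<sigma> \<kappa>)"
    by (simp add: nn_integral_multi_law[OF F] S1.emeasure_space_1[simplified])
  finally show "(\<integral>\<^sup>+\<eta>. F \<eta> \<partial>distr (multi_law n m \<sigma> \<kappa> \<Otimes>\<^sub>M exp_seq 1) (config_space n) (\<lambda>p. step n
      (fst p) (snd p)))
    = (\<integral>\<^sup>+\<eta>. F \<eta> \<partial>multi_law n m \<sigma> \<kappa>)" .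
qed simp

lemma invariant_multi_law: "invariant_measure n (multi_law n m \<sigma> \<kappa>)"
  unfolding invariant_measure_def
  using prob_on_states_multi_law multi_law_step distr_chain_space[OF prob_space_multi_law
      sets_multi_law] by simp

lemma multi_law_translate: "distr (multi_law n m \<sigma> \<kappa>) (config_space n) (translate n 1)
    = multi_law n m \<sigma> \<kappa>"
proof (rule measure_eqI_nn_integral)
  interpret S1: prob_space "exp_seq 1" by (rule prob_space_exp_seq) simp
  interpret Em: prob_space "exp_config m \<sigma>" by (rule prob_space_exp_config[OF sigma_pos])
  interpret P: pair_sigma_finite "exp_config m \<sigma>" "exp_seq 1" ..
  let ?Q = "\<lambda>I. \<lambda>i\<in>{1..n}. multi_queue m I (\<kappa> i)"
  fix F :: "config \<Rightarrow> ennreal" assume "F \<in> borel_measurable (distr (multi_law n m \<sigma> \<kappa>) (config_space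
      n) (translate n 1))"
  then have F: "F \<in> borel_measurable (config_space n)" by simp
  have tr: "translate n 1 \<in> config_space n \<rightarrow>\<^sub>M config_space n"
    using measurable_translate[OF measurable_ident] by simp
  have FQ: "(\<lambda>I. F (?Q I)) \<in> borel_measurable (config_space m)"
    using measurable_compose[OF measurable_multi_queue[OF measurable_ident] F] by simp
  have "(\<integral>\<^sup>+\<eta>. F \<eta> \<partial>distr (multi_law n m \<sigma> \<kappa>) (config_space n) (translate n 1))
    = (\<integral>\<^sup>+\<eta>. F (translate n 1 \<eta>) \<partial>multi_law n m \<sigma> \<kappa>)"
    using tr F by (intro nn_integral_distr) (auto simp: measurable_cong_sets[OF sets_multi_law
        refl])
  also have "\<dots> = (\<integral>\<^sup>+I. F (translate n 1 (?Q I)) \<partial>exp_config m \<sigma>)"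
    by (rule nn_integral_multi_law[OF measurable_compose[OF tr F]])
  also have "\<dots> = (\<integral>\<^sup>+I. F (?Q (translate m 1 I)) \<partial>exp_config m \<sigma>)"
  proof (rule nn_integral_cong_AE)
    \<comment> \<open>Interchangeability contains the stability of every queue in the tandems, which
      is what commuting with the shift requires. The service \<open>w\<close> is auxiliary here, and
      any one from the full-measure set will do.\<close>
    have "AE I in exp_config m \<sigma>. AE w in exp_seq 1. \<forall>i\<in>{1..m}. \<forall>d. Suc d < i \<longrightarrow>
      interchangeable (tandem i I d, I (i - Suc d), drive I w (i - Suc (Suc d)))"
      using P.AE_pair[OF AE_interchangeable_all] by simp
    then show "AE I in exp_config m \<sigma>. F (translate n 1 (?Q I)) = F (?Q (translate m 1 I))"
    proof eventually_elim
      case (elim I)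
      then obtain w where ok: "\<forall>i\<in>{1..m}. \<forall>d. Suc d < i \<longrightarrow>
        interchangeable (tandem i I d, I (i - Suc d), drive I w (i - Suc (Suc d)))"
        using eventually_happens'[OF S1.ae_filter_bot elim] by blast
      have "multi_queue m (translate m 1 I) i = shift (multi_queue m I i)" if i: "i \<in> {1..m}" for i
      proof -
        have "tandem i (translate m 1 I) (i - 1) = shift (tandem i I (i - 1))"
          using ok i by (intro tandem_shift[where w = w and m = m]) (auto simp: translate_1)
        then show ?thesis using i by (simp add: multi_queue_tandem)
      qed
      then have "translate n 1 (?Q I) = ?Q (translate m 1 I)"
        using \<kappa> by (auto simp: translate_1 restrict_def fun_eq_iff)
      then show ?case by simp
    qed
  qed
  also have "\<dots> = (\<integral>\<^sup>+I. F (?Q I) \<partial>exp_config m \<sigma>)"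
    by (rule nn_integral_exp_config_translate[OF sigma_pos FQ])
  also have "\<dots> = (\<integral>\<^sup>+\<eta>. F \<eta> \<partial>multi_law n m \<sigma> \<kappa>)"
    by (simp add: nn_integral_multi_law[OF F])
  finally show "(\<integral>\<^sup>+\<eta>. F \<eta> \<partial>distr (multi_law n m \<sigma> \<kappa>) (config_space n) (translate n 1))
    = (\<integral>\<^sup>+\<eta>. F \<eta> \<partial>multi_law n m \<sigma> \<kappa>)" .
qed simp

lemma integrable_multi_law:
  assumes i: "i \<in> {1..n}"
  shows "integrable (multi_law n m \<sigma> \<kappa>) (\<lambda>\<eta>. \<eta> i k)"
proof (rule integrableI_bounded)
  let ?s = "\<sigma> (\<kappa> i)"
  have s: "0 < ?s" by (rule sigma_pos)
  show "(\<lambda>\<eta>. \<eta> i k) \<in> borel_measurable (multi_law n m \<sigma> \<kappa>)"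
    using measurable_compose[OF measurable_config_component[OF measurable_ident i]
        measurable_component_singleton[OF UNIV_I]]
    by (simp add: measurable_cong_sets[OF sets_multi_law refl])
  have "(\<integral>\<^sup>+\<eta>. ennreal (norm (\<eta> i k)) \<partial>multi_law n m \<sigma> \<kappa>)
      = (\<integral>\<^sup>+z. ennreal (norm (z k)) \<partial>exp_seq ?s)"
    by (rule nn_integral_multi_law_component[OF i]) measurable
  also have "\<dots> = (\<integral>\<^sup>+x. ennreal (norm x) \<partial>expo ?s)"
    by (rule nn_integral_exp_seq_component[OF s]) measurable
  \<comment> \<open>The first moment is dominated by an exponential moment; the exponent
    \<open>1 / (2 * ?s)\<close> is half the critical rate \<open>1 / ?s\<close>, so that moment is
    finite.\<close>
  also have "\<dots> \<le> (\<integral>\<^sup>+x. ennreal (2 * ?s) * ennreal (exp (1 / (2 * ?s) * x)) \<partial>expo ?s)"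
  proof (rule nn_integral_mono_AE)
    show "AE x in expo ?s. ennreal (norm x) \<le> ennreal (2 * ?s) * ennreal (exp (1 / (2 * ?s) * x))"
      using AE_expo_nonneg
    proof eventually_elim
      case (elim x)
      have "x / (2 * ?s) \<le> exp (x / (2 * ?s))"
        using exp_ge_add_one_self[of "x / (2 * ?s)"] by linarith
      then have "x \<le> 2 * ?s * exp (x / (2 * ?s))" using s by (simp add: field_simps)
      then show ?case using elim s by (simp add: ennreal_mult[symmetric])
    qed
  qed
  also have "\<dots> = ennreal (2 * ?s) * ennreal (1 / (1 - 1 / (2 * ?s) * ?s))"
    using s nn_integral_expo_exp[of ?s "1 / (2 * ?s)"] by (subst nn_integral_cmult) simp_all
  also have "\<dots> < \<infinity>" by (simp add: ennreal_mult_less_top)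
  finally show "(\<integral>\<^sup>+\<eta>. ennreal (norm (\<eta> i k)) \<partial>multi_law n m \<sigma> \<kappa>) < \<infinity>" .
qed

end

section \<open>Blocks and sorting: multiclass measures in the form \<open>multi_law\<close>\<close>

lemma blocks_exist:
  assumes "1 \<le> n" "mono_on {1..n} \<rho>" "\<forall>i\<in>{1..n}. 0 < \<rho> i"
  shows "\<exists>m \<sigma> b. blocks n \<rho> m \<sigma> b"
  using assms
proof (induction n rule: dec_induct)
  case base
  have "blocks 1 \<rho> 1 \<rho> (\<lambda>l. l)"
    using base by (auto simp: blocks_def strict_mono_on_def)
  then show ?case by blast
next
  case (step n)
  have mono: "mono_on {1..n} \<rho>" using step.prems(1) by (rule mono_on_subset) auto
  with step obtain m \<sigma> b where bl: "blocks n \<rho> m \<sigma> b" by auto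
  then have m: "m \<in> {1..n}" and \<sigma>1: "0 < \<sigma> 1" and \<sigma>m: "strict_mono_on {1..m} \<sigma>" and b1: "b 1 = 1"
    and bm: "b (m + 1) = n + 1" and bmono: "strict_mono_on {1..m + 1} b"
    and eq: "\<And>l j. l \<in> {1..m} \<Longrightarrow> j \<in> {b l..<b (l + 1)} \<Longrightarrow> \<rho> j = \<sigma> l"
    by (auto simp: blocks_def)
  have "b m < b (m + 1)" using m by (intro strict_mono_onD[OF bmono]) auto
  then have "\<rho> n = \<sigma> m" using m bm by (intro eq) auto
  moreover have "\<rho> n \<le> \<rho> (Suc n)" using step by (intro mono_onD[OF step.prems(1)]) auto
  ultimately have le: "\<sigma> m \<le> \<rho> (Suc n)" by simp
  have b_le: "b l \<le> n + 1" if "l \<in> {1..m + 1}" for l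
    using strict_mono_on_leD[OF bmono that, of "m + 1"] that bm by auto
  show ?case
  proof (cases "\<rho> (Suc n) = \<sigma> m")
    case True
    define b' where "b' = b(m + 1 := n + 2)"
    have "strict_mono_on {1..m + 1} b'"
    proof (rule strict_mono_onI)
      fix r s assume rs: "r \<in> {1..m + 1}" "s \<in> {1..m + 1}" "r < s"
      then have "b r < b s" by (intro strict_mono_onD[OF bmono])
      then show "b' r < b' s" using rs b_le[OF rs(2)] bm by (auto simp: b'_def)
    qed
    moreover have "\<rho> j = \<sigma> l" if "l \<in> {1..m}" "j \<in> {b' l..<b' (l + 1)}" for l j
      using that eq[OF that(1), of j] True bm
        by (cases "j = Suc n") (auto simp: b'_def split: if_splits)
    ultimately have "blocks (Suc n) \<rho> m \<sigma> b'"
      unfolding blocks_def using m \<sigma>1 \<sigma>m b1 by (auto simp: b'_def)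
    then show ?thesis by blast
  next
    case False
    with le have lt: "\<sigma> m < \<rho> (Suc n)" by simp
    define b' where "b' = b(m + 2 := n + 2)"
    define \<sigma>' where "\<sigma>' = \<sigma>(m + 1 := \<rho> (Suc n))"
    have "strict_mono_on {1..m + 2} b'"
    proof (rule strict_mono_onI)
      fix r s assume rs: "r \<in> {1..m + 2}" "s \<in> {1..m + 2}" "r < s"
      then show "b' r < b' s" using strict_mono_onD[OF bmono, of r s] b_le[of r]
        by (cases "s = m + 2") (auto simp: b'_def)
    qed
    moreover have "strict_mono_on {1..m + 1} \<sigma>'"
    proof (rule strict_mono_onI)
      fix r s assume rs: "r \<in> {1..m + 1}" "s \<in> {1..m + 1}" "r < s"
      have "\<sigma> r \<le> \<sigma> m" if "r \<in> {1..m}" for r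
        using strict_mono_on_leD[OF \<sigma>m that, of m] that m by auto
      then show "\<sigma>' r < \<sigma>' s" using strict_mono_onD[OF \<sigma>m, of r s] rs lt by (fastforce simp: \<sigma>'_def)
    qed
    moreover have "\<rho> j = \<sigma>' l" if "l \<in> {1..m + 1}" "j \<in> {b' l..<b' (l + 1)}" for l j
    proof (cases "l = m + 1")
      case True
      then have "j = Suc n" using that bm by (auto simp: b'_def)
      then show ?thesis by (simp add: \<sigma>'_def True)
    next
      case False
      then show ?thesis using that eq[of l j] by (auto simp: b'_def \<sigma>'_def)
    qed
    ultimately have "blocks (Suc n) \<rho> (m + 1) \<sigma>' b'"
      unfolding blocks_def using m \<sigma>1 b1 by (auto simp: b'_def \<sigma>'_def)
    then show ?thesis by blast
  qed
qed

text \<open>Selection sort: a transposition brings a largest entry to the last place, and the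
  induction hypothesis sorts the others.\<close>

lemma sorting_permutation:
  fixes \<rho> :: "nat \<Rightarrow> real"
  shows "\<exists>\<pi>. \<pi> permutes {1..n} \<and> mono_on {1..n} (\<rho> \<circ> \<pi>)"
proof (induction n arbitrary: \<rho>)
  case 0
  then show ?case by (intro exI[of _ id]) (auto simp: mono_on_def)
next
  case (Suc n)
  have "Max (\<rho> ` {1..Suc n}) \<in> \<rho> ` {1..Suc n}" by (intro Max_in) auto
  then obtain j where j: "j \<in> {1..Suc n}" "\<rho> j = Max (\<rho> ` {1..Suc n})" by force
  then have max: "\<rho> i \<le> \<rho> j" if "i \<in> {1..Suc n}" for i using that by simp
  define t where "t = Transposition.transpose j (Suc n)"
  have t: "t permutes {1..Suc n}" unfolding t_def using j(1) by (intro permutes_swap_id) auto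
  obtain \<pi> where \<pi>: "\<pi> permutes {1..n}" "mono_on {1..n} (\<rho> \<circ> t \<circ> \<pi>)"
    using Suc[of "\<rho> \<circ> t"] by blast
  have \<pi>': "\<pi> permutes {1..Suc n}" using \<pi>(1) by (rule permutes_subset) auto
  have p: "t \<circ> \<pi> permutes {1..Suc n}" using \<pi>' t by (rule permutes_compose)
  have "\<rho> (t (\<pi> (Suc n))) = \<rho> j"
    using permutes_not_in[OF \<pi>(1), of "Suc n"] by (simp add: t_def)
  then have top: "\<rho> (t (\<pi> i)) \<le> \<rho> (t (\<pi> (Suc n)))" if "i \<in> {1..Suc n}" for i
    using max[of "t (\<pi> i)"] permutes_in_image[OF p, of i] that by simp
  have "mono_on {1..Suc n} (\<rho> \<circ> (t \<circ> \<pi>))"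
  proof (rule mono_onI)
    fix r s assume rs: "r \<in> {1..Suc n}" "s \<in> {1..Suc n}" "r \<le> s"
    show "(\<rho> \<circ> (t \<circ> \<pi>)) r \<le> (\<rho> \<circ> (t \<circ> \<pi>)) s"
      using top[OF rs(1)] mono_onD[OF \<pi>(2), of r s] rs by (cases "s = Suc n") auto
  qed
  with p show ?case by blast
qed

text \<open>The blocks stem from a choice operator, so only the property \<open>blocks\<close> is
  available; any blocks with this property lead to a law of the stated form.\<close>

lemma multiclass_sorted_multi_law:
  assumes n: "1 \<le> n" and mono: "mono_on {1..n} \<rho>" and \<rho>: "\<And>i. i \<in> {1..n} \<Longrightarrow> 1 < \<rho> i"
  shows "\<exists>m \<sigma> \<kappa>. (\<forall>i. 1 < \<sigma> i) \<and> strict_mono_on {1..m} \<sigma> \<and> (\<forall>i\<in>{1..n}. \<kappa> i \<in> {1..m} \<and> \<sigma> (\<kappa> i) = \<rho> i)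
      \<and>
    multiclass_sorted n \<rho> = multi_law n m \<sigma> \<kappa>"
proof -
  have pos: "\<forall>i\<in>{1..n}. 0 < \<rho> i" using \<rho> by force
  define x where "x = (SOME x. case x of (m, \<sigma>, b) \<Rightarrow> blocks n \<rho> m \<sigma> b)"
  obtain m \<sigma> b where x: "x = (m, \<sigma>, b)" by (cases x)
  have "\<exists>x. case x of (m, \<sigma>, b) \<Rightarrow> blocks n \<rho> m \<sigma> b" using blocks_exist[OF n mono pos] by auto
  from someI_ex[OF this] have bl: "blocks n \<rho> m \<sigma> b" unfolding x_def[symmetric] x by simp
  then have m: "m \<in> {1..n}" and \<sigma>m: "strict_mono_on {1..m} \<sigma>" and b1: "b 1 = 1"
    and bm: "b (m + 1) = n + 1" and bmono: "strict_mono_on {1..m + 1} b"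
    and eq: "\<And>l j. l \<in> {1..m} \<Longrightarrow> j \<in> {b l..<b (l + 1)} \<Longrightarrow> \<rho> j = \<sigma> l"
    by (auto simp: blocks_def)
  define \<kappa> where "\<kappa> j = (THE l. l \<in> {1..m} \<and> j \<in> {b l..<b (l + 1)})" for j
  have \<kappa>: "\<kappa> j \<in> {1..m} \<and> j \<in> {b (\<kappa> j)..<b (\<kappa> j + 1)}" if j: "j \<in> {1..n}" for j
    unfolding \<kappa>_def
  proof (rule theI')
    define l where "l = Max {l \<in> {1..m}. b l \<le> j}"
    have fin: "finite {l \<in> {1..m}. b l \<le> j}" by simp
    have "1 \<in> {l \<in> {1..m}. b l \<le> j}" using m b1 j by auto
    then have l: "l \<in> {l \<in> {1..m}. b l \<le> j}" unfolding l_def using fin by (intro Max_in) auto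
    have "j < b (l + 1)"
    proof (rule ccontr)
      assume "\<not> j < b (l + 1)"
      then have "l + 1 \<in> {l \<in> {1..m}. b l \<le> j}" using l bm j by (cases "l = m") auto
      then have "l + 1 \<le> l" unfolding l_def using fin by (intro Max_ge) auto
      then show False by simp
    qed
    moreover have "l' = l" if l': "l' \<in> {1..m} \<and> j \<in> {b l'..<b (l' + 1)}" for l'
    proof (rule antisym)
      show "l' \<le> l" unfolding l_def using l' fin by (intro Max_ge) auto
      show "l \<le> l'"
      proof (rule ccontr)
        assume "\<not> l \<le> l'"
        then have "b (l' + 1) \<le> b l" using l l' by (intro strict_mono_on_leD[OF bmono]) auto
        then show False using l l' by auto
      qed
    qed
    ultimately show "\<exists>!l. l \<in> {1..m} \<and> j \<in> {b l..<b (l + 1)}" using l by auto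
  qed
  \<comment> \<open>\<open>multi_law\<close> is studied for means above 1 at every index. The value
    2 outside \<open>{1..m}\<close> is arbitrary, and \<open>exp_config m\<close> does not see
    it.\<close>
  define \<sigma>' where "\<sigma>' i = (if i \<in> {1..m} then \<sigma> i else 2)" for i
  have "1 < \<sigma> l" if l: "l \<in> {1..m}" for l
  proof -
    have b: "b l < b (l + 1)" using l by (intro strict_mono_onD[OF bmono]) auto
    moreover have "b (l + 1) \<le> b (m + 1)" "b 1 \<le> b l" using l
      by (auto intro!: strict_mono_on_leD[OF bmono])
    ultimately have "b l \<in> {1..n}" using b1 bm by auto
    moreover have "\<rho> (b l) = \<sigma> l" using b by (intro eq[OF l]) auto
    ultimately show ?thesis using \<rho>[of "b l"] by simp
  qed
  then have \<sigma>': "1 < \<sigma>' i" for i by (simp add: \<sigma>'_def)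
  moreover have "strict_mono_on {1..m} \<sigma>'" using \<sigma>m by (simp add: \<sigma>'_def strict_mono_on_def)
  moreover have "\<kappa> i \<in> {1..m} \<and> \<sigma>' (\<kappa> i) = \<rho> i" if "i \<in> {1..n}" for i
    using \<kappa>[OF that] eq[of "\<kappa> i" i] by (simp add: \<sigma>'_def)
  moreover have "multiclass_sorted n \<rho> = multi_law n m \<sigma>' \<kappa>"
  proof -
    have "exp_config m \<sigma> = exp_config m \<sigma>'"
      unfolding exp_config_def by (rule PiM_cong) (auto simp: \<sigma>'_def)
    then show ?thesis
      unfolding multiclass_sorted_def x_def[symmetric] x multi_law_def
        by (simp add: expand_blocks_def \<kappa>_def)
  qed
  ultimately show ?thesis by blast
qed

lemma multiclass_measure_multi_law:
  assumes n: "1 \<le> n" and \<rho>: "\<And>i. i \<in> {1..n} \<Longrightarrow> 1 < \<rho> i"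
  shows "\<exists>m \<sigma> \<kappa>. (\<forall>i. 1 < \<sigma> i) \<and> strict_mono_on {1..m} \<sigma> \<and> (\<forall>i\<in>{1..n}. \<kappa> i \<in> {1..m} \<and> \<sigma> (\<kappa> i) = \<rho> i)
      \<and>
    multiclass_measure n \<rho> = multi_law n m \<sigma> \<kappa>"
proof -
  define \<pi> where "\<pi> = (SOME \<pi>. \<pi> permutes {1..n} \<and> mono_on {1..n} (\<rho> \<circ> \<pi>))"
  have \<pi>: "\<pi> permutes {1..n}" "mono_on {1..n} (\<rho> \<circ> \<pi>)"
    using someI_ex[OF sorting_permutation[of n \<rho>]] by (auto simp: \<pi>_def)
  have "1 < (\<rho> \<circ> \<pi>) i" if "i \<in> {1..n}" for i
    using \<rho>[of "\<pi> i"] permutes_in_image[OF \<pi>(1), of i] that by simp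
  from multiclass_sorted_multi_law[OF n \<pi>(2) this] obtain m \<sigma> \<kappa> where
    \<sigma>: "\<forall>i. 1 < \<sigma> i" and \<sigma>m: "strict_mono_on {1..m} \<sigma>"
    and \<kappa>: "\<forall>i\<in>{1..n}. \<kappa> i \<in> {1..m} \<and> \<sigma> (\<kappa> i) = (\<rho> \<circ> \<pi>) i"
    and law: "multiclass_sorted n (\<rho> \<circ> \<pi>) = multi_law n m \<sigma> \<kappa>" by blast
  have inv: "inv \<pi> i \<in> {1..n}" if "i \<in> {1..n}" for i
    using permutes_in_image[OF permutes_inv[OF \<pi>(1)], of i] that by simp
  have m1: "(\<lambda>\<xi>. \<lambda>i\<in>{1..n}. \<xi> (inv \<pi> i)) \<in> config_space n \<rightarrow>\<^sub>M config_space n"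
    using inv by (intro measurable_configI measurable_config_component[where n = n]) auto
  have m2: "(\<lambda>I. \<lambda>i\<in>{1..n}. multi_queue m I (\<kappa> i)) \<in> exp_config m \<sigma> \<rightarrow>\<^sub>M config_space n"
    using measurable_multi_queue_exp[of \<sigma> m n \<kappa>] \<sigma> \<sigma>m \<kappa> by blast
  have "multiclass_measure n \<rho> = distr (multi_law n m \<sigma> \<kappa>) (config_space n) (\<lambda>\<xi>. \<lambda>i\<in>{1..n}. \<xi> (inv \<pi>
      i))"
    unfolding multiclass_measure_def Let_def \<pi>_def[symmetric] law ..
  also have "\<dots> = distr (exp_config m \<sigma>) (config_space n)
      ((\<lambda>\<xi>. \<lambda>i\<in>{1..n}. \<xi> (inv \<pi> i)) \<circ> (\<lambda>I. \<lambda>i\<in>{1..n}. multi_queue m I (\<kappa> i)))"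
    unfolding multi_law_def by (rule distr_distr[OF m1 m2])
  \<comment> \<open>Undoing the sorting only relabels the components, which is absorbed into
    \<open>\<kappa>\<close>.\<close>
  also have "\<dots> = multi_law n m \<sigma> (\<kappa> \<circ> inv \<pi>)"
    unfolding multi_law_def using inv by (intro distr_cong) (auto simp: restrict_def fun_eq_iff)
  finally have "multiclass_measure n \<rho> = multi_law n m \<sigma> (\<kappa> \<circ> inv \<pi>)" .
  moreover have "(\<kappa> \<circ> inv \<pi>) i \<in> {1..m} \<and> \<sigma> ((\<kappa> \<circ> inv \<pi>) i) = \<rho> i" if "i \<in> {1..n}" for i
    using \<kappa> inv[OF that] permutes_inverses(1)[OF \<pi>(1), of i] by simp
  ultimately show ?thesis using \<sigma> \<sigma>m by blast
qed

section \<open>Coupled queues\<close>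

definition delay :: "seq \<Rightarrow> seq \<Rightarrow> seq \<Rightarrow> seq" where
  "delay I I' w k = sojourn I w k - sojourn I' w k"

text \<open>With \<open>x = I k - I' k\<close> and \<open>y\<close> the delay at
  \<open>k - 1\<close>, this is twice the smaller of the two absolute values if \<open>x\<close> and
  \<open>y\<close> have the same sign, and 0 otherwise. The queue passes on \<open>x - y\<close>, so
  equal signs are the ones that cancel.\<close>

definition loss :: "seq \<Rightarrow> seq \<Rightarrow> seq \<Rightarrow> seq" where
  "loss I I' w k = \<bar>I k - I' k\<bar> + \<bar>delay I I' w (k - 1)\<bar> - \<bar>(I k - I' k) - delay I I' w (k - 1)\<bar>"

lemma loss_nonneg: "0 \<le> loss I I' w k"
  unfolding loss_def by linarith

lemma loss_le: "loss I I' w k \<le> 2 * \<bar>I k - I' k\<bar>"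
proof -
  have "\<bar>x\<bar> + \<bar>y\<bar> - \<bar>x - y\<bar> \<le> 2 * \<bar>x\<bar>" for x y :: real
    using abs_triangle_ineq2_sym[of y x] by simp
  then show ?thesis unfolding loss_def .
qed

text \<open>A queue splits \<open>x = I k - J (k - 1)\<close> into its positive part, which goes to the output, and its
  negative part, which goes to the sojourn time.  Both parts are monotone, so the distance of two
  copies splits accordingly.\<close>

lemma queue_map_dist:
  assumes "queue_stable I w" "queue_stable I' w"
  shows "\<bar>queue_map I w k - queue_map I' w k\<bar> + \<bar>delay I I' w k\<bar>
    = \<bar>I k - I' k\<bar> + \<bar>delay I I' w (k - 1)\<bar> - loss I I' w k"
  unfolding loss_def delay_def queue_map_sojourn[OF assms(1)] queue_map_sojourn[OF assms(2)]
    sojourn_step[OF assms(1), of k] sojourn_step[OF assms(2), of k] by linarith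

lemma delay_shift:
  assumes "queue_stable I w" "queue_stable I' w"
  shows "delay (shift I) (shift I') (shift w) k = delay I I' w (k + 1)"
  unfolding delay_def sojourn_shift[OF assms(1)] sojourn_shift[OF assms(2)] by (simp add: shift_def)

lemma loss_shift:
  assumes "queue_stable I w" "queue_stable I' w"
  shows "loss (shift I) (shift I') (shift w) k = loss I I' w (k + 1)"
  unfolding loss_def delay_shift[OF assms] by (simp add: shift_def)

lemma sojourn_busy:
  assumes "queue_stable I w" "\<And>k. 0 \<le> w k"
  shows "w a - (\<Sum>j<n. I (a + 1 + int j)) \<le> sojourn I w (a + int n)"
proof (induction n)
  case 0
  then show ?case using sojourn_ge[OF assms(1)] by simp
next
  case (Suc n)
  have "sojourn I w (a + int n) - I (a + int n + 1) \<le> sojourn I w (a + int n + 1)"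
    using sojourn_step[OF assms(1), of "a + int n + 1"] assms(2)[of "a + int n + 1"] by simp
  with Suc show ?case by (simp add: algebra_simps)
qed

text \<open>A long service time at \<open>a\<close> keeps both queues busy during the following window, so that all
  discrepancies of the window are moved to the delays, where those of opposite signs cancel.\<close>

lemma loss_window:
  assumes st: "queue_stable I w" "queue_stable I' w"
    and nonneg: "\<And>k. 0 \<le> I k" "\<And>k. 0 \<le> I' k" "\<And>k. 0 \<le> w k"
    and busy: "(\<Sum>j<n. I (a + 1 + int j)) + (\<Sum>j<n. I' (a + 1 + int j)) \<le> w a"
  shows "(\<Sum>j<n. \<bar>I (a + 1 + int j) - I' (a + 1 + int j)\<bar>) - \<bar>\<Sum>j<n. I (a + 1 + int j) - I' (a + 1
      + int j)\<bar>
    \<le> (\<Sum>j<n. loss I I' w (a + 1 + int j))"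
proof -
  have step: "queue_map I w (a + 1 + int j) = queue_map I' w (a + 1 + int j) \<and>
      delay I I' w (a + 1 + int j) = delay I I' w (a + int j) - (I (a + 1 + int j) - I' (a + 1 + int
          j))"
    if "j < n" for j
  proof -
    have le: "(\<Sum>i<j. K (a + 1 + int i)) + K (a + 1 + int j) \<le> (\<Sum>i<n. K (a + 1 + int i))"
      if "\<And>k. 0 \<le> K k" for K :: seq
    proof -
      have "(\<Sum>i<Suc j. K (a + 1 + int i)) \<le> (\<Sum>i<n. K (a + 1 + int i))"
        using \<open>j < n\<close> that by (intro sum_mono2) auto
      then show ?thesis by simp
    qed
    have pos: "0 \<le> (\<Sum>i<n. K (a + 1 + int i))" if "\<And>k. 0 \<le> K k" for K :: seq
      using that by (intro sum_nonneg) auto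
    have 1: "I (a + 1 + int j) \<le> sojourn I w (a + int j)"
      using sojourn_busy[OF st(1) nonneg(3), where a = a
          and n = j] busy le[of I, OF nonneg(1)] pos[of I', OF nonneg(2)] by linarith
    have 2: "I' (a + 1 + int j) \<le> sojourn I' w (a + int j)"
      using sojourn_busy[OF st(2) nonneg(3), where a = a
          and n = j] busy le[of I', OF nonneg(2)] pos[of I, OF nonneg(1)] by linarith
    have eq: "a + 1 + int j - 1 = a + int j" by simp
    show ?thesis
      unfolding delay_def queue_map_sojourn[OF st(1)] queue_map_sojourn[OF st(2)]
        sojourn_step[OF st(1), of "a + 1 + int j"] sojourn_step[OF st(2), of "a + 1 + int j"] eq
      using 1 2 by auto
  qed
  \<comment> \<open>The outputs agree throughout the window, so the balance in
    \<open>queue_map_dist\<close> reduces to the delays and telescopes.\<close>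
  have tel: "(\<Sum>j<m. loss I I' w (a + 1 + int j)) = (\<Sum>j<m. \<bar>I (a + 1 + int j) - I' (a + 1 + int j)\<bar>)
      + \<bar>delay I I' w a\<bar> - \<bar>delay I I' w (a + int m)\<bar> \<and>
      delay I I' w (a + int m) = delay I I' w a - (\<Sum>j<m. I (a + 1 + int j) - I' (a + 1 + int j))"
    if "m \<le> n" for m
    using that
  proof (induction m)
    case (Suc m)
    have eq: "a + 1 + int m - 1 = a + int m" "a + int (Suc m) = a + 1 + int m" by auto
    show ?case
      using Suc step[of m] queue_map_dist[OF st, of "a + 1 + int m"] unfolding eq by simp
  qed simp
  \<comment> \<open>The triangle inequality: the absolute delay grows over the window by at most the
    absolute value of the summed discrepancies.\<close>
  show ?thesis using tel[of n] by linarith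
qed

lemma sum_window: "(\<Sum>k=- int N..0. f k) = (\<Sum>j<Suc N. f (- int N - 1 + 1 + int j))"
  by (rule sum.reindex_bij_witness[of _ "\<lambda>j. - int N + int j" "\<lambda>k. nat (k + int N)"]) auto

lemma loss_window':
  assumes st: "queue_stable I w" "queue_stable I' w"
    and nonneg: "\<And>k. 0 \<le> I k" "\<And>k. 0 \<le> I' k" "\<And>k. 0 \<le> w k"
    and busy: "(\<Sum>k=- int N..0. I k) + (\<Sum>k=- int N..0. I' k) \<le> w (- int N - 1)"
  shows "(\<Sum>k=- int N..0. \<bar>I k - I' k\<bar>) - \<bar>\<Sum>k=- int N..0. I k - I' k\<bar>
      \<le> (\<Sum>k=- int N..0. loss I I' w k)"
  using loss_window[OF st nonneg, where a = "- int N - 1" and n = "Suc N"] busy unfolding sum_window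
    by blast

lemma measurable_delay [measurable (raw)]:
  assumes [measurable]: "f \<in> M \<rightarrow>\<^sub>M seq_space" "g \<in> M \<rightarrow>\<^sub>M seq_space" "h \<in> M \<rightarrow>\<^sub>M seq_space"
  shows "(\<lambda>x. delay (f x) (g x) (h x) k) \<in> borel_measurable M"
  unfolding delay_def by measurable

lemma measurable_loss [measurable (raw)]:
  assumes [measurable]: "f \<in> M \<rightarrow>\<^sub>M seq_space" "g \<in> M \<rightarrow>\<^sub>M seq_space" "h \<in> M \<rightarrow>\<^sub>M seq_space"
  shows "(\<lambda>x. loss (f x) (g x) (h x) k) \<in> borel_measurable M"
  unfolding loss_def by measurable

lemma emeasure_expo_tail:
  assumes "0 \<le> t"
  shows "emeasure (expo 1) {t<..} = ennreal (exp (- t))"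
proof -
  interpret prob_space "expo 1" by (rule prob_space_expo) simp
  have "distributed (expo 1) lborel (\<lambda>x. x) (exponential_density 1)"
    unfolding distributed_def by (auto simp: distr_id2 exponential_density_def[abs_def])
  from exponential_distributedD_gt[OF this assms] have "prob {t<..} = exp (- t)"
    by (simp add: greaterThan_def)
  then show ?thesis unfolding emeasure_eq_measure by simp
qed

text \<open>The delays to which this is applied need not have a finite mean.\<close>

lemma (in prob_space) integral_diff_same_law:
  fixes X Y :: "'a \<Rightarrow> real"
  assumes [measurable]: "X \<in> borel_measurable M" "Y \<in> borel_measurable M"
    and pos: "\<And>x. 0 \<le> X x" "\<And>x. 0 \<le> Y x"
    and law: "\<And>f. f \<in> borel_measurable borel \<Longrightarrow> (\<integral>\<^sup>+x. ennreal (f (X x)) \<partial>M)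
        = (\<integral>\<^sup>+x. ennreal (f (Y x)) \<partial>M)"
    and int: "integrable M (\<lambda>x. X x - Y x)"
  shows "(\<integral>x. X x - Y x \<partial>M) = 0"
proof -
  have "(\<lambda>n. \<integral>x. min (X x) (real n) - min (Y x) (real n) \<partial>M) \<longlonglongrightarrow> (\<integral>x. X x - Y x \<partial>M)"
  proof (rule integral_dominated_convergence[where w = "\<lambda>x. \<bar>X x - Y x\<bar>"])
    show "AE x in M. (\<lambda>n. min (X x) (real n) - min (Y x) (real n)) \<longlonglongrightarrow> X x - Y x"
    proof (intro AE_I2 tendsto_eventually)
      fix x
      obtain m where "max (X x) (Y x) \<le> real m" using real_arch_simple by blast
      then have "min (X x) (real n) - min (Y x) (real n) = X x - Y x" if "m \<le> n" for n
        using that by (simp add: min_def)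
      then show "\<forall>\<^sub>F n in sequentially. min (X x) (real n) - min (Y x) (real n) = X x - Y x"
        unfolding eventually_sequentially by blast
    qed
    show "AE x in M. norm (min (X x) (real n) - min (Y x) (real n)) \<le> \<bar>X x - Y x\<bar>" for n
      by (intro AE_I2) (simp add: min_def)
  qed (use int in auto)
  moreover have "(\<integral>x. min (X x) (real n) - min (Y x) (real n) \<partial>M) = 0" for n
  proof -
    have i: "integrable M (\<lambda>x. min (Z x) (real n))" if "Z \<in> borel_measurable M" "\<And>x. 0 \<le> Z x" for Z
      using that by (intro integrable_const_bound[where B = "real n"]) auto
    have "(\<integral>x. min (X x) (real n) \<partial>M) = (\<integral>x. min (Y x) (real n) \<partial>M)"
      using law[of "\<lambda>y. min y (real n)"] pos by (simp add: integral_eq_nn_integral)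
    then show ?thesis using i[of X] i[of Y] pos by simp
  qed
  ultimately show ?thesis by (simp add: LIMSEQ_const_iff)
qed

lemma int_shift_invariant:
  fixes f :: "int \<Rightarrow> 'a"
  assumes "\<And>k. f (k + 1) = f k"
  shows "f k = f 0"
proof (induction k rule: int_induct[where k = 0])
  case (step1 i)
  then show ?case using assms[of i] by simp
next
  case (step2 i)
  then show ?case using assms[of "i - 1"] by simp
qed simp

section \<open>Shift-invariant couplings of two sequences\<close>

definition regular :: "seq \<Rightarrow> bool" where
  "regular z \<longleftrightarrow> (\<forall>k. 0 \<le> z k) \<and> (\<exists>L>1. cesaro z L)"

lemma measurable_regular [measurable]: "Measurable.pred seq_space regular"
proof -
  have [measurable]: "Measurable.pred seq_space (\<lambda>z. \<exists>L>1. cesaro z L)"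
    by (intro measurable_cesaro_ex) measurable
  show ?thesis unfolding regular_def[abs_def] by measurable
qed

text \<open>The exceptional set of driving sequences is independent of \<open>z\<close>, as only the
  average and the signs of \<open>w\<close> matter. One null set therefore serves both copies and
  all components.\<close>

lemma AE_regular_admissible: "AE w in exp_seq 1. \<forall>z. regular z \<longrightarrow> admissible z w"
  using AE_exp_seq_cesaro[of 1, simplified] AE_exp_seq_nonneg[of 1, simplified]
  by eventually_elim (auto simp: regular_def admissible_def intro: cesaro_queue_stable)

text \<open>One component of a coupling. Integrability of the outputs is an assumption at this
  level; for couplings of invariant measures it holds because the outputs have the marginals of the
  inputs.\<close>

locale seq_coupling = prob_space \<Lambda> for \<Lambda> :: "(seq \<times> seq) measure" +
  assumes sets_\<Lambda> [measurable_cong]: "sets \<Lambda> = sets seq2_space"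
    and shift_\<Lambda>: "\<And>F. F \<in> borel_measurable seq2_space \<Longrightarrow>
      (\<integral>\<^sup>+p. F (shift (fst p), shift (snd p)) \<partial>\<Lambda>) = (\<integral>\<^sup>+p. F p \<partial>\<Lambda>)"
    and regular_\<Lambda>: "AE p in \<Lambda>. regular (fst p) \<and> regular (snd p)"
    and int_\<Lambda>: "integrable \<Lambda> (\<lambda>p. fst p 0)" "integrable \<Lambda> (\<lambda>p. snd p 0)"
    and int_D: "integrable (\<Lambda> \<Otimes>\<^sub>M exp_seq 1) (\<lambda>q. queue_map (fst (fst q)) (snd q) 0)"
      "integrable (\<Lambda> \<Otimes>\<^sub>M exp_seq 1) (\<lambda>q. queue_map (snd (fst q)) (snd q) 0)"
begin

abbreviation R where "R \<equiv> \<Lambda> \<Otimes>\<^sub>M exp_seq 1"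

sublocale W: prob_space "exp_seq 1"
  by (rule prob_space_exp_seq) simp

sublocale P: pair_prob_space \<Lambda> "exp_seq 1" ..

lemma AE_R: "AE q in R. admissible (fst (fst q)) (snd q) \<and> admissible (snd (fst q)) (snd q)"
proof (rule P.AE_pair_measure)
  show "AE p in \<Lambda>. AE w in exp_seq 1. admissible (fst (fst (p, w))) (snd (p, w))
      \<and> admissible (snd (fst (p, w))) (snd (p, w))"
    using regular_\<Lambda>
  proof eventually_elim
    case (elim p)
    show ?case using AE_regular_admissible by eventually_elim (use elim in auto)
  qed
qed measurable

lemma shift_R:
  assumes F [measurable]: "F \<in> borel_measurable (seq2_space \<Otimes>\<^sub>M seq_space)"
  shows "(\<integral>\<^sup>+q. F ((shift (fst (fst q)), shift (snd (fst q))), shift (snd q)) \<partial>R) = (\<integral>\<^sup>+q. F q \<partial>R)"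
proof -
  have "(\<integral>\<^sup>+q. F ((shift (fst (fst q)), shift (snd (fst q))), shift (snd q)) \<partial>R)
    = (\<integral>\<^sup>+p. \<integral>\<^sup>+w. F ((shift (fst p), shift (snd p)), shift w) \<partial>exp_seq 1 \<partial>\<Lambda>)"
    by (subst W.nn_integral_fst[symmetric]) auto
  also have "\<dots> = (\<integral>\<^sup>+p. \<integral>\<^sup>+w. F ((shift (fst p), shift (snd p)), w) \<partial>exp_seq 1 \<partial>\<Lambda>)"
    by (intro nn_integral_cong nn_integral_exp_seq_shift) auto
  also have "\<dots> = (\<integral>\<^sup>+p. \<integral>\<^sup>+w. F (p, w) \<partial>exp_seq 1 \<partial>\<Lambda>)"
    by (rule shift_\<Lambda>) measurable
  also have "\<dots> = (\<integral>\<^sup>+q. F q \<partial>R)"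
    by (rule W.nn_integral_fst) measurable
  finally show ?thesis .
qed

lemma stationary_\<Lambda>:
  assumes [measurable]: "f \<in> borel_measurable (borel \<Otimes>\<^sub>M borel)"
  shows "(\<integral>\<^sup>+p. f (fst p k, snd p k) \<partial>\<Lambda>) = (\<integral>\<^sup>+p. f (fst p 0, snd p 0) \<partial>\<Lambda>)"
proof (rule int_shift_invariant[where f = "\<lambda>k. \<integral>\<^sup>+p. f (fst p k, snd p k) \<partial>\<Lambda>"])
  fix k
  show "(\<integral>\<^sup>+p. f (fst p (k + 1), snd p (k + 1)) \<partial>\<Lambda>) = (\<integral>\<^sup>+p. f (fst p k, snd p k) \<partial>\<Lambda>)"
    using shift_\<Lambda>[of "\<lambda>p. f (fst p k, snd p k)"] by (simp add: shift_def)
qed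

lemma integral_stationary_\<Lambda>:
  fixes f :: "real \<times> real \<Rightarrow> real"
  assumes [measurable]: "f \<in> borel_measurable (borel \<Otimes>\<^sub>M borel)" and pos: "\<And>x. 0 \<le> f x"
    and int: "integrable \<Lambda> (\<lambda>p. f (fst p 0, snd p 0))"
  shows "integrable \<Lambda> (\<lambda>p. f (fst p k, snd p k))"
    "(\<integral>p. f (fst p k, snd p k) \<partial>\<Lambda>) = (\<integral>p. f (fst p 0, snd p 0) \<partial>\<Lambda>)"
proof -
  have eq: "(\<integral>\<^sup>+p. ennreal (f (fst p k, snd p k)) \<partial>\<Lambda>) = (\<integral>\<^sup>+p. ennreal (f (fst p 0, snd p 0)) \<partial>\<Lambda>)"
    by (rule stationary_\<Lambda>[of "\<lambda>x. ennreal (f x)"]) measurable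
  show "integrable \<Lambda> (\<lambda>p. f (fst p k, snd p k))"
    using int pos eq by (subst integrable_iff_bounded) (simp add: integrable_iff_bounded)
  show "(\<integral>p. f (fst p k, snd p k) \<partial>\<Lambda>) = (\<integral>p. f (fst p 0, snd p 0) \<partial>\<Lambda>)"
    using eq pos by (simp add: integral_eq_nn_integral)
qed

lemma integrable_component: "integrable \<Lambda> (\<lambda>p. fst p k)" "integrable \<Lambda> (\<lambda>p. snd p k)"
proof -
  have "integrable \<Lambda> (\<lambda>p. \<bar>fst p k\<bar>)" "integrable \<Lambda> (\<lambda>p. \<bar>snd p k\<bar>)"
    using integral_stationary_\<Lambda>(1)[of "\<lambda>x. \<bar>fst x\<bar>" k] integral_stationary_\<Lambda>(1)[of
        "\<lambda>x. \<bar>snd x\<bar>" k] int_\<Lambda> by simp_all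
  then show "integrable \<Lambda> (\<lambda>p. fst p k)" "integrable \<Lambda> (\<lambda>p. snd p k)"
    by (simp_all add: integrable_abs_iff)
qed

lemma integrable_dist: "integrable \<Lambda> (\<lambda>p. \<bar>fst p k - snd p k\<bar>)"
  using integral_stationary_\<Lambda>(1)[of "\<lambda>x. \<bar>fst x - snd x\<bar>" k] int_\<Lambda> by simp

lemma integral_dist: "(\<integral>p. \<bar>fst p k - snd p k\<bar> \<partial>\<Lambda>) = (\<integral>p. \<bar>fst p 0 - snd p 0\<bar> \<partial>\<Lambda>)"
  using integral_stationary_\<Lambda>(2)[of "\<lambda>x. \<bar>fst x - snd x\<bar>" k] int_\<Lambda> by simp

lemma integral_R_\<Lambda>:
  fixes f :: "seq \<times> seq \<Rightarrow> real"
  assumes "integrable \<Lambda> f"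
  shows "integrable R (\<lambda>q. f (fst q))" "(\<integral>q. f (fst q) \<partial>R) = (\<integral>p. f p \<partial>\<Lambda>)"
proof -
  have d: "distr R \<Lambda> fst = \<Lambda>" by (rule W.distr_pair_fst)
  have i: "integrable (distr R \<Lambda> fst) f" using assms d by simp
  show "integrable R (\<lambda>q. f (fst q))" by (rule integrable_distr[OF measurable_fst i])
  show "(\<integral>q. f (fst q) \<partial>R) = (\<integral>p. f p \<partial>\<Lambda>)"
    using integral_distr[of fst R \<Lambda> f] assms d by simp
qed

abbreviation loss_R where "loss_R k q \<equiv> loss (fst (fst q)) (snd (fst q)) (snd q) k"
abbreviation delay_R where "delay_R k q \<equiv> delay (fst (fst q)) (snd (fst q)) (snd q) k"

lemma nn_integral_loss: "(\<integral>\<^sup>+q. ennreal (loss_R k q) \<partial>R) = (\<integral>\<^sup>+q. ennreal (loss_R 0 q) \<partial>R)"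
proof (rule int_shift_invariant[where f = "\<lambda>k. \<integral>\<^sup>+q. ennreal (loss_R k q) \<partial>R"])
  fix k
  have "(\<integral>\<^sup>+q. ennreal (loss_R (k + 1) q) \<partial>R)
    = (\<integral>\<^sup>+q. ennreal (loss_R k ((shift (fst (fst q)), shift (snd (fst q))), shift (snd q))) \<partial>R)"
    by (rule nn_integral_cong_AE, rule AE_mp[OF AE_R], rule AE_I2, rule impI) (simp add:
        admissible_def loss_shift)
  also have "\<dots> = (\<integral>\<^sup>+q. ennreal (loss_R k q) \<partial>R)" by (rule shift_R) measurable
  finally show "(\<integral>\<^sup>+q. ennreal (loss_R (k + 1) q) \<partial>R) = (\<integral>\<^sup>+q. ennreal (loss_R k q) \<partial>R)" .
qed

lemma integrable_loss: "integrable R (loss_R k)"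
proof (rule Bochner_Integration.integrable_bound)
  show "integrable R (\<lambda>q. 2 * \<bar>fst (fst q) k - snd (fst q) k\<bar>)"
    using integral_R_\<Lambda>(1)[OF integrable_dist] by simp
  show "AE q in R. norm (loss_R k q) \<le> norm (2 * \<bar>fst (fst q) k - snd (fst q) k\<bar>)"
  proof (rule AE_I2)
    fix q
    show "norm (loss_R k q) \<le> norm (2 * \<bar>fst (fst q) k - snd (fst q) k\<bar>)"
      using loss_nonneg[of "fst (fst q)" "snd (fst q)" "snd q" k] loss_le[of "fst (fst q)"
          "snd (fst q)" "snd q" k]
      by simp
  qed
qed measurable

text \<open>\<open>queue_map_dist\<close> expresses the increment of the absolute delay from site
  \<open>-1\<close> to site 0 by integrable quantities. By stationarity it is a difference of two
  variables with the same law, so its mean is 0 even if the delays themselves are not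
  integrable.\<close>

lemma dist_decrease:
  "(\<integral>q. \<bar>queue_map (fst (fst q)) (snd q) 0 - queue_map (snd (fst q)) (snd q) 0\<bar> \<partial>R)
    = (\<integral>p. \<bar>fst p 0 - snd p 0\<bar> \<partial>\<Lambda>) - (\<integral>q. loss_R 0 q \<partial>R)"
proof -
  let ?D = "\<lambda>q. \<bar>queue_map (fst (fst q)) (snd q) 0 - queue_map (snd (fst q)) (snd q) 0\<bar>"
  let ?d = "\<lambda>q :: (seq \<times> seq) \<times> seq. \<bar>fst (fst q) 0 - snd (fst q) 0\<bar>"
  have iD: "integrable R ?D" using int_D by simp
  have id: "integrable R ?d" using integral_R_\<Lambda>(1)[OF integrable_dist] .
  have eq: "AE q in R. \<bar>delay_R 0 q\<bar> - \<bar>delay_R (- 1) q\<bar> = ?d q - ?D q - loss_R 0 q"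
    using AE_R
  proof eventually_elim
    case (elim q)
    then show ?case using queue_map_dist[of "fst (fst q)" "snd q" "snd (fst q)" 0]
      by (simp add: admissible_def)
  qed
  have i: "integrable R (\<lambda>q. ?d q - ?D q - loss_R 0 q)" using iD id integrable_loss by simp
  have "(\<integral>q. \<bar>delay_R 0 q\<bar> - \<bar>delay_R (- 1) q\<bar> \<partial>R) = 0"
  proof (rule P.integral_diff_same_law)
    fix f :: "real \<Rightarrow> real" assume [measurable]: "f \<in> borel_measurable borel"
    have "(\<integral>\<^sup>+q. ennreal (f \<bar>delay_R 0 q\<bar>) \<partial>R)
      = (\<integral>\<^sup>+q. ennreal (f \<bar>delay_R (- 1) ((shift (fst (fst q)), shift (snd (fst q))), shift (snd
          q))\<bar>) \<partial>R)"
      by (rule nn_integral_cong_AE, rule AE_mp[OF AE_R], rule AE_I2, rule impI) (simp add: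
          admissible_def delay_shift)
    also have "\<dots> = (\<integral>\<^sup>+q. ennreal (f \<bar>delay_R (- 1) q\<bar>) \<partial>R)" by (rule shift_R) measurable
    finally show "(\<integral>\<^sup>+q. ennreal (f \<bar>delay_R 0 q\<bar>) \<partial>R) = (\<integral>\<^sup>+q. ennreal (f \<bar>delay_R (- 1) q\<bar>) \<partial>R)" .
  next
    show "integrable R (\<lambda>q. \<bar>delay_R 0 q\<bar> - \<bar>delay_R (- 1) q\<bar>)"
    proof (rule integrable_cong_AE_imp[OF i])
      show "AE q in R. ?d q - ?D q - loss_R 0 q = \<bar>delay_R 0 q\<bar> - \<bar>delay_R (- 1) q\<bar>"
        using eq by eventually_elim (rule sym)
    qed measurable
  qed (simp_all, measurable)
  moreover have "(\<integral>q. \<bar>delay_R 0 q\<bar> - \<bar>delay_R (- 1) q\<bar> \<partial>R) = (\<integral>q. ?d q - ?D q - loss_R 0 q \<partial>R)"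
    by (rule integral_cong_AE[OF _ _ eq]) measurable
  moreover have "(\<integral>q. ?d q \<partial>R) = (\<integral>p. \<bar>fst p 0 - snd p 0\<bar> \<partial>\<Lambda>)"
    by (rule integral_R_\<Lambda>(2)[OF integrable_dist])
  ultimately show ?thesis using iD id integrable_loss by simp
qed

abbreviation total :: "nat \<Rightarrow> seq \<Rightarrow> real" where
  "total N z \<equiv> (\<Sum>k=- int N..0. z k)"

text \<open>It vanishes exactly when no two discrepancies of the window have opposite signs; in
  general it measures the mass that would cancel on addition.\<close>

definition mixed :: "nat \<Rightarrow> seq \<times> seq \<Rightarrow> real" where
  "mixed N p = (\<Sum>k=- int N..0. \<bar>fst p k - snd p k\<bar>) - \<bar>\<Sum>k=- int N..0. fst p k - snd p k\<bar>"

lemma mixed_nonneg: "0 \<le> mixed N p"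
  using sum_abs[of "\<lambda>k. fst p k - snd p k"] by (simp add: mixed_def)

lemma measurable_mixed [measurable]: "mixed N \<in> borel_measurable seq2_space"
  unfolding mixed_def[abs_def] by measurable

lemma integrable_mixed: "integrable \<Lambda> (mixed N)"
proof -
  have "integrable \<Lambda> (\<lambda>p. \<Sum>k=- int N..0. fst p k - snd p k)"
    by (intro Bochner_Integration.integrable_sum Bochner_Integration.integrable_diff
        integrable_component)
  then show ?thesis
    unfolding mixed_def[abs_def]
    by (intro Bochner_Integration.integrable_diff[OF Bochner_Integration.integrable_sum[OF
        integrable_dist] integrable_abs])
qed

text \<open>The service at site \<open>- N - 1\<close> is independent of the two copies and exceeds
  their combined content \<open>S\<close> of the window with probability \<open>exp (- S)\<close>.
  On that event \<open>loss_window'\<close> bounds the loss in the window from below, and all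
  \<open>N + 1\<close> sites have the same mean loss.\<close>

lemma loss_lower_bound:
  "(\<integral>p. exp (- (total N (fst p) + total N (snd p))) * mixed N p \<partial>\<Lambda>) \<le> real (Suc N)
      * (\<integral>q. loss_R 0 q \<partial>R)"
proof -
  let ?S = "\<lambda>p. total N (fst p) + total N (snd p)"
  let ?a = "- int N - 1"
  have S0: "AE p in \<Lambda>. 0 \<le> ?S p"
    using regular_\<Lambda> by eventually_elim (auto simp: regular_def intro!: add_nonneg_nonneg sum_nonneg)
  have "(\<integral>\<^sup>+p. ennreal (exp (- ?S p) * mixed N p) \<partial>\<Lambda>)
    = (\<integral>\<^sup>+p. \<integral>\<^sup>+w. ennreal (mixed N p) * indicator {?S p<..} (w ?a) \<partial>exp_seq 1 \<partial>\<Lambda>)"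
  proof (rule nn_integral_cong_AE)
    show "AE p in \<Lambda>. ennreal (exp (- ?S p) * mixed N p)
      = (\<integral>\<^sup>+w. ennreal (mixed N p) * indicator {?S p<..} (w ?a) \<partial>exp_seq 1)"
      using S0
    proof eventually_elim
      case (elim p)
      have "(\<integral>\<^sup>+w. indicator {?S p<..} (w ?a) \<partial>exp_seq 1) = emeasure (expo 1) {?S p<..}"
        using nn_integral_exp_seq_component[of 1 "indicator {?S p<..}" ?a] by simp
      also have "\<dots> = ennreal (exp (- ?S p))" by (rule emeasure_expo_tail[OF elim])
      finally show ?case
        by (subst nn_integral_cmult) (auto simp: ennreal_mult mixed_nonneg mult.commute)
    qed
  qed
  also have "\<dots> = (\<integral>\<^sup>+q. ennreal (mixed N (fst q)) * indicator {?S (fst q)<..} (snd q ?a) \<partial>R)"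
  proof -
    have "(\<lambda>q. ennreal (mixed N (fst q))
        * (if ?S (fst q) < snd q ?a then 1 else 0)) \<in> borel_measurable R"
      by measurable
    moreover have "(if x < y then 1 else 0) = (indicator {x<..} y :: ennreal)" for x y :: real
      by simp
    ultimately have "(\<lambda>q. ennreal (mixed N (fst q))
        * indicator {?S (fst q)<..} (snd q ?a)) \<in> borel_measurable R"
      by simp
    from W.nn_integral_fst[OF this] show ?thesis by simp
  qed
  also have "\<dots> \<le> (\<integral>\<^sup>+q. ennreal (\<Sum>k=- int N..0. loss_R k q) \<partial>R)"
  proof (rule nn_integral_mono_AE)
    show "AE q in R. ennreal (mixed N (fst q)) * indicator {?S (fst q)<..} (snd q ?a)
      \<le> ennreal (\<Sum>k=- int N..0. loss_R k q)"
      using AE_R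
    proof eventually_elim
      case (elim q)
      have "mixed N (fst q) \<le> (\<Sum>k=- int N..0. loss_R k q)" if "?S (fst q) < snd q ?a"
        unfolding mixed_def using elim that
        by (intro loss_window') (auto simp: admissible_def)
      then show ?case by (auto split: split_indicator intro: ennreal_leI)
    qed
  qed
  also have "\<dots> = (\<Sum>k=- int N..0. \<integral>\<^sup>+q. ennreal (loss_R k q) \<partial>R)"
    by (simp add: sum_ennreal[symmetric] loss_nonneg nn_integral_sum del: sum_ennreal)
  also have "\<dots> = (\<Sum>k=- int N..0. ennreal (\<integral>q. loss_R 0 q \<partial>R))"
    by (subst nn_integral_loss) (simp add: nn_integral_eq_integral integrable_loss loss_nonneg)
  also have "\<dots> = ennreal (real (Suc N) * (\<integral>q. loss_R 0 q \<partial>R))"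
  proof -
    have c: "card {- int N..0} = Suc N" by simp
    show ?thesis
      unfolding sum_constant c ennreal_of_nat_eq_real_of_nat
      by (rule ennreal_mult[symmetric]) (auto intro!: Bochner_Integration.integral_nonneg
          loss_nonneg)
  qed
  finally have le: "(\<integral>\<^sup>+p. ennreal (exp (- ?S p) * mixed N p) \<partial>\<Lambda>) \<le> ennreal (real (Suc N)
      * (\<integral>q. loss_R 0 q \<partial>R))" .
  have pos: "0 \<le> (\<integral>q. loss_R 0 q \<partial>R)" by (intro Bochner_Integration.integral_nonneg loss_nonneg)
  have "(\<integral>p. exp (- ?S p) * mixed N p \<partial>\<Lambda>) = enn2real (\<integral>\<^sup>+p. ennreal (exp (- ?S p) * mixed N p) \<partial>\<Lambda>)"
    by (rule integral_eq_nn_integral) (auto simp: mixed_nonneg)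
  also have "\<dots> \<le> real (Suc N) * (\<integral>q. loss_R 0 q \<partial>R)"
    using enn2real_mono[OF le] pos by simp
  finally show ?thesis .
qed

text \<open>The total distance in a window is the absolute sum of the discrepancies plus
  \<open>mixed\<close>. The sum is small by the laws of large numbers around the common
  \<open>\<rho>\<close>. For \<open>mixed\<close>, contents up to \<open>K\<close> bring in the mean
  loss with the factor \<open>exp (2 * K)\<close>, and larger contents only tails of the
  marginals.\<close>

lemma dist_bound:
  assumes K: "0 \<le> K"
  shows "(\<integral>p. \<bar>fst p 0 - snd p 0\<bar> \<partial>\<Lambda>) \<le>
    (\<integral>p. \<bar>total N (fst p) / real (Suc N) - \<rho>\<bar> \<partial>\<Lambda>) + (\<integral>p. \<bar>total N (snd p) / real (Suc N) - \<rho>\<bar> \<partial>\<Lambda>)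
    + exp (2 * K) * (\<integral>q. loss_R 0 q \<partial>R)
    + 2 * (\<integral>p. total N (fst p) * indicator {K<..} (total N (fst p)) \<partial>\<Lambda>)
    + 2 * (\<integral>p. total N (snd p) * indicator {K<..} (total N (snd p)) \<partial>\<Lambda>)"
proof -
  let ?A = "\<lambda>p. total N (fst p)" and ?B = "\<lambda>p. total N (snd p)" and ?n = "real (Suc N)"
  let ?e = "\<lambda>p. exp (- (?A p + ?B p)) * mixed N p"
  let ?tail = "\<lambda>x :: real. x * indicator {K<..} x"
  have pos: "AE p in \<Lambda>. 0 \<le> ?A p \<and> 0 \<le> ?B p"
    using regular_\<Lambda> by eventually_elim (auto simp: regular_def intro!: sum_nonneg)
  have iA: "integrable \<Lambda> ?A" and iB: "integrable \<Lambda> ?B"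
    by (intro Bochner_Integration.integrable_sum integrable_component)+
  have tail: "integrable \<Lambda> (\<lambda>p. ?tail (?A p))" "integrable \<Lambda> (\<lambda>p. ?tail (?B p))"
    by (rule Bochner_Integration.integrable_bound[OF iA] Bochner_Integration.integrable_bound[OF
        iB];
        auto split: split_indicator)+
  have ie: "integrable \<Lambda> ?e"
  proof (rule Bochner_Integration.integrable_bound[OF integrable_mixed[of N]])
    show "AE p in \<Lambda>. norm (?e p) \<le> norm (mixed N p)"
      using pos by eventually_elim (auto simp: mixed_nonneg abs_mult mult_left_le_one_le)
  qed measurable
  have iabs: "integrable \<Lambda> (\<lambda>p. \<bar>?A p / ?n - \<rho>\<bar>)" "integrable \<Lambda> (\<lambda>p. \<bar>?B p / ?n - \<rho>\<bar>)"
    using iA iB by auto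
  have pt: "AE p in \<Lambda>. (\<Sum>k=- int N..0. \<bar>fst p k - snd p k\<bar>) \<le>
    ?n * \<bar>?A p / ?n - \<rho>\<bar> + ?n * \<bar>?B p / ?n - \<rho>\<bar> + exp (2 * K) * ?e p + 2 * ?tail (?A p) + 2 * ?tail
        (?B p)"
    using regular_\<Lambda> pos
  proof eventually_elim
    case (elim p)
    have sd: "(\<Sum>k=- int N..0. fst p k - snd p k) = ?A p - ?B p" by (simp add: sum_subtractf)
    have 1: "\<bar>?A p - ?B p\<bar> \<le> ?n * \<bar>?A p / ?n - \<rho>\<bar> + ?n * \<bar>?B p / ?n - \<rho>\<bar>"
    proof -
      have "?n * \<bar>x / ?n - \<rho>\<bar> = \<bar>x - ?n * \<rho>\<bar>" for x
        by (simp add: abs_mult[symmetric, of ?n, simplified] right_diff_distrib flip: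
            abs_of_nonneg[of ?n])
      then show ?thesis by (simp del: of_nat_Suc)
    qed
    have "(\<Sum>k=- int N..0. \<bar>fst p k - snd p k\<bar>) \<le> (\<Sum>k=- int N..0. fst p k + snd p k)"
      using elim by (intro sum_mono) (auto simp: regular_def abs_le_iff)
    then have mx: "mixed N p \<le> ?A p + ?B p - \<bar>?A p - ?B p\<bar>"
      unfolding mixed_def sd by (simp add: sum.distrib)
    have 2: "mixed N p \<le> exp (2 * K) * ?e p + 2 * ?tail (?A p) + 2 * ?tail (?B p)"
    proof (cases "?A p \<le> K \<and> ?B p \<le> K")
      case True
      then have "1 \<le> exp (2 * K) * exp (- (?A p + ?B p))" by (simp flip: exp_add)
      then have "1 * mixed N p \<le> exp (2 * K) * exp (- (?A p + ?B p)) * mixed N p"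
        by (rule mult_right_mono[OF _ mixed_nonneg])
      then show ?thesis using True by (simp add: mult.assoc)
    next
      case False
      have "0 \<le> exp (2 * K) * ?e p" by (simp add: mixed_nonneg)
      \<comment> \<open>\<open>mixed\<close> is at most twice the smaller of the two contents, hence
        at most twice any content that exceeds \<open>K\<close>.\<close>
      moreover have "mixed N p \<le> 2 * ?tail (?A p) + 2 * ?tail (?B p)"
        using False mx elim(2) by (auto simp: not_le split: split_indicator)
      ultimately show ?thesis by linarith
    qed
    have "(\<Sum>k=- int N..0. \<bar>fst p k - snd p k\<bar>) = \<bar>?A p - ?B p\<bar> + mixed N p"
      by (simp add: mixed_def sd)
    then show ?case using 1 2 by linarith
  qed
  have factor: "n * a + n * b + e * (n * l) + n * (2 * c) + n * (2 * d) = n * (a + b + e * l + 2 * c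
      + 2 * d)"
    for n a b c d e l :: real by (simp add: algebra_simps)
  have lin: "(\<integral>p. a * f1 p + a * f2 p + b * f3 p + 2 * f4 p + 2 * f5 p \<partial>\<Lambda>)
      = a * (\<integral>p. f1 p \<partial>\<Lambda>) + a * (\<integral>p. f2 p \<partial>\<Lambda>) + b * (\<integral>p. f3 p \<partial>\<Lambda>) + 2 * (\<integral>p. f4 p \<partial>\<Lambda>) + 2 * (\<integral>p. f5
          p \<partial>\<Lambda>)"
    if "integrable \<Lambda> f1" "integrable \<Lambda> f2" "integrable \<Lambda> f3" "integrable \<Lambda> f4" "integrable \<Lambda> f5"
    for f1 f2 f3 f4 f5 :: "seq \<times> seq \<Rightarrow> real" and a b :: real
    using that by simp
  have "?n * (\<integral>p. \<bar>fst p 0 - snd p 0\<bar> \<partial>\<Lambda>) = (\<integral>p. (\<Sum>k=- int N..0. \<bar>fst p k - snd p k\<bar>) \<partial>\<Lambda>)"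
  proof -
    have "(\<Sum>k=- int N..0. \<integral>p. \<bar>fst p k - snd p k\<bar> \<partial>\<Lambda>) = (\<Sum>k=- int N..0. \<integral>p. \<bar>fst p 0 - snd p 0\<bar> \<partial>\<Lambda>)"
      by (rule sum.cong[OF refl integral_dist])
    then show ?thesis by (subst Bochner_Integration.integral_sum[OF integrable_dist]) simp
  qed
  also have "\<dots> \<le> (\<integral>p. ?n * \<bar>?A p / ?n - \<rho>\<bar> + ?n * \<bar>?B p / ?n - \<rho>\<bar> + exp (2 * K) * ?e p + 2
      * ?tail (?A p) + 2 * ?tail (?B p) \<partial>\<Lambda>)"
    using pt by (intro integral_mono_AE Bochner_Integration.integrable_add integrable_mult_right
        Bochner_Integration.integrable_sum integrable_dist iabs ie tail)
  also have "\<dots> = ?n * (\<integral>p. \<bar>?A p / ?n - \<rho>\<bar> \<partial>\<Lambda>) + ?n * (\<integral>p. \<bar>?B p / ?n - \<rho>\<bar> \<partial>\<Lambda>)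
      + exp (2 * K) * (\<integral>p. ?e p \<partial>\<Lambda>) + 2 * (\<integral>p. ?tail (?A p) \<partial>\<Lambda>) + 2 * (\<integral>p. ?tail (?B p) \<partial>\<Lambda>)"
    by (rule lin[OF iabs ie tail])
  also have "\<dots> \<le> ?n * (\<integral>p. \<bar>?A p / ?n - \<rho>\<bar> \<partial>\<Lambda>) + ?n * (\<integral>p. \<bar>?B p / ?n - \<rho>\<bar> \<partial>\<Lambda>)
      + exp (2 * K) * (?n * (\<integral>q. loss_R 0 q \<partial>R)) + ?n * (2 * (\<integral>p. ?tail (?A p) \<partial>\<Lambda>)) + ?n * (2 * (\<integral>p.
          ?tail (?B p) \<partial>\<Lambda>))"
  proof -
    \<comment> \<open>The tail terms lack the factor \<open>?n\<close>; enlarging them by it allows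
      the whole inequality to be divided by \<open>?n\<close>.\<close>
    have t: "x \<le> ?n * x" if "0 \<le> x" for x :: real
      using that mult_right_mono[of 1 ?n x] by simp
    have "0 \<le> (\<integral>p. ?tail (?A p) \<partial>\<Lambda>)" "0 \<le> (\<integral>p. ?tail (?B p) \<partial>\<Lambda>)"
      using K by (auto intro!: Bochner_Integration.integral_nonneg split: split_indicator)
    then show ?thesis
      by (intro add_mono order_refl t mult_left_mono loss_lower_bound) auto
  qed
  also have "\<dots> = ?n * ((\<integral>p. \<bar>?A p / ?n - \<rho>\<bar> \<partial>\<Lambda>) + (\<integral>p. \<bar>?B p / ?n - \<rho>\<bar> \<partial>\<Lambda>)
      + exp (2 * K) * (\<integral>q. loss_R 0 q \<partial>R) + 2 * (\<integral>p. ?tail (?A p) \<partial>\<Lambda>) + 2 * (\<integral>p. ?tail (?B p) \<partial>\<Lambda>))"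
    by (rule factor)
  finally show ?thesis by (subst (asm) mult_le_cancel_left_pos) auto
qed

end

section \<open>Laws of large numbers in mean\<close>

text \<open>\<open>\<rho>\<close> is introduced as the almost sure limit of the averages. That it is
  the mean follows in \<open>mean_\<nu>\<close>, from convergence of the averages in mean.\<close>

locale stationary_seq = prob_space \<nu> for \<nu> :: "seq measure" +
  fixes \<rho> :: real
  assumes sets_\<nu> [measurable_cong]: "sets \<nu> = sets seq_space"
    and shift_\<nu>: "\<And>F. F \<in> borel_measurable seq_space \<Longrightarrow> (\<integral>\<^sup>+z. F (shift z) \<partial>\<nu>) = (\<integral>\<^sup>+z. F z \<partial>\<nu>)"
    and nonneg_\<nu>: "AE z in \<nu>. \<forall>k. 0 \<le> z k"
    and cesaro_\<nu>: "AE z in \<nu>. cesaro z \<rho>"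
    and int_\<nu>: "integrable \<nu> (\<lambda>z. z 0)"
begin

abbreviation total :: "nat \<Rightarrow> seq \<Rightarrow> real" where
  "total N z \<equiv> (\<Sum>k=- int N..0. z k)"

lemma stationary_\<nu>:
  fixes f :: "real \<Rightarrow> real"
  assumes [measurable]: "f \<in> borel_measurable borel" and pos: "\<And>x. 0 \<le> f x" and int:
      "integrable \<nu> (\<lambda>z. f (z 0))"
  shows "integrable \<nu> (\<lambda>z. f (z k))" "(\<integral>z. f (z k) \<partial>\<nu>) = (\<integral>z. f (z 0) \<partial>\<nu>)"
proof -
  have eq: "(\<integral>\<^sup>+z. ennreal (f (z k)) \<partial>\<nu>) = (\<integral>\<^sup>+z. ennreal (f (z 0)) \<partial>\<nu>)"
  proof (rule int_shift_invariant[where f = "\<lambda>k. \<integral>\<^sup>+z. ennreal (f (z k)) \<partial>\<nu>"])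
    fix k
    show "(\<integral>\<^sup>+z. ennreal (f (z (k + 1))) \<partial>\<nu>) = (\<integral>\<^sup>+z. ennreal (f (z k)) \<partial>\<nu>)"
      using shift_\<nu>[of "\<lambda>z. ennreal (f (z k))"] by (simp add: shift_def)
  qed
  show "integrable \<nu> (\<lambda>z. f (z k))"
    using int pos eq by (subst integrable_iff_bounded) (simp add: integrable_iff_bounded)
  show "(\<integral>z. f (z k) \<partial>\<nu>) = (\<integral>z. f (z 0) \<partial>\<nu>)"
    using eq pos by (simp add: integral_eq_nn_integral)
qed

lemma integrable_\<nu>: "integrable \<nu> (\<lambda>z. z k)"
proof -
  have "integrable \<nu> (\<lambda>z. \<bar>z k\<bar>)" using stationary_\<nu>(1)[of abs k] int_\<nu> by simp
  then show ?thesis by (simp add: integrable_abs_iff)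
qed

lemma integral_\<nu>: "(\<integral>z. z k \<partial>\<nu>) = (\<integral>z. z 0 \<partial>\<nu>)"
proof -
  have "(\<integral>z. z j \<partial>\<nu>) = (\<integral>z. \<bar>z j\<bar> \<partial>\<nu>)" for j
    by (rule integral_cong_AE, measurable, use nonneg_\<nu> in eventually_elim) simp
  then show ?thesis using stationary_\<nu>(2)[of abs k] int_\<nu> by simp
qed

lemma integrable_total: "integrable \<nu> (total N)"
  by (intro Bochner_Integration.integrable_sum integrable_\<nu>)

lemma integral_total: "(\<integral>z. total N z \<partial>\<nu>) = real (Suc N) * (\<integral>z. z 0 \<partial>\<nu>)"
proof -
  have "(\<Sum>k=- int N..0. \<integral>z. z k \<partial>\<nu>) = (\<Sum>k=- int N..0. \<integral>z. z 0 \<partial>\<nu>)"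
    by (rule sum.cong[OF refl integral_\<nu>])
  then show ?thesis by (subst Bochner_Integration.integral_sum[OF integrable_\<nu>]) simp
qed

lemma excess_tendsto: "(\<lambda>m. \<integral>z. max 0 (z 0 - real m) \<partial>\<nu>) \<longlonglongrightarrow> 0"
proof -
  have "(\<lambda>m. \<integral>z. max 0 (z 0 - real m) \<partial>\<nu>) \<longlonglongrightarrow> (\<integral>z. 0 \<partial>\<nu>)"
  proof (rule integral_dominated_convergence[where w = "\<lambda>z. \<bar>z 0\<bar>"])
    show "AE z in \<nu>. (\<lambda>m. max 0 (z 0 - real m)) \<longlonglongrightarrow> 0"
    proof (intro AE_I2 tendsto_eventually)
      fix z :: seq
      obtain m where "z 0 \<le> real m" using real_arch_simple by blast
      then have "max 0 (z 0 - real k) = 0" if "m \<le> k" for k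
        using that by simp
      then show "\<forall>\<^sub>F m in sequentially. max 0 (z 0 - real m) = 0"
        unfolding eventually_sequentially by blast
    qed
  qed (use int_\<nu> in auto)
  then show ?thesis by simp
qed

text \<open>Truncation at \<open>m\<close> costs at most the mean of the excess over \<open>m\<close>, by convexity.\<close>

lemma cesaro_L1: "(\<lambda>N. \<integral>z. \<bar>total N z / real (Suc N) - \<rho>\<bar> \<partial>\<nu>) \<longlonglongrightarrow> 0"
proof (rule order_tendstoI)
  fix \<epsilon> :: real assume \<epsilon>: "0 < \<epsilon>"
  have "\<forall>\<^sub>F m in sequentially. (\<integral>z. max 0 (z 0 - real m) \<partial>\<nu>) < \<epsilon> / 2"
    using excess_tendsto \<epsilon> by (intro order_tendstoD(2)[where a = "\<epsilon> / 2"]) auto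
  \<comment> \<open>\<open>\<rho> \<le> real m\<close> ensures that truncating the averages at
    \<open>m\<close> leaves their limit unchanged.\<close>
  moreover have "\<forall>\<^sub>F m in sequentially. \<rho> \<le> real m"
    using eventually_ge_at_top[of "nat \<lceil>\<rho>\<rceil>"] by eventually_elim linarith
  ultimately have "\<forall>\<^sub>F m in sequentially. (\<integral>z. max 0 (z 0 - real m) \<partial>\<nu>) < \<epsilon> / 2 \<and> \<rho> \<le> real m"
    by (rule eventually_conj)
  then obtain m where m: "(\<integral>z. max 0 (z 0 - real m) \<partial>\<nu>) < \<epsilon> / 2" "\<rho> \<le> real m"
    using eventually_happens'[OF sequentially_bot] by blast
  let ?a = "\<lambda>N z. total N z / real (Suc N)"
  let ?ex = "\<lambda>k z :: seq. max 0 (z k - real m)"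
  have iex: "integrable \<nu> (?ex k)" "(\<integral>z. ?ex k z \<partial>\<nu>) = (\<integral>z. ?ex 0 z \<partial>\<nu>)" for k
    using stationary_\<nu>[of "\<lambda>x. max 0 (x - real m)" k] int_\<nu> by simp_all
  have "(\<lambda>N. \<integral>z. \<bar>min (?a N z) (real m) - \<rho>\<bar> \<partial>\<nu>) \<longlonglongrightarrow> (\<integral>z. 0 \<partial>\<nu>)"
  proof (rule integral_dominated_convergence[where w = "\<lambda>z. real m + \<bar>\<rho>\<bar>"])
    show "AE z in \<nu>. (\<lambda>N. \<bar>min (?a N z) (real m) - \<rho>\<bar>) \<longlonglongrightarrow> 0"
      using cesaro_\<nu>
    proof eventually_elim
      case (elim z)
      have "(\<lambda>N. \<bar>min (?a N z) (real m) - \<rho>\<bar>) \<longlonglongrightarrow> \<bar>min \<rho> (real m) - \<rho>\<bar>"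
        by (intro tendsto_intros elim[unfolded cesaro_def])
      then show ?case using m(2) by simp
    qed
    show "AE z in \<nu>. norm \<bar>min (?a N z) (real m) - \<rho>\<bar> \<le> real m + \<bar>\<rho>\<bar>" for N
      using nonneg_\<nu>
    proof eventually_elim
      case (elim z)
      then have "0 \<le> ?a N z" by (intro divide_nonneg_nonneg sum_nonneg) auto
      then show ?case by (auto simp: min_def)
    qed
  qed auto
  then have "\<forall>\<^sub>F N in sequentially. (\<integral>z. \<bar>min (?a N z) (real m) - \<rho>\<bar> \<partial>\<nu>) < \<epsilon> / 2"
    using \<epsilon> by (intro order_tendstoD(2)[where a = "\<epsilon> / 2"]) auto
  then show "\<forall>\<^sub>F N in sequentially. (\<integral>z. \<bar>?a N z - \<rho>\<bar> \<partial>\<nu>) < \<epsilon>"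
  proof eventually_elim
    case (elim N)
    let ?n = "real (Suc N)"
    have pt: "\<bar>?a N z - \<rho>\<bar> \<le> \<bar>min (?a N z) (real m) - \<rho>\<bar> + (\<Sum>k=- int N..0. ?ex k z) / ?n" for z
    proof -
      have "total N z - ?n * real m = (\<Sum>k=- int N..0. z k - real m)" by (simp add: sum_subtractf)
      also have "\<dots> \<le> (\<Sum>k=- int N..0. ?ex k z)" by (intro sum_mono) auto
      finally have "(total N z - ?n * real m) / ?n \<le> (\<Sum>k=- int N..0. ?ex k z) / ?n"
        by (intro divide_right_mono) auto
      then have 1: "?a N z - real m \<le> (\<Sum>k=- int N..0. ?ex k z) / ?n"
        by (simp add: diff_divide_distrib del: of_nat_Suc)
      have 2: "0 \<le> (\<Sum>k=- int N..0. ?ex k z) / ?n" by (intro divide_nonneg_nonneg sum_nonneg) auto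
      have "\<bar>x - \<rho>\<bar> \<le> \<bar>min x M - \<rho>\<bar> + e" if "x - M \<le> e" "0 \<le> e" for x M e :: real
        using that by (auto simp: min_def)
      from this[OF 1 2] show ?thesis .
    qed
    have i1: "integrable \<nu> (\<lambda>z. \<bar>?a N z - \<rho>\<bar>)" using integrable_total by auto
    have i2: "integrable \<nu> (\<lambda>z. \<bar>min (?a N z) (real m) - \<rho>\<bar>)" using integrable_total by auto
    have i3: "integrable \<nu> (\<lambda>z. (\<Sum>k=- int N..0. ?ex k z) / ?n)"
      by (intro integrable_divide Bochner_Integration.integrable_sum iex(1))
    have "(\<integral>z. \<bar>?a N z - \<rho>\<bar> \<partial>\<nu>) \<le> (\<integral>z. \<bar>min (?a N z) (real m) - \<rho>\<bar>
        + (\<Sum>k=- int N..0. ?ex k z) / ?n \<partial>\<nu>)"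
      by (intro integral_mono pt i1 Bochner_Integration.integrable_add i2 i3)
    also have "\<dots> = (\<integral>z. \<bar>min (?a N z) (real m) - \<rho>\<bar> \<partial>\<nu>) + (\<integral>z. (\<Sum>k=- int N..0. ?ex k z) / ?n \<partial>\<nu>)"
      by (rule Bochner_Integration.integral_add[OF i2 i3])
    also have "(\<integral>z. (\<Sum>k=- int N..0. ?ex k z) / ?n \<partial>\<nu>) = (\<integral>z. ?ex 0 z \<partial>\<nu>)"
    proof -
      have "(\<Sum>k=- int N..0. \<integral>z. ?ex k z \<partial>\<nu>) = (\<Sum>k=- int N..0. \<integral>z. ?ex 0 z \<partial>\<nu>)"
        by (rule sum.cong[OF refl iex(2)])
      also have "\<dots> = ?n * (\<integral>z. ?ex 0 z \<partial>\<nu>)" by simp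
      finally have s: "(\<integral>z. (\<Sum>k=- int N..0. ?ex k z) \<partial>\<nu>) = ?n * (\<integral>z. ?ex 0 z \<partial>\<nu>)"
        by (subst Bochner_Integration.integral_sum[OF iex(1)])
      have "(\<integral>z. (\<Sum>k=- int N..0. ?ex k z) / ?n \<partial>\<nu>) = (\<integral>z. (\<Sum>k=- int N..0. ?ex k z) \<partial>\<nu>) / ?n"
        by (rule integral_divide_zero)
      then show ?thesis unfolding s by (simp del: of_nat_Suc)
    qed
    finally show ?case using elim m(1) by linarith
  qed
next
  fix a :: real assume "a < 0"
  moreover have "0 \<le> (\<integral>z. \<bar>total N z / real (Suc N) - \<rho>\<bar> \<partial>\<nu>)" for N
    by (rule Bochner_Integration.integral_nonneg) simp
  ultimately have "a < (\<integral>z. \<bar>total N z / real (Suc N) - \<rho>\<bar> \<partial>\<nu>)" for N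
    by (rule less_le_trans)
  then show "\<forall>\<^sub>F N in sequentially. a < (\<integral>z. \<bar>total N z / real (Suc N) - \<rho>\<bar> \<partial>\<nu>)"
    by (intro always_eventually allI)
qed

lemma mean_\<nu>: "(\<integral>z. z 0 \<partial>\<nu>) = \<rho>"
proof -
  have "\<bar>(\<integral>z. z 0 \<partial>\<nu>) - \<rho>\<bar> \<le> (\<integral>z. \<bar>total N z / real (Suc N) - \<rho>\<bar> \<partial>\<nu>)" for N
  proof -
    have i: "integrable \<nu> (\<lambda>z. total N z / real (Suc N))"
      by (intro integrable_divide integrable_total)
    have "(\<integral>z. total N z / real (Suc N) - \<rho> \<partial>\<nu>) = (\<integral>z. total N z / real (Suc N) \<partial>\<nu>) - (\<integral>z. \<rho> \<partial>\<nu>)"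
      by (rule Bochner_Integration.integral_diff[OF i]) simp
    also have "(\<integral>z. total N z / real (Suc N) \<partial>\<nu>) = (\<integral>z. total N z \<partial>\<nu>) / real (Suc N)"
      by (rule integral_divide_zero)
    also have "\<dots> = (\<integral>z. z 0 \<partial>\<nu>)" unfolding integral_total by (simp del: of_nat_Suc)
    finally have "(\<integral>z. z 0 \<partial>\<nu>) - \<rho> = (\<integral>z. total N z / real (Suc N) - \<rho> \<partial>\<nu>)"
      by (simp add: prob_space)
    then show ?thesis using integral_abs_bound[of \<nu> "\<lambda>z. total N z / real (Suc N) - \<rho>"] by simp
  qed
  then have "\<bar>(\<integral>z. z 0 \<partial>\<nu>) - \<rho>\<bar> \<le> 0"
    by (intro LIMSEQ_le_const[OF cesaro_L1]) auto
  then show ?thesis by simp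
qed

lemma tail_tendsto: "(\<lambda>m. \<integral>z. total N z * indicator {real m<..} (total N z) \<partial>\<nu>) \<longlonglongrightarrow> 0"
proof -
  have "(\<lambda>m. \<integral>z. total N z * indicator {real m<..} (total N z) \<partial>\<nu>) \<longlonglongrightarrow> (\<integral>z. 0 \<partial>\<nu>)"
  proof (rule integral_dominated_convergence[where w = "\<lambda>z. \<bar>total N z\<bar>"])
    show "AE z in \<nu>. (\<lambda>m. total N z * indicator {real m<..} (total N z)) \<longlonglongrightarrow> 0"
    proof (intro AE_I2 tendsto_eventually)
      fix z :: seq
      obtain m where "total N z \<le> real m" using real_arch_simple by blast
      then have "total N z * indicator {real k<..} (total N z) = 0" if "m \<le> k" for k
        using that by simp
      then show "\<forall>\<^sub>F m in sequentially. total N z * indicator {real m<..} (total N z) = 0"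
        unfolding eventually_sequentially by blast
    qed
    show "integrable \<nu> (\<lambda>z. \<bar>total N z\<bar>)" using integrable_total by simp
  qed (auto split: split_indicator)
  then show ?thesis by simp
qed

end

section \<open>Ergodicity makes the averages constant\<close>

lemma cesaro_translate: "cesaro (\<lambda>k. z (k + l)) L \<longleftrightarrow> cesaro z L"
proof -
  have "cesaro (\<lambda>k. z (k + l)) L = cesaro (\<lambda>k. z (k + 0)) L"
  proof (rule int_shift_invariant[where f = "\<lambda>l. cesaro (\<lambda>k. z (k + l)) L"])
    fix l
    have "(\<lambda>k. z (k + (l + 1))) = shift (\<lambda>k. z (k + l))" by (simp add: shift_def add_ac)
    then show "cesaro (\<lambda>k. z (k + (l + 1))) L = cesaro (\<lambda>k. z (k + l)) L"
      by (simp only: cesaro_shift)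
  qed
  then show ?thesis by simp
qed

text \<open>The averages converge on the state space. That their limit is at most \<open>a\<close>
  is a translation-invariant event, of probability 0 or 1; the constant is the infimum of the levels
  \<open>a\<close> with probability 1.\<close>

lemma ergodic_cesaro_const:
  assumes \<mu>: "prob_on_states n \<mu>" and erg: "translation_ergodic n \<mu>" and i: "i \<in> {1..n}"
  shows "\<exists>c. AE \<eta> in \<mu>. cesaro (\<eta> i) c"
proof -
  interpret prob_space \<mu> using \<mu> by (simp add: prob_on_states_def)
  have sets: "sets \<mu> = sets (config_space n)" and st: "AE \<eta> in \<mu>. \<eta> \<in> state_space n"
    using \<mu> by (auto simp: prob_on_states_def)
  have space: "space \<mu> = space (config_space n)" by (rule sets_eq_imp_space_eq[OF sets])
  have L: "AE \<eta> in \<mu>. \<exists>L>1. cesaro (\<eta> i) L"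
    using st by eventually_elim (use i in \<open>auto simp: state_space_iff\<close>)
  define B where "B a = {\<eta> \<in> space (config_space n). \<exists>L\<le>a. cesaro (\<eta> i) L}" for a :: real
  have B_sets: "B a \<in> sets (config_space n)" for a
  proof -
    have "Measurable.pred (config_space n) (\<lambda>\<eta>. \<exists>L\<le>a. cesaro (\<eta> i) L)"
      by (intro measurable_cesaro_ex measurable_config_component[where f =
          "\<lambda>\<eta>. \<eta>", OF _ i]) simp_all
    then show ?thesis by (simp add: B_def pred_def)
  qed
  have B_inv: "translate n l -` B a \<inter> space (config_space n) = B a" for a l
    using i cesaro_translate[of "_ i" l] by (auto simp: B_def translate_def space_config)
  have B01: "prob (B a) = 0 \<or> prob (B a) = 1" for a
    by (rule erg[unfolded translation_ergodic_def, THEN conjunct2, THEN bspec, OF B_sets, THEN mp])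
      (intro allI B_inv)
  have B1: "AE \<eta> in \<mu>. \<exists>L\<le>a. cesaro (\<eta> i) L" if "prob (B a) = 1" for a
  proof -
    have "AE \<eta> in \<mu>. \<eta> \<in> B a" using that B_sets sets by (subst (asm) prob_eq_1) auto
    then show ?thesis by eventually_elim (simp add: B_def)
  qed
  have B0: "AE \<eta> in \<mu>. \<not> (\<exists>L\<le>a. cesaro (\<eta> i) L)" if "prob (B a) \<noteq> 1" for a
  proof -
    have "prob (B a) = 0" using B01 that by blast
    then have "AE \<eta> in \<mu>. \<eta> \<notin> B a" using B_sets sets by (subst (asm) prob_eq_0) auto
    then show ?thesis using AE_space by eventually_elim (auto simp: B_def space)
  qed
  define S where "S = {a. prob (B a) = 1}"
  have S_ne: "S \<noteq> {}"
  proof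
    assume "S = {}"
    then have "AE \<eta> in \<mu>. \<forall>m::nat. \<not> (\<exists>L\<le>real m. cesaro (\<eta> i) L)"
      unfolding AE_all_countable using B0 by (auto simp: S_def)
    then have "AE \<eta> in \<mu>. False"
      using L
    proof eventually_elim
      case (elim \<eta>)
      then obtain L where "cesaro (\<eta> i) L" by blast
      moreover obtain m :: nat where "L \<le> real m" using real_arch_simple by blast
      ultimately show ?case using elim by blast
    qed
    then show False by simp
  qed
  have S_bdd: "bdd_below S"
  proof (rule bdd_belowI)
    fix a assume "a \<in> S"
    then have "prob (B a) = 1" by (simp add: S_def)
    from B1[OF this] L have "AE \<eta> in \<mu>. 1 \<le> a"
    proof eventually_elim
      case (elim \<eta>)
      then obtain L L' where "L \<le> a" "cesaro (\<eta> i) L" "1 < L'" "cesaro (\<eta> i) L'" by blast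
      then show ?case using cesaro_unique[of "\<eta> i" L L'] by simp
    qed
    then show "1 \<le> a" by simp
  qed
  define c where "c = Inf S"
  have up: "AE \<eta> in \<mu>. \<exists>L\<le>a. cesaro (\<eta> i) L" if ca: "c < a" for a
  proof -
    obtain b where b: "b \<in> S" "b < a" using ca cInf_less_iff[OF S_ne S_bdd, of a] unfolding c_def
      by blast
    then have "AE \<eta> in \<mu>. \<exists>L\<le>b. cesaro (\<eta> i) L" using B1 by (simp add: S_def)
    then show ?thesis
    proof eventually_elim
      case (elim \<eta>)
      then obtain L where "L \<le> b" "cesaro (\<eta> i) L" by blast
      with b(2) show ?case by (intro exI[of _ L]) simp
    qed
  qed
  have low: "AE \<eta> in \<mu>. \<not> (\<exists>L\<le>a. cesaro (\<eta> i) L)" if "a < c" for a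
  proof -
    have "a \<notin> S" using that cInf_lower[OF _ S_bdd, of a] unfolding c_def by auto
    then show ?thesis by (intro B0) (simp add: S_def)
  qed
  \<comment> \<open>Countably many levels on either side of \<open>c\<close> pin the limit
    down.\<close>
  have "AE \<eta> in \<mu>. \<forall>m::nat. (\<exists>L\<le>c + 1 / real (Suc m). cesaro (\<eta> i) L)
      \<and> \<not> (\<exists>L\<le>c - 1 / real (Suc m). cesaro (\<eta> i) L)"
    unfolding AE_all_countable by (intro allI AE_conjI up low) auto
  then have "AE \<eta> in \<mu>. cesaro (\<eta> i) c"
  proof eventually_elim
    case (elim \<eta>)
    then obtain L where L: "cesaro (\<eta> i) L" by blast
    have le: "L \<le> c + 1 / real (Suc m)" for m using elim L cesaro_unique by blast
    have ge: "c - 1 / real (Suc m) \<le> L" for m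
    proof (rule ccontr)
      assume "\<not> c - 1 / real (Suc m) \<le> L"
      then have "L \<le> c - 1 / real (Suc m)" by simp
      with elim L show False by blast
    qed
    have "(\<lambda>m. 1 / real (Suc m)) \<longlonglongrightarrow> 0" by (rule lim_1_over_n[THEN LIMSEQ_Suc])
    then have t: "(\<lambda>m. c + 1 / real (Suc m)) \<longlonglongrightarrow> c + 0" "(\<lambda>m. c - 1 / real (Suc m)) \<longlonglongrightarrow> c - 0"
      by (intro tendsto_intros; assumption)+
    have "L \<le> c" using LIMSEQ_le_const[OF t(1)] le by auto
    moreover have "c \<le> L" using LIMSEQ_le_const2[OF t(2)] ge by auto
    ultimately show ?case using L by simp
  qed
  then show ?thesis by blast
qed

lemma stationary_seq_component:
  assumes \<mu>: "prob_on_states n \<mu>" and tr: "distr \<mu> (config_space n) (translate n 1) = \<mu>" and i: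
      "i \<in> {1..n}"
    and int: "integrable \<mu> (\<lambda>\<eta>. \<eta> i 0)" and ces: "AE \<eta> in \<mu>. cesaro (\<eta> i) c"
  shows "stationary_seq (distr \<mu> seq_space (\<lambda>\<eta>. \<eta> i)) c"
proof -
  interpret prob_space \<mu> using \<mu> by (simp add: prob_on_states_def)
  have sets: "sets \<mu> = sets (config_space n)" and st: "AE \<eta> in \<mu>. \<eta> \<in> state_space n"
    using \<mu> by (auto simp: prob_on_states_def)
  have m: "(\<lambda>\<eta>. \<eta> i) \<in> \<mu> \<rightarrow>\<^sub>M seq_space"
    using measurable_config_component[OF measurable_ident i]
      by (simp add: measurable_cong_sets[OF sets refl])
  have mt: "translate n 1 \<in> \<mu> \<rightarrow>\<^sub>M config_space n"
    using measurable_translate[OF measurable_ident]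
      by (simp add: measurable_cong_sets[OF sets refl])
  interpret D: prob_space "distr \<mu> seq_space (\<lambda>\<eta>. \<eta> i)" by (rule prob_space_distr[OF m])
  show ?thesis
  proof
    show "sets (distr \<mu> seq_space (\<lambda>\<eta>. \<eta> i)) = sets seq_space" by simp
    fix F :: "seq \<Rightarrow> ennreal" assume F [measurable]: "F \<in> borel_measurable seq_space"
    have Fi: "(\<lambda>\<eta>. F (\<eta> i)) \<in> borel_measurable (config_space n)"
      using measurable_compose[OF measurable_config_component[OF measurable_ident i] F] by simp
    have "(\<integral>\<^sup>+z. F (shift z) \<partial>distr \<mu> seq_space (\<lambda>\<eta>. \<eta> i)) = (\<integral>\<^sup>+\<eta>. F (shift (\<eta> i)) \<partial>\<mu>)"
      by (rule nn_integral_distr[OF m]) simp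
    also have "\<dots> = (\<integral>\<^sup>+\<eta>. F (translate n 1 \<eta> i) \<partial>\<mu>)" using i by (simp add: translate_1)
    also have "\<dots> = (\<integral>\<^sup>+\<eta>. F (\<eta> i) \<partial>distr \<mu> (config_space n) (translate n 1))"
      using Fi by (intro nn_integral_distr[OF mt, symmetric]) simp
    also have "\<dots> = (\<integral>\<^sup>+z. F z \<partial>distr \<mu> seq_space (\<lambda>\<eta>. \<eta> i))"
      unfolding tr by (rule nn_integral_distr[OF m, symmetric]) simp
    finally show "(\<integral>\<^sup>+z. F (shift z) \<partial>distr \<mu> seq_space (\<lambda>\<eta>. \<eta> i))
        = (\<integral>\<^sup>+z. F z \<partial>distr \<mu> seq_space (\<lambda>\<eta>. \<eta> i))" .
  next
    have "AE \<eta> in \<mu>. \<forall>k. 0 \<le> \<eta> i k" using st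
      by eventually_elim (use i in \<open>auto simp: state_space_iff\<close>)
    then show "AE z in distr \<mu> seq_space (\<lambda>\<eta>. \<eta> i). \<forall>k. 0 \<le> z k"
      by (subst AE_distr_iff[OF m]) measurable
    show "AE z in distr \<mu> seq_space (\<lambda>\<eta>. \<eta> i). cesaro z c"
      using ces by (subst AE_distr_iff[OF m]) measurable
    show "integrable (distr \<mu> seq_space (\<lambda>\<eta>. \<eta> i)) (\<lambda>z. z 0)"
      using int by (subst integrable_distr_eq[OF m]) auto
  qed
qed

lemma ergodic_cesaro:
  assumes \<mu>: "prob_on_states n \<mu>" and erg: "translation_ergodic n \<mu>" and i: "i \<in> {1..n}"
    and int: "integrable \<mu> (\<lambda>\<eta>. \<eta> i 0)"
  shows "AE \<eta> in \<mu>. cesaro (\<eta> i) (\<integral>\<eta>. \<eta> i 0 \<partial>\<mu>)"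
proof -
  obtain c where c: "AE \<eta> in \<mu>. cesaro (\<eta> i) c" using ergodic_cesaro_const[OF \<mu> erg i] by blast
  have tr: "distr \<mu> (config_space n) (translate n 1) = \<mu>" using erg
    by (auto simp: translation_ergodic_def)
  interpret stationary_seq "distr \<mu> seq_space (\<lambda>\<eta>. \<eta> i)" c
    by (rule stationary_seq_component[OF \<mu> tr i int c])
  have sets: "sets \<mu> = sets (config_space n)" using \<mu> by (auto simp: prob_on_states_def)
  have m: "(\<lambda>\<eta>. \<eta> i) \<in> \<mu> \<rightarrow>\<^sub>M seq_space"
    using measurable_config_component[OF measurable_ident i]
      by (simp add: measurable_cong_sets[OF sets refl])
  have "c = (\<integral>\<eta>. \<eta> i 0 \<partial>\<mu>)" using mean_\<nu> by (subst (asm) integral_distr[OF m]) auto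
  with c show ?thesis by simp
qed

section \<open>Couplings of invariant measures\<close>

text \<open>The 0-1 law is replaced by a consequence of it, averages with the constant limits
  \<open>\<rho> i\<close>. This is the common ground of the ergodic candidate, by
  \<open>ergodic_cesaro\<close>, and of the multiclass measure, by the law of large numbers for its
  exponential components.\<close>

definition stationary :: "nat \<Rightarrow> (nat \<Rightarrow> real) \<Rightarrow> config measure \<Rightarrow> bool" where
  "stationary n \<rho> \<mu> \<longleftrightarrow> prob_on_states n \<mu> \<and> distr \<mu> (config_space n) (translate n 1) = \<mu> \<and>
    distr (\<mu> \<Otimes>\<^sub>M exp_seq 1) (config_space n) (\<lambda>p. step n (fst p) (snd p)) = \<mu> \<and>
    (\<forall>i\<in>{1..n}. integrable \<mu> (\<lambda>\<eta>. \<eta> i 0) \<and> (AE \<eta> in \<mu>. cesaro (\<eta> i) (\<rho> i)))"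

abbreviation config2_space :: "nat \<Rightarrow> (config \<times> config) measure" where
  "config2_space n \<equiv> config_space n \<Otimes>\<^sub>M config_space n"

definition translate2 :: "nat \<Rightarrow> config \<times> config \<Rightarrow> config \<times> config" where
  "translate2 n p = (translate n 1 (fst p), translate n 1 (snd p))"

definition step2 :: "nat \<Rightarrow> config \<times> config \<Rightarrow> seq \<Rightarrow> config \<times> config" where
  "step2 n p w = (step n (fst p) w, step n (snd p) w)"

definition coupling :: "nat \<Rightarrow> config measure \<Rightarrow> config measure \<Rightarrow> (config \<times> config) measure \<Rightarrow> bool"
    where
  "coupling n \<mu> \<mu>' \<Lambda> \<longleftrightarrow> prob_space \<Lambda> \<and> sets \<Lambda> = sets (config2_space n) \<and>
    distr \<Lambda> (config_space n) fst = \<mu> \<and> distr \<Lambda> (config_space n) snd = \<mu>' \<and>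
    distr \<Lambda> (config2_space n) (translate2 n) = \<Lambda>"

definition cost :: "nat \<Rightarrow> (config \<times> config) measure \<Rightarrow> real" where
  "cost n \<Lambda> = (\<Sum>i\<in>{1..n}. \<integral>p. \<bar>fst p i 0 - snd p i 0\<bar> \<partial>\<Lambda>)"

definition couple_step :: "nat \<Rightarrow> (config \<times> config) measure \<Rightarrow> (config \<times> config) measure" where
  "couple_step n \<Lambda> = distr (\<Lambda> \<Otimes>\<^sub>M exp_seq 1) (config2_space n) (\<lambda>q. step2 n (fst q) (snd q))"

lemma measurable_translate2: "translate2 n \<in> config2_space n \<rightarrow>\<^sub>M config2_space n"
  unfolding translate2_def[abs_def]
  by (rule measurable_Pair[OF measurable_translate[OF measurable_fst] measurable_translate[OF
      measurable_snd]])

lemma measurable_step2: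
  assumes "f \<in> M \<rightarrow>\<^sub>M config2_space n" "g \<in> M \<rightarrow>\<^sub>M seq_space"
  shows "(\<lambda>x. step2 n (f x) (g x)) \<in> M \<rightarrow>\<^sub>M config2_space n"
  unfolding step2_def
  by (rule measurable_Pair[OF measurable_step[OF measurable_compose[OF assms(1) measurable_fst]
      assms(2)]
        measurable_step[OF measurable_compose[OF assms(1) measurable_snd] assms(2)]])

lemma measurable_component2:
  assumes "f \<in> M \<rightarrow>\<^sub>M config2_space n" "i \<in> {1..n}"
  shows "(\<lambda>x. fst (f x) i) \<in> M \<rightarrow>\<^sub>M seq_space" "(\<lambda>x. snd (f x) i) \<in> M \<rightarrow>\<^sub>M seq_space"
  using measurable_config_component[OF measurable_compose[OF assms(1) measurable_fst] assms(2)]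
    measurable_config_component[OF measurable_compose[OF assms(1) measurable_snd] assms(2)] by auto

text \<open>This provides a coupling to begin with, so that the infimum of the costs is taken over a
  nonempty set.\<close>

lemma coupling_product:
  assumes "stationary n \<rho> \<mu>" "stationary n \<rho> \<mu>'"
  shows "coupling n \<mu> \<mu>' (\<mu> \<Otimes>\<^sub>M \<mu>')"
proof -
  have p: "prob_space \<mu>" "prob_space \<mu>'" and s: "sets \<mu> = sets (config_space n)"
      "sets \<mu>' = sets (config_space n)"
    and t: "distr \<mu> (config_space n) (translate n 1) = \<mu>"
        "distr \<mu>' (config_space n) (translate n 1) = \<mu>'"
    using assms by (auto simp: stationary_def prob_on_states_def)
  interpret M: prob_space \<mu> by fact
  interpret M': prob_space \<mu>' by fact
  interpret P: pair_prob_space \<mu> \<mu>' ..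
  have s2: "sets (\<mu> \<Otimes>\<^sub>M \<mu>') = sets (config2_space n)" by (rule sets_pair_measure_cong[OF s])
  have tm: "translate n 1 \<in> config_space n \<rightarrow>\<^sub>M config_space n"
    using measurable_translate[OF measurable_ident] by simp
  have "\<mu> \<Otimes>\<^sub>M \<mu>' = distr \<mu> (config_space n) (translate n 1) \<Otimes>\<^sub>M distr \<mu>' (config_space n) (translate
      n 1)"
    by (simp add: t)
  also have "\<dots> = distr (\<mu> \<Otimes>\<^sub>M \<mu>') (config2_space n) (\<lambda>(x, y). (translate n 1 x, translate n 1 y))"
    using tm s M'.sigma_finite_measure_axioms
    by (intro pair_measure_distr) (auto simp: t(2) measurable_cong_sets[OF s(1) refl]
        measurable_cong_sets[OF s(2) refl])
  finally have "distr (\<mu> \<Otimes>\<^sub>M \<mu>') (config2_space n) (translate2 n) = \<mu> \<Otimes>\<^sub>M \<mu>'"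
    by (simp add: translate2_def[abs_def] split_beta')
  moreover have "distr (\<mu> \<Otimes>\<^sub>M \<mu>') (config_space n) fst = \<mu>"
    using M'.distr_pair_fst[of \<mu>] distr_cong[OF refl s(1), of "\<mu> \<Otimes>\<^sub>M \<mu>'" fst fst] by simp
  moreover have "distr (\<mu> \<Otimes>\<^sub>M \<mu>') (config_space n) snd = \<mu>'"
  proof (rule measure_eqI_nn_integral)
    fix F :: "config \<Rightarrow> ennreal" assume "F \<in> borel_measurable (distr (\<mu> \<Otimes>\<^sub>M \<mu>') (config_space n)
        snd)"
    then have F: "F \<in> borel_measurable (config_space n)" by simp
    then have F': "F \<in> borel_measurable \<mu>'" by (simp add: measurable_cong_sets[OF s(2) refl])
    have "(\<integral>\<^sup>+x. F x \<partial>distr (\<mu> \<Otimes>\<^sub>M \<mu>') (config_space n) snd) = (\<integral>\<^sup>+p. F (snd p) \<partial>(\<mu> \<Otimes>\<^sub>M \<mu>'))"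
      using F by (intro nn_integral_distr) (auto simp: measurable_cong_sets[OF s2 refl])
    also have "\<dots> = (\<integral>\<^sup>+x. \<integral>\<^sup>+y. F y \<partial>\<mu>' \<partial>\<mu>)"
      using F' by (subst M'.nn_integral_fst[symmetric]) auto
    finally show "(\<integral>\<^sup>+x. F x \<partial>distr (\<mu> \<Otimes>\<^sub>M \<mu>') (config_space n) snd) = (\<integral>\<^sup>+x. F x \<partial>\<mu>')"
      by (simp add: M.emeasure_space_1)
  qed (simp add: s)
  ultimately show ?thesis
    unfolding coupling_def using s2 P.prob_space_axioms by blast
qed

lemma nn_integral_step_marginal:
  assumes \<mu>: "prob_on_states n \<mu>" and inv:
      "distr (\<mu> \<Otimes>\<^sub>M exp_seq 1) (config_space n) (\<lambda>p. step n (fst p) (snd p)) = \<mu>"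
    and F: "F \<in> borel_measurable (config_space n)"
  shows "(\<integral>\<^sup>+\<eta>. \<integral>\<^sup>+w. F (step n \<eta> w) \<partial>exp_seq 1 \<partial>\<mu>) = (\<integral>\<^sup>+\<eta>. F \<eta> \<partial>\<mu>)"
    "(\<lambda>\<eta>. \<integral>\<^sup>+w. F (step n \<eta> w) \<partial>exp_seq 1) \<in> borel_measurable (config_space n)"
proof -
  interpret W: prob_space "exp_seq 1" by (rule prob_space_exp_seq) simp
  have s: "sets \<mu> = sets (config_space n)" using \<mu> by (simp add: prob_on_states_def)
  have s2: "sets (\<mu> \<Otimes>\<^sub>M exp_seq 1) = sets (config_space n \<Otimes>\<^sub>M seq_space)"
    by (rule sets_pair_measure_cong[OF s sets_exp_seq])
  have s3: "sets (config_space n \<Otimes>\<^sub>M exp_seq 1) = sets (config_space n \<Otimes>\<^sub>M seq_space)"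
    by (rule sets_pair_measure_cong[OF refl sets_exp_seq])
  have m: "(\<lambda>p. step n (fst p) (snd p)) \<in> config_space n \<Otimes>\<^sub>M seq_space \<rightarrow>\<^sub>M config_space n"
    by (rule measurable_step) measurable
  have m': "(\<lambda>q. F (step n (fst q) (snd q))) \<in> borel_measurable (\<mu> \<Otimes>\<^sub>M exp_seq 1)"
    using measurable_compose[OF m F] by (simp add: measurable_cong_sets[OF s2 refl])
  have "(\<integral>\<^sup>+\<eta>. F \<eta> \<partial>\<mu>) = (\<integral>\<^sup>+\<eta>. F \<eta> \<partial>distr (\<mu> \<Otimes>\<^sub>M exp_seq 1) (config_space n) (\<lambda>p. step n (fst p)
      (snd p)))"
    by (simp add: inv)
  also have "\<dots> = (\<integral>\<^sup>+q. F (step n (fst q) (snd q)) \<partial>(\<mu> \<Otimes>\<^sub>M exp_seq 1))"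
    using m F by (intro nn_integral_distr) (auto simp: measurable_cong_sets[OF s2 refl])
  also have "\<dots> = (\<integral>\<^sup>+\<eta>. \<integral>\<^sup>+w. F (step n \<eta> w) \<partial>exp_seq 1 \<partial>\<mu>)"
    using W.nn_integral_fst[OF m'] by simp
  finally show "(\<integral>\<^sup>+\<eta>. \<integral>\<^sup>+w. F (step n \<eta> w) \<partial>exp_seq 1 \<partial>\<mu>) = (\<integral>\<^sup>+\<eta>. F \<eta> \<partial>\<mu>)" by simp
  have "(\<lambda>q. F (step n (fst q) (snd q))) \<in> borel_measurable (config_space n \<Otimes>\<^sub>M exp_seq 1)"
    using measurable_compose[OF m F] by (simp add: measurable_cong_sets[OF s3 refl])
  then show "(\<lambda>\<eta>. \<integral>\<^sup>+w. F (step n \<eta> w) \<partial>exp_seq 1) \<in> borel_measurable (config_space n)"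
    using W.borel_measurable_nn_integral[of "\<lambda>\<eta> w. F (step n \<eta> w)" "config_space n"]
      by (simp add: split_beta')
qed

section \<open>One step of the coupled dynamics, acting on couplings\<close>

locale config_coupling =
  fixes n :: nat and \<rho> :: "nat \<Rightarrow> real" and \<mu> \<mu>' :: "config measure" and \<Lambda> ::
      "(config \<times> config) measure"
  assumes st: "stationary n \<rho> \<mu>" and st': "stationary n \<rho> \<mu>'" and cp: "coupling n \<mu> \<mu>' \<Lambda>"
begin

sublocale L: prob_space \<Lambda> using cp by (simp add: coupling_def)

sublocale W: prob_space "exp_seq 1" by (rule prob_space_exp_seq) simp

sublocale P: pair_prob_space \<Lambda> "exp_seq 1" ..

lemma sets_\<Lambda>: "sets \<Lambda> = sets (config2_space n)"
  using cp by (simp add: coupling_def)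

lemma sets_Q: "sets (\<Lambda> \<Otimes>\<^sub>M exp_seq 1) = sets (config2_space n \<Otimes>\<^sub>M seq_space)"
  by (rule sets_pair_measure_cong[OF sets_\<Lambda> sets_exp_seq])

lemma fst_\<Lambda>: "fst \<in> \<Lambda> \<rightarrow>\<^sub>M config_space n" and snd_\<Lambda>: "snd \<in> \<Lambda> \<rightarrow>\<^sub>M config_space n"
  by (auto simp: measurable_cong_sets[OF sets_\<Lambda> refl])

lemma distr_fst: "distr \<Lambda> (config_space n) fst = \<mu>" and distr_snd:
    "distr \<Lambda> (config_space n) snd = \<mu>'"
  and distr_translate2: "distr \<Lambda> (config2_space n) (translate2 n) = \<Lambda>"
  using cp by (simp_all add: coupling_def)

lemma nn_integral_fst_\<Lambda>: "F \<in> borel_measurable (config_space n) \<Longrightarrow> (\<integral>\<^sup>+p. F (fst p) \<partial>\<Lambda>)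
    = (\<integral>\<^sup>+\<eta>. F \<eta> \<partial>\<mu>)"
  unfolding distr_fst[symmetric] by (rule nn_integral_distr[OF fst_\<Lambda>, symmetric]) simp

lemma nn_integral_snd_\<Lambda>: "F \<in> borel_measurable (config_space n) \<Longrightarrow> (\<integral>\<^sup>+p. F (snd p) \<partial>\<Lambda>)
    = (\<integral>\<^sup>+\<eta>. F \<eta> \<partial>\<mu>')"
  unfolding distr_snd[symmetric] by (rule nn_integral_distr[OF snd_\<Lambda>, symmetric]) simp

lemma AE_regular: "AE p in \<Lambda>. \<forall>i\<in>{1..n}. regular (fst p i) \<and> regular (snd p i)"
proof -
  have reg: "\<eta> \<in> state_space n \<Longrightarrow> \<forall>i\<in>{1..n}. regular (\<eta> i)" for \<eta>
    by (simp add: state_space_iff regular_def)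
  have "AE \<eta> in \<mu>. \<eta> \<in> state_space n" "AE \<eta> in \<mu>'. \<eta> \<in> state_space n"
    using st st' by (auto simp: stationary_def prob_on_states_def)
  then have "AE p in \<Lambda>. fst p \<in> state_space n" "AE p in \<Lambda>. snd p \<in> state_space n"
    unfolding distr_fst[symmetric] distr_snd[symmetric]
      using AE_distrD[OF fst_\<Lambda>] AE_distrD[OF snd_\<Lambda>] by auto
  then show ?thesis by eventually_elim (use reg in blast)
qed

lemma nn_integral_couple_step:
  assumes F: "F \<in> borel_measurable (config2_space n)"
  shows "(\<integral>\<^sup>+p. F p \<partial>couple_step n \<Lambda>) = (\<integral>\<^sup>+p. \<integral>\<^sup>+w. F (step2 n p w) \<partial>exp_seq 1 \<partial>\<Lambda>)"
proof -
  have m: "(\<lambda>q. step2 n (fst q) (snd q)) \<in> config2_space n \<Otimes>\<^sub>M seq_space \<rightarrow>\<^sub>M config2_space n"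
    by (rule measurable_step2) measurable
  have m': "(\<lambda>q. F (step2 n (fst q) (snd q))) \<in> borel_measurable (\<Lambda> \<Otimes>\<^sub>M exp_seq 1)"
    using measurable_compose[OF m F] by (simp add: measurable_cong_sets[OF sets_Q refl])
  have "(\<integral>\<^sup>+p. F p \<partial>couple_step n \<Lambda>) = (\<integral>\<^sup>+q. F (step2 n (fst q) (snd q)) \<partial>(\<Lambda> \<Otimes>\<^sub>M exp_seq 1))"
    unfolding couple_step_def using m F
    by (intro nn_integral_distr) (auto simp: measurable_cong_sets[OF sets_Q refl])
  also have "\<dots> = (\<integral>\<^sup>+p. \<integral>\<^sup>+w. F (step2 n p w) \<partial>exp_seq 1 \<partial>\<Lambda>)"
    using W.nn_integral_fst[OF m'] by simp
  finally show ?thesis .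
qed

lemma stationary_facts:
  "prob_on_states n \<mu>" "distr (\<mu> \<Otimes>\<^sub>M exp_seq 1) (config_space n) (\<lambda>p. step n (fst p) (snd p)) = \<mu>"
  "prob_on_states n \<mu>'" "distr (\<mu>' \<Otimes>\<^sub>M exp_seq 1) (config_space n) (\<lambda>p. step n (fst p) (snd p))
      = \<mu>'"
  using st st' by (simp_all add: stationary_def)

lemma prob_space_couple_step: "prob_space (couple_step n \<Lambda>)"
proof -
  have "(\<lambda>q. step2 n (fst q) (snd q)) \<in> config2_space n \<Otimes>\<^sub>M seq_space \<rightarrow>\<^sub>M config2_space n"
    by (rule measurable_step2) measurable
  then show ?thesis
    unfolding couple_step_def by (intro P.prob_space_distr) (simp add: measurable_cong_sets[OF
        sets_Q refl])
qed

text \<open>Both copies use the same services, so each marginal performs a step of the chain and is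
  preserved by invariance.\<close>

lemma coupling_couple_step: "coupling n \<mu> \<mu>' (couple_step n \<Lambda>)"
  unfolding coupling_def
proof (intro conjI)
  let ?\<Lambda> = "couple_step n \<Lambda>"
  show "prob_space ?\<Lambda>" by (rule prob_space_couple_step)
  show s: "sets ?\<Lambda> = sets (config2_space n)" by (simp add: couple_step_def)
  have f: "fst \<in> ?\<Lambda> \<rightarrow>\<^sub>M config_space n" "snd \<in> ?\<Lambda> \<rightarrow>\<^sub>M config_space n"
      "translate2 n \<in> ?\<Lambda> \<rightarrow>\<^sub>M config2_space n"
    using measurable_translate2 by (auto simp: measurable_cong_sets[OF s refl])
  show "distr ?\<Lambda> (config_space n) fst = \<mu>"
  proof (rule measure_eqI_nn_integral)
    fix F :: "config \<Rightarrow> ennreal" assume "F \<in> borel_measurable (distr ?\<Lambda> (config_space n) fst)"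
    then have F: "F \<in> borel_measurable (config_space n)" by simp
    have "(\<integral>\<^sup>+x. F x \<partial>distr ?\<Lambda> (config_space n) fst) = (\<integral>\<^sup>+p. F (fst p) \<partial>?\<Lambda>)"
      using F by (intro nn_integral_distr f) simp
    also have "\<dots> = (\<integral>\<^sup>+p. \<integral>\<^sup>+w. F (step n (fst p) w) \<partial>exp_seq 1 \<partial>\<Lambda>)"
      using nn_integral_couple_step[OF measurable_compose[OF measurable_fst F]]
        by (simp add: step2_def)
    also have "\<dots> = (\<integral>\<^sup>+\<eta>. F \<eta> \<partial>\<mu>)"
      using nn_integral_fst_\<Lambda>[OF nn_integral_step_marginal(2)[OF stationary_facts(1,2) F]]
          nn_integral_step_marginal(1)[OF stationary_facts(1,2) F] by simp
    finally show "(\<integral>\<^sup>+x. F x \<partial>distr ?\<Lambda> (config_space n) fst) = (\<integral>\<^sup>+\<eta>. F \<eta> \<partial>\<mu>)" .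
  qed (use stationary_facts in \<open>simp add: prob_on_states_def\<close>)
  show "distr ?\<Lambda> (config_space n) snd = \<mu>'"
  proof (rule measure_eqI_nn_integral)
    fix F :: "config \<Rightarrow> ennreal" assume "F \<in> borel_measurable (distr ?\<Lambda> (config_space n) snd)"
    then have F: "F \<in> borel_measurable (config_space n)" by simp
    have "(\<integral>\<^sup>+x. F x \<partial>distr ?\<Lambda> (config_space n) snd) = (\<integral>\<^sup>+p. F (snd p) \<partial>?\<Lambda>)"
      using F by (intro nn_integral_distr f) simp
    also have "\<dots> = (\<integral>\<^sup>+p. \<integral>\<^sup>+w. F (step n (snd p) w) \<partial>exp_seq 1 \<partial>\<Lambda>)"
      using nn_integral_couple_step[OF measurable_compose[OF measurable_snd F]]
        by (simp add: step2_def)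
    also have "\<dots> = (\<integral>\<^sup>+\<eta>. F \<eta> \<partial>\<mu>')"
      using nn_integral_snd_\<Lambda>[OF nn_integral_step_marginal(2)[OF stationary_facts(3,4) F]]
          nn_integral_step_marginal(1)[OF stationary_facts(3,4) F] by simp
    finally show "(\<integral>\<^sup>+x. F x \<partial>distr ?\<Lambda> (config_space n) snd) = (\<integral>\<^sup>+\<eta>. F \<eta> \<partial>\<mu>')" .
  qed (use stationary_facts in \<open>simp add: prob_on_states_def\<close>)
  show "distr ?\<Lambda> (config2_space n) (translate2 n) = ?\<Lambda>"
  proof (rule measure_eqI_nn_integral)
    fix F :: "config \<times> config \<Rightarrow> ennreal" assume
        "F \<in> borel_measurable (distr ?\<Lambda> (config2_space n) (translate2 n))"
    then have F: "F \<in> borel_measurable (config2_space n)" by simp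
    have Fs: "(\<lambda>p. \<integral>\<^sup>+w. F (step2 n p w) \<partial>exp_seq 1) \<in> borel_measurable (config2_space n)"
      by (rule W.borel_measurable_nn_integral, unfold split_beta', rule measurable_compose[OF
          measurable_step2 F]) measurable
    have "(\<integral>\<^sup>+x. F x \<partial>distr ?\<Lambda> (config2_space n) (translate2 n)) = (\<integral>\<^sup>+p. F (translate2 n p) \<partial>?\<Lambda>)"
      using F by (intro nn_integral_distr f) simp
    also have "\<dots> = (\<integral>\<^sup>+p. \<integral>\<^sup>+w. F (translate2 n (step2 n p w)) \<partial>exp_seq 1 \<partial>\<Lambda>)"
      by (rule nn_integral_couple_step[OF measurable_compose[OF measurable_translate2 F]])
    \<comment> \<open>A step commutes with the translation once the services are shifted as well;
      the law of the services then absorbs that shift.\<close>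
    also have "\<dots> = (\<integral>\<^sup>+p. \<integral>\<^sup>+w. F (step2 n (translate2 n p) (shift w)) \<partial>exp_seq 1 \<partial>\<Lambda>)"
    proof (rule nn_integral_cong_AE, rule AE_mp[OF AE_regular], rule AE_I2, rule impI)
      fix p assume p: "\<forall>i\<in>{1..n}. regular (fst p i) \<and> regular (snd p i)"
      show "(\<integral>\<^sup>+w. F (translate2 n (step2 n p w)) \<partial>exp_seq 1)
          = (\<integral>\<^sup>+w. F (step2 n (translate2 n p) (shift w)) \<partial>exp_seq 1)"
      proof (rule nn_integral_cong_AE, rule AE_mp[OF AE_regular_admissible], rule AE_I2, rule impI)
        fix w assume w: "\<forall>z. regular z \<longrightarrow> admissible z w"
        have "queue_map (shift (fst p i)) (shift w) = shift (queue_map (fst p i) w)"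
          "queue_map (shift (snd p i)) (shift w) = shift (queue_map (snd p i) w)" if "i \<in> {1..n}"
              for i
          using p w that by (auto intro!: queue_map_shift simp: admissible_def)
        then have "translate2 n (step2 n p w) = step2 n (translate2 n p) (shift w)"
          by (auto simp: translate2_def step2_def step_def translate_1 restrict_def fun_eq_iff)
        then show "F (translate2 n (step2 n p w)) = F (step2 n (translate2 n p) (shift w))" by simp
      qed
    qed
    also have "\<dots> = (\<integral>\<^sup>+p. \<integral>\<^sup>+w. F (step2 n (translate2 n p) w) \<partial>exp_seq 1 \<partial>\<Lambda>)"
    proof (rule nn_integral_cong)
      fix p assume "p \<in> space \<Lambda>"
      then have "translate2 n p \<in> space (config2_space n)"
        using measurable_space[OF measurable_translate2] sets_eq_imp_space_eq[OF sets_\<Lambda>] by simp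
      then have c: "(\<lambda>w. translate2 n p) \<in> seq_space \<rightarrow>\<^sub>M config2_space n" by simp
      show "(\<integral>\<^sup>+w. F (step2 n (translate2 n p) (shift w)) \<partial>exp_seq 1)
          = (\<integral>\<^sup>+w. F (step2 n (translate2 n p) w) \<partial>exp_seq 1)"
        by (rule nn_integral_exp_seq_shift, simp, rule measurable_compose[OF measurable_step2[OF c]
            F]) measurable
    qed
    also have "\<dots> = (\<integral>\<^sup>+p. \<integral>\<^sup>+w. F (step2 n p w) \<partial>exp_seq 1 \<partial>distr \<Lambda> (config2_space n) (translate2
        n))"
      using measurable_translate2 Fs
      by (intro nn_integral_distr[symmetric]) (auto simp: measurable_cong_sets[OF sets_\<Lambda> refl])
    also have "\<dots> = (\<integral>\<^sup>+p. F p \<partial>?\<Lambda>)"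
      unfolding distr_translate2 by (rule nn_integral_couple_step[OF F, symmetric])
    finally show "(\<integral>\<^sup>+x. F x \<partial>distr ?\<Lambda> (config2_space n) (translate2 n)) = (\<integral>\<^sup>+p. F p \<partial>?\<Lambda>)" .
  qed (simp add: s)
qed

definition component :: "nat \<Rightarrow> (seq \<times> seq) measure" where
  "component i = distr \<Lambda> seq2_space (\<lambda>p. (fst p i, snd p i))"

lemma measurable_component_\<Lambda>: "i \<in> {1..n}
    \<Longrightarrow> (\<lambda>p. (fst p i, snd p i)) \<in> config2_space n \<rightarrow>\<^sub>M seq2_space"
  by (intro measurable_Pair measurable_component2[where f = "\<lambda>p. p"]) auto

lemma measurable_component_\<Lambda>': "i \<in> {1..n} \<Longrightarrow> (\<lambda>p. (fst p i, snd p i)) \<in> \<Lambda> \<rightarrow>\<^sub>M seq2_space"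
  using measurable_component_\<Lambda> by (simp add: measurable_cong_sets[OF sets_\<Lambda> refl])

lemma nn_integral_component:
  assumes "i \<in> {1..n}" "F \<in> borel_measurable seq2_space"
  shows "(\<integral>\<^sup>+p. F p \<partial>component i) = (\<integral>\<^sup>+p. F (fst p i, snd p i) \<partial>\<Lambda>)"
  unfolding component_def using assms by (intro nn_integral_distr measurable_component_\<Lambda>') auto

lemma nn_integral_component_W:
  assumes i: "i \<in> {1..n}" and F [measurable]: "F \<in> borel_measurable (seq2_space \<Otimes>\<^sub>M seq_space)"
  shows "(\<integral>\<^sup>+q. F q \<partial>(component i \<Otimes>\<^sub>M exp_seq 1))
      = (\<integral>\<^sup>+p. \<integral>\<^sup>+w. F ((fst p i, snd p i), w) \<partial>exp_seq 1 \<partial>\<Lambda>)"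
proof -
  have s: "sets (component i \<Otimes>\<^sub>M exp_seq 1) = sets (seq2_space \<Otimes>\<^sub>M seq_space)"
    by (rule sets_pair_measure_cong[OF _ sets_exp_seq]) (simp add: component_def)
  have "(\<integral>\<^sup>+q. F q \<partial>(component i \<Otimes>\<^sub>M exp_seq 1)) = (\<integral>\<^sup>+p. \<integral>\<^sup>+w. F (p, w) \<partial>exp_seq 1 \<partial>component i)"
    using F by (subst W.nn_integral_fst) (auto simp: measurable_cong_sets[OF s refl])
  also have "\<dots> = (\<integral>\<^sup>+p. \<integral>\<^sup>+w. F ((fst p i, snd p i), w) \<partial>exp_seq 1 \<partial>\<Lambda>)"
    by (intro nn_integral_component[OF i]) measurable
  finally show ?thesis .
qed

lemma nn_integral_output:
  assumes i: "i \<in> {1..n}" and F [measurable]: "F \<in> borel_measurable (borel \<Otimes>\<^sub>M borel)"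
  shows "(\<integral>\<^sup>+q. F (queue_map (fst (fst q)) (snd q) 0, queue_map (snd (fst q)) (snd q) 0) \<partial>(component
      i \<Otimes>\<^sub>M exp_seq 1))
    = (\<integral>\<^sup>+p. F (fst p i 0, snd p i 0) \<partial>couple_step n \<Lambda>)"
proof -
  have m: "(\<lambda>p. F (fst p i 0, snd p i 0)) \<in> borel_measurable (config2_space n)"
    using measurable_compose[OF measurable_component_\<Lambda>[OF i], of "\<lambda>p. F (fst p 0, snd p 0)"] by simp
  have "(\<integral>\<^sup>+q. F (queue_map (fst (fst q)) (snd q) 0, queue_map (snd (fst q)) (snd q) 0) \<partial>(component
      i \<Otimes>\<^sub>M exp_seq 1))
    = (\<integral>\<^sup>+p. \<integral>\<^sup>+w. F (queue_map (fst p i) w 0, queue_map (snd p i) w 0) \<partial>exp_seq 1 \<partial>\<Lambda>)"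
  proof (subst nn_integral_component_W[OF i])
    show "(\<lambda>q. F (queue_map (fst (fst q)) (snd q) 0, queue_map (snd (fst q)) (snd q) 0)) \<in>
        borel_measurable (seq2_space \<Otimes>\<^sub>M seq_space)"
      by measurable
  qed simp
  also have "\<dots> = (\<integral>\<^sup>+p. F (fst p i 0, snd p i 0) \<partial>couple_step n \<Lambda>)"
    using i by (simp add: nn_integral_couple_step[OF m] step2_def step_def)
  finally show ?thesis .
qed

lemma nn_integral_marginals:
  assumes i: "i \<in> {1..n}" and "coupling n \<mu> \<mu>' \<Lambda>'"
  shows "(\<integral>\<^sup>+p. ennreal (norm (fst p i 0)) \<partial>\<Lambda>') < \<infinity>" "(\<integral>\<^sup>+p. ennreal (norm (snd p i 0)) \<partial>\<Lambda>') < \<infinity>"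
proof -
  interpret C: config_coupling n \<rho> \<mu> \<mu>' \<Lambda>' using st st' assms(2) by unfold_locales
  have m: "(\<lambda>\<eta>. ennreal (norm (\<eta> i 0))) \<in> borel_measurable (config_space n)"
    by (rule measurable_compose[OF measurable_config_component[where f = "\<lambda>\<eta>. \<eta>", OF _ i]]) auto
  have "(\<integral>\<^sup>+\<eta>. ennreal (norm (\<eta> i 0)) \<partial>\<mu>) < \<infinity>" "(\<integral>\<^sup>+\<eta>. ennreal (norm (\<eta> i 0)) \<partial>\<mu>') < \<infinity>"
    using st st' i by (auto simp: stationary_def integrable_iff_bounded)
  then show "(\<integral>\<^sup>+p. ennreal (norm (fst p i 0)) \<partial>\<Lambda>') < \<infinity>"
      "(\<integral>\<^sup>+p. ennreal (norm (snd p i 0)) \<partial>\<Lambda>') < \<infinity>"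
    using C.nn_integral_fst_\<Lambda>[OF m] C.nn_integral_snd_\<Lambda>[OF m] by auto
qed

lemma seq_coupling_component:
  assumes i: "i \<in> {1..n}"
  shows "seq_coupling (component i)"
proof -
  interpret D: prob_space "component i"
    unfolding component_def by (rule L.prob_space_distr[OF measurable_component_\<Lambda>'[OF i]])
  have sc [measurable_cong]: "sets (component i) = sets seq2_space" by (simp add: component_def)
  show ?thesis
  proof
    show "sets (component i) = sets seq2_space" by (rule sc)
    fix F :: "seq \<times> seq \<Rightarrow> ennreal" assume F [measurable]: "F \<in> borel_measurable seq2_space"
    have m: "(\<lambda>p. F (fst p i, snd p i)) \<in> borel_measurable (config2_space n)"
      by (rule measurable_compose[OF measurable_component_\<Lambda>[OF i] F])
    have "(\<integral>\<^sup>+p. F (shift (fst p), shift (snd p)) \<partial>component i)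
        = (\<integral>\<^sup>+p. F (shift (fst p i), shift (snd p i)) \<partial>\<Lambda>)"
      by (subst nn_integral_component[OF i]) auto
    also have "\<dots> = (\<integral>\<^sup>+p. (\<lambda>p. F (fst p i, snd p i)) (translate2 n p) \<partial>\<Lambda>)"
      using i by (simp add: translate2_def translate_1)
    also have "\<dots> = (\<integral>\<^sup>+p. F (fst p i, snd p i) \<partial>distr \<Lambda> (config2_space n) (translate2 n))"
      using measurable_translate2 m by (intro nn_integral_distr[symmetric]) (auto simp:
          measurable_cong_sets[OF sets_\<Lambda> refl])
    also have "\<dots> = (\<integral>\<^sup>+p. F p \<partial>component i)"
      unfolding distr_translate2 by (rule nn_integral_component[OF i F, symmetric])
    finally show "(\<integral>\<^sup>+p. F (shift (fst p), shift (snd p)) \<partial>component i)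
        = (\<integral>\<^sup>+p. F p \<partial>component i)" .
  next
    have "AE p in \<Lambda>. regular (fst p i) \<and> regular (snd p i)"
      using AE_regular by eventually_elim (use i in blast)
    then show "AE p in component i. regular (fst p) \<and> regular (snd p)"
      unfolding component_def
    proof (subst AE_distr_iff[OF measurable_component_\<Lambda>'[OF i]])
      show "{p \<in> space seq2_space. regular (fst p) \<and> regular (snd p)} \<in> sets seq2_space"
        by measurable
    qed simp
    have "(\<integral>\<^sup>+p. ennreal (norm (fst p 0)) \<partial>component i) < \<infinity>"
        "(\<integral>\<^sup>+p. ennreal (norm (snd p 0)) \<partial>component i) < \<infinity>"
      using nn_integral_marginals[OF i cp] by (subst nn_integral_component[OF i]; simp)+
    then show "integrable (component i) (\<lambda>p. fst p 0)" "integrable (component i) (\<lambda>p. snd p 0)"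
      by (intro integrableI_bounded; simp)+
    \<comment> \<open>The outputs are distributed as component \<open>i\<close> of
      \<open>couple_step n \<Lambda>\<close>, again a coupling of the same two marginals, whose
      means are finite.\<close>
    have "(\<integral>\<^sup>+q. ennreal (norm (queue_map (fst (fst q)) (snd q) 0)) \<partial>(component i \<Otimes>\<^sub>M exp_seq 1)) <
        \<infinity>"
      "(\<integral>\<^sup>+q. ennreal (norm (queue_map (snd (fst q)) (snd q) 0)) \<partial>(component i \<Otimes>\<^sub>M exp_seq 1)) < \<infinity>"
      using nn_integral_output[OF i, of "\<lambda>x. ennreal (norm (fst x))"] nn_integral_output[OF i, of
          "\<lambda>x. ennreal (norm (snd x))"]
        nn_integral_marginals[OF i coupling_couple_step] by simp_all
    then show "integrable (component i \<Otimes>\<^sub>M exp_seq 1) (\<lambda>q. queue_map (fst (fst q)) (snd q) 0)"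
      "integrable (component i \<Otimes>\<^sub>M exp_seq 1) (\<lambda>q. queue_map (snd (fst q)) (snd q) 0)"
      by (intro integrableI_bounded; simp)+
  qed
qed

definition mean_loss :: "nat \<Rightarrow> real" where
  "mean_loss i = (\<integral>q. loss (fst (fst q)) (snd (fst q)) (snd q) 0 \<partial>(component i \<Otimes>\<^sub>M exp_seq 1))"

lemma mean_loss_nonneg: "0 \<le> mean_loss i"
  unfolding mean_loss_def by (rule Bochner_Integration.integral_nonneg) (rule loss_nonneg)

lemma integral_component:
  fixes f :: "seq \<times> seq \<Rightarrow> real"
  assumes "i \<in> {1..n}" "f \<in> borel_measurable seq2_space"
  shows "(\<integral>p. f p \<partial>component i) = (\<integral>p. f (fst p i, snd p i) \<partial>\<Lambda>)"
  unfolding component_def using assms by (intro integral_distr measurable_component_\<Lambda>')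

lemma cost_couple_step: "cost n (couple_step n \<Lambda>) = cost n \<Lambda> - (\<Sum>i\<in>{1..n}. mean_loss i)"
proof -
  have "(\<integral>p. \<bar>fst p i 0 - snd p i 0\<bar> \<partial>couple_step n \<Lambda>)
      = (\<integral>p. \<bar>fst p i 0 - snd p i 0\<bar> \<partial>\<Lambda>) - mean_loss i"
    if i: "i \<in> {1..n}" for i
  proof -
    interpret S: seq_coupling "component i" by (rule seq_coupling_component[OF i])
    have s: "sets (couple_step n \<Lambda>) = sets (config2_space n)" by (simp add: couple_step_def)
    have m: "(\<lambda>p. \<bar>fst p i 0 - snd p i 0\<bar>) \<in> borel_measurable (couple_step n \<Lambda>)"
      using measurable_compose[OF measurable_component_\<Lambda>[OF i], of "\<lambda>p. \<bar>fst p 0 - snd p 0\<bar>"]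
      by (simp add: measurable_cong_sets[OF s refl])
    have "(\<integral>p. \<bar>fst p i 0 - snd p i 0\<bar> \<partial>couple_step n \<Lambda>)
      = (\<integral>q. \<bar>queue_map (fst (fst q)) (snd q) 0 - queue_map (snd (fst q)) (snd q) 0\<bar> \<partial>(component i
          \<Otimes>\<^sub>M exp_seq 1))"
      using nn_integral_output[OF i, of "\<lambda>x. ennreal \<bar>fst x - snd x\<bar>"] m
        by (simp add: integral_eq_nn_integral)
    also have "\<dots> = (\<integral>p. \<bar>fst p 0 - snd p 0\<bar> \<partial>component i) - mean_loss i"
      unfolding mean_loss_def by (rule S.dist_decrease)
    also have "(\<integral>p. \<bar>fst p 0 - snd p 0\<bar> \<partial>component i) = (\<integral>p. \<bar>fst p i 0 - snd p i 0\<bar> \<partial>\<Lambda>)"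
      by (subst integral_component[OF i]) auto
    finally show ?thesis .
  qed
  then show ?thesis by (simp add: cost_def sum_subtractf)
qed

lemma integral_marginal:
  fixes f :: "seq \<Rightarrow> real"
  assumes i: "i \<in> {1..n}" and f [measurable]: "f \<in> borel_measurable seq_space"
  shows "(\<integral>p. f (fst p) \<partial>component i) = (\<integral>z. f z \<partial>distr \<mu> seq_space (\<lambda>\<eta>. \<eta> i))"
    "(\<integral>p. f (snd p) \<partial>component i) = (\<integral>z. f z \<partial>distr \<mu>' seq_space (\<lambda>\<eta>. \<eta> i))"
proof -
  have c: "(\<lambda>\<eta>. \<eta> i) \<in> config_space n \<rightarrow>\<^sub>M seq_space"
    using measurable_config_component[where f = "\<lambda>\<eta>. \<eta>", OF _ i] by simp
  have s: "sets \<mu> = sets (config_space n)" "sets \<mu>' = sets (config_space n)"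
    using stationary_facts by (simp_all add: prob_on_states_def)
  have m: "(\<lambda>\<eta>. \<eta> i) \<in> \<mu> \<rightarrow>\<^sub>M seq_space" "(\<lambda>\<eta>. \<eta> i) \<in> \<mu>' \<rightarrow>\<^sub>M seq_space"
    using c by (simp_all add: measurable_cong_sets[OF s(1) refl] measurable_cong_sets[OF s(2) refl])
  have fc: "(\<lambda>\<eta>. f (\<eta> i)) \<in> borel_measurable (config_space n)" by (rule measurable_compose[OF c f])
  have "(\<integral>p. f (fst p) \<partial>component i) = (\<integral>p. f (fst p i) \<partial>\<Lambda>)"
    by (subst integral_component[OF i]) auto
  also have "\<dots> = (\<integral>\<eta>. f (\<eta> i) \<partial>\<mu>)" unfolding distr_fst[symmetric]
    by (rule integral_distr[OF fst_\<Lambda> fc, symmetric])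
  also have "\<dots> = (\<integral>z. f z \<partial>distr \<mu> seq_space (\<lambda>\<eta>. \<eta> i))"
    by (rule integral_distr[OF m(1) f, symmetric])
  finally show "(\<integral>p. f (fst p) \<partial>component i) = (\<integral>z. f z \<partial>distr \<mu> seq_space (\<lambda>\<eta>. \<eta> i))" .
  have "(\<integral>p. f (snd p) \<partial>component i) = (\<integral>p. f (snd p i) \<partial>\<Lambda>)"
    by (subst integral_component[OF i]) auto
  also have "\<dots> = (\<integral>\<eta>. f (\<eta> i) \<partial>\<mu>')" unfolding distr_snd[symmetric]
    by (rule integral_distr[OF snd_\<Lambda> fc, symmetric])
  also have "\<dots> = (\<integral>z. f z \<partial>distr \<mu>' seq_space (\<lambda>\<eta>. \<eta> i))"
    by (rule integral_distr[OF m(2) f, symmetric])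
  finally show "(\<integral>p. f (snd p) \<partial>component i) = (\<integral>z. f z \<partial>distr \<mu>' seq_space (\<lambda>\<eta>. \<eta> i))" .
qed

end

context config_coupling
begin

abbreviation total :: "nat \<Rightarrow> seq \<Rightarrow> real" where
  "total N z \<equiv> (\<Sum>k=- int N..0. z k)"

text \<open>Apart from the mean loss, the right-hand side involves the marginals only. So
  \<open>N\<close> and \<open>K\<close> can be fixed before the coupling is selected.\<close>

lemma component_bound:
  assumes i: "i \<in> {1..n}" and K: "0 \<le> K"
  shows "(\<integral>p. \<bar>fst p i 0 - snd p i 0\<bar> \<partial>\<Lambda>) \<le>
    (\<integral>z. \<bar>total N z / real (Suc N) - \<rho> i\<bar> \<partial>distr \<mu> seq_space (\<lambda>\<eta>. \<eta> i))
    + (\<integral>z. \<bar>total N z / real (Suc N) - \<rho> i\<bar> \<partial>distr \<mu>' seq_space (\<lambda>\<eta>. \<eta> i))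
    + exp (2 * K) * mean_loss i
    + 2 * (\<integral>z. total N z * indicator {K<..} (total N z) \<partial>distr \<mu> seq_space (\<lambda>\<eta>. \<eta> i))
    + 2 * (\<integral>z. total N z * indicator {K<..} (total N z) \<partial>distr \<mu>' seq_space (\<lambda>\<eta>. \<eta> i))"
proof -
  interpret S: seq_coupling "component i" by (rule seq_coupling_component[OF i])
  have m1: "(\<lambda>z. \<bar>total N z / real (Suc N) - \<rho> i\<bar>) \<in> borel_measurable seq_space" by measurable
  have m2: "(\<lambda>z. total N z * indicator {K<..} (total N z)) \<in> borel_measurable seq_space"
    by measurable
  have "(\<integral>p. \<bar>fst p i 0 - snd p i 0\<bar> \<partial>\<Lambda>) = (\<integral>p. \<bar>fst p 0 - snd p 0\<bar> \<partial>component i)"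
    by (subst integral_component[OF i]) auto
  also note S.dist_bound[OF K, of N "\<rho> i"]
  finally show ?thesis
    unfolding mean_loss_def[symmetric] integral_marginal[OF i m1] integral_marginal[OF i m2] .
qed

lemma dist_le_cost:
  assumes i: "i \<in> {1..n}"
  shows "(\<integral>p. \<bar>fst p i k - snd p i k\<bar> \<partial>\<Lambda>) \<le> cost n \<Lambda>" "integrable \<Lambda> (\<lambda>p. \<bar>fst p i k - snd p i k\<bar>)"
proof -
  interpret S: seq_coupling "component i" by (rule seq_coupling_component[OF i])
  have "(\<integral>p. \<bar>fst p i k - snd p i k\<bar> \<partial>\<Lambda>) = (\<integral>p. \<bar>fst p k - snd p k\<bar> \<partial>component i)"
    by (subst integral_component[OF i]) auto
  also have "\<dots> = (\<integral>p. \<bar>fst p 0 - snd p 0\<bar> \<partial>component i)" by (rule S.integral_dist)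
  also have "\<dots> = (\<integral>p. \<bar>fst p i 0 - snd p i 0\<bar> \<partial>\<Lambda>)"
    by (subst integral_component[OF i]) auto
  also have "\<dots> \<le> cost n \<Lambda>"
    unfolding cost_def using i by (intro member_le_sum Bochner_Integration.integral_nonneg) auto
  finally show "(\<integral>p. \<bar>fst p i k - snd p i k\<bar> \<partial>\<Lambda>) \<le> cost n \<Lambda>" .
  show "integrable \<Lambda> (\<lambda>p. \<bar>fst p i k - snd p i k\<bar>)"
    using S.integrable_dist[of k] unfolding component_def
    by (subst (asm) integrable_distr_eq[OF measurable_component_\<Lambda>'[OF i]]) auto
qed

end

section \<open>Couplings of arbitrarily small cost\<close>

lemma cost_nonneg: "0 \<le> cost n \<Lambda>"
  unfolding cost_def by (intro sum_nonneg Bochner_Integration.integral_nonneg) auto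

text \<open>The cost does not increase under the coupled dynamics, so a coupling of almost minimal cost
  has almost no loss in the next step.\<close>

lemma small_coupling:
  assumes st: "stationary n \<rho> \<mu>" and st': "stationary n \<rho> \<mu>'" and \<epsilon>: "0 < \<epsilon>"
  shows "\<exists>\<Lambda>. coupling n \<mu> \<mu>' \<Lambda> \<and> cost n \<Lambda> < \<epsilon>"
proof -
  \<comment> \<open>In \<open>component_bound\<close> there are two errors of averages, one loss
    term and two tails with factor 2, altogether 7 times \<open>\<delta>\<close>. The
    \<open>+ 1\<close> keeps the denominator positive and the final inequality strict.\<close>
  define \<delta> where "\<delta> = \<epsilon> / (7 * (real n + 1))"
  have \<delta>: "0 < \<delta>" using \<epsilon> by (simp add: \<delta>_def)
  let ?total = "\<lambda>N z. (\<Sum>k=- int N..0. z k) :: real"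
  let ?err = "\<lambda>\<mu> i N. (\<integral>z. \<bar>?total N z / real (Suc N) - \<rho> i\<bar> \<partial>distr \<mu> seq_space (\<lambda>\<eta>. \<eta> i))"
  let ?tail = "\<lambda>\<mu> i N K. (\<integral>z. ?total N z
      * indicator {K<..} (?total N z) \<partial>distr \<mu> seq_space (\<lambda>\<eta>. \<eta> i))"
  have S: "stationary_seq (distr \<mu> seq_space (\<lambda>\<eta>. \<eta> i)) (\<rho> i)" if "i \<in> {1..n}" "stationary n \<rho> \<mu>"
      for i \<mu>
    using that by (intro stationary_seq_component) (auto simp: stationary_def)
  have "\<forall>\<^sub>F N in sequentially. \<forall>i\<in>{1..n}. ?err \<mu> i N < \<delta> \<and> ?err \<mu>' i N < \<delta>"
  proof (intro eventually_ball_finite finite_atLeastAtMost ballI eventually_conj)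
    fix i assume i: "i \<in> {1..n}"
    show "\<forall>\<^sub>F N in sequentially. ?err \<mu> i N < \<delta>" "\<forall>\<^sub>F N in sequentially. ?err \<mu>' i N < \<delta>"
      using order_tendstoD(2)[OF stationary_seq.cesaro_L1[OF S[OF i st]] \<delta>]
        order_tendstoD(2)[OF stationary_seq.cesaro_L1[OF S[OF i st']] \<delta>] by auto
  qed
  then obtain N where N: "\<And>i. i \<in> {1..n} \<Longrightarrow> ?err \<mu> i N < \<delta> \<and> ?err \<mu>' i N < \<delta>"
    using eventually_happens'[OF sequentially_bot] by blast
  have "\<forall>\<^sub>F m in sequentially. \<forall>i\<in>{1..n}. ?tail \<mu> i N (real m) < \<delta> \<and> ?tail \<mu>' i N (real m) < \<delta>"
  proof (intro eventually_ball_finite finite_atLeastAtMost ballI eventually_conj)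
    fix i assume i: "i \<in> {1..n}"
    show "\<forall>\<^sub>F m in sequentially. ?tail \<mu> i N (real m) < \<delta>"
        "\<forall>\<^sub>F m in sequentially. ?tail \<mu>' i N (real m) < \<delta>"
      using order_tendstoD(2)[OF stationary_seq.tail_tendsto[OF S[OF i st]] \<delta>]
        order_tendstoD(2)[OF stationary_seq.tail_tendsto[OF S[OF i st']] \<delta>] by auto
  qed
  then obtain m where m: "\<And>i. i \<in> {1..n} \<Longrightarrow> ?tail \<mu> i N (real m) < \<delta> \<and> ?tail \<mu>' i N (real m) < \<delta>"
    using eventually_happens'[OF sequentially_bot] by blast
  \<comment> \<open>The order of choices is essential: \<open>N\<close> makes the averages accurate,
    \<open>m\<close> makes the tails small for that \<open>N\<close>, and only then is the
    admissible loss fixed so as to beat the factor \<open>exp (2 * real m)\<close>.\<close>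
  define \<gamma> where "\<gamma> = \<delta> / exp (2 * real m)"
  have \<gamma>: "0 < \<gamma>" "exp (2 * real m) * \<gamma> = \<delta>" using \<delta> by (simp_all add: \<gamma>_def)
  define C where "C = cost n ` {\<Lambda>. coupling n \<mu> \<mu>' \<Lambda>}"
  have C_ne: "C \<noteq> {}" using coupling_product[OF st st'] by (auto simp: C_def)
  have C_bdd: "bdd_below C" by (rule bdd_belowI[of _ 0]) (auto simp: C_def cost_nonneg)
  have "Inf C < Inf C + \<gamma>" using \<gamma> by simp
  then have "\<exists>x\<in>C. x < Inf C + \<gamma>" by (subst (asm) cInf_less_iff[OF C_ne C_bdd])
  then obtain \<Lambda> where \<Lambda>: "coupling n \<mu> \<mu>' \<Lambda>" and le: "cost n \<Lambda> < Inf C + \<gamma>"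
    unfolding C_def by blast
  interpret config_coupling n \<rho> \<mu> \<mu>' \<Lambda> using st st' \<Lambda> by unfold_locales
  have "Inf C \<le> cost n (couple_step n \<Lambda>)"
    using coupling_couple_step by (intro cInf_lower C_bdd) (auto simp: C_def)
  then have sum: "(\<Sum>i\<in>{1..n}. mean_loss i) < \<gamma>" using le by (simp add: cost_couple_step)
  have loss: "mean_loss i < \<gamma>" if "i \<in> {1..n}" for i
    using member_le_sum[OF that, of mean_loss] mean_loss_nonneg sum by auto
  have "(\<integral>p. \<bar>fst p i 0 - snd p i 0\<bar> \<partial>\<Lambda>) \<le> 7 * \<delta>" if i: "i \<in> {1..n}" for i
  proof -
    have "exp (2 * real m) * mean_loss i \<le> \<delta>"
      using mult_left_mono[OF less_imp_le[OF loss[OF i]], of "exp (2 * real m)"] \<gamma>(2) by simp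
    then show ?thesis
      using component_bound[OF i, of "real m" N] N[OF i] m[OF i] by linarith
  qed
  then have "cost n \<Lambda> \<le> (\<Sum>i\<in>{1..n}. 7 * \<delta>)" unfolding cost_def by (intro sum_mono) auto
  also have "\<dots> = real n * (7 * \<delta>)" by simp
  also have "\<dots> < (real n + 1) * (7 * \<delta>)" using \<delta> by simp
  also have "\<dots> = \<epsilon>" by (simp add: \<delta>_def add_pos_nonneg divide_simps)
  finally show ?thesis using \<Lambda> by blast
qed

text \<open>A Lipschitz approximation, with constant \<open>m\<close>, to the indicator of a closed
  set. The empty set is treated apart because \<open>infdist\<close> to it is 0, which would yield
  the value 1 everywhere.\<close>

definition bump :: "real set \<Rightarrow> nat \<Rightarrow> real \<Rightarrow> real" where
  "bump A m x = (if A = {} then 0 else max 0 (1 - real m * infdist x A))"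

lemma bump_bounds: "0 \<le> bump A m x" "bump A m x \<le> 1"
  by (auto simp: bump_def infdist_nonneg)

lemma bump_lipschitz: "\<bar>bump A m x - bump A m y\<bar> \<le> real m * \<bar>x - y\<bar>"
proof -
  have "\<bar>infdist x A - infdist y A\<bar> \<le> \<bar>x - y\<bar>"
    using infdist_triangle[of x A y] infdist_triangle[of y A x]
      by (simp add: dist_real_def abs_minus_commute)
  then have "real m * \<bar>infdist x A - infdist y A\<bar> \<le> real m * \<bar>x - y\<bar>" by (rule mult_left_mono) simp
  moreover have "\<bar>max 0 (1 - a) - max 0 (1 - b)\<bar> \<le> \<bar>a - b\<bar>" for a b :: real by linarith
  from this[of "real m * infdist x A" "real m * infdist y A"]
  have "\<bar>max 0 (1 - real m * infdist x A) - max 0 (1 - real m * infdist y A)\<bar> \<le> real m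
      * \<bar>infdist x A - infdist y A\<bar>"
    by (simp add: abs_mult flip: right_diff_distrib)
  ultimately show ?thesis by (auto simp: bump_def)
qed

lemma bump_measurable [measurable]: "bump A m \<in> borel_measurable borel"
proof (cases "A = {}")
  case False
  have [measurable]: "(\<lambda>x. infdist x A) \<in> borel_measurable borel"
    by (intro borel_measurable_continuous_onI continuous_on_infdist continuous_on_id)
  show ?thesis unfolding bump_def[abs_def] using False by simp
qed (simp add: bump_def[abs_def])

lemma bump_tendsto:
  assumes "closed A"
  shows "(\<lambda>m. bump A m x) \<longlonglongrightarrow> indicator A x"
proof (cases "x \<in> A")
  case True
  then have "bump A m x = 1" for m by (auto simp: bump_def)
  with True show ?thesis by simp
next
  case False
  have "\<forall>\<^sub>F m in sequentially. bump A m x = 0"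
  proof (cases "A = {}")
    case False
    with assms \<open>x \<notin> A\<close> have pos: "0 < infdist x A"
      using in_closed_iff_infdist_zero[of A x] infdist_nonneg[of x A] by force
    obtain k :: nat where "1 / infdist x A \<le> real k" using real_arch_simple by blast
    then have k: "1 \<le> real k * infdist x A" using pos by (simp add: field_simps)
    have "bump A m x = 0" if "k \<le> m" for m
    proof -
      have "real k * infdist x A \<le> real m * infdist x A" using that pos by simp
      with k show ?thesis by (simp add: bump_def)
    qed
    then show ?thesis unfolding eventually_sequentially by blast
  qed (simp add: bump_def)
  then show ?thesis using False by (simp add: tendsto_eventually)
qed

text \<open>Under a coupling, the expectations of a Lipschitz function of finitely many coordinates
  differ by at most a constant times the cost, and the cost can be made arbitrarily small. Products
  of bumps then identify the two measures on closed cylinders.\<close>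

theorem stationary_unique:
  assumes st: "stationary n \<rho> \<mu>" and st': "stationary n \<rho> \<mu>'"
  shows "\<mu> = \<mu>'"
proof (rule measure_eqI_cylinder[where J = "{1..n} \<times> UNIV" and X =
    "\<lambda>j \<eta>. \<eta> (fst j) (snd j :: int)"])
  have p: "prob_space \<mu>" "prob_space \<mu>'" and s: "sets \<mu> = sets (config_space n)"
      "sets \<mu>' = sets (config_space n)"
    using assms by (auto simp: stationary_def prob_on_states_def)
  interpret M: prob_space \<mu> by fact
  interpret M': prob_space \<mu>' by fact
  have space: "space \<mu> = space (config_space n)" "space \<mu>' = space (config_space n)"
    using s by (auto dest: sets_eq_imp_space_eq)
  show "finite_measure \<mu>" by unfold_locales
  show "sets \<mu>' = sets \<mu>" by (simp add: s)
  let ?X = "\<lambda>j \<eta>. \<eta> (fst j) (snd j :: int)"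
  have Xc: "?X j \<in> borel_measurable (config_space n)" if "j \<in> {1..n} \<times> UNIV" for j
    using that by (intro measurable_compose[OF measurable_config_component[where f = "\<lambda>\<eta>. \<eta>"
        and n = n]]) auto
  then show "?X j \<in> borel_measurable \<mu>" if "j \<in> {1..n} \<times> UNIV" for j
    using that by (simp add: measurable_cong_sets[OF s(1) refl])
  show "(\<lambda>x. x) \<in> M' \<rightarrow>\<^sub>M \<mu>"
    if sp: "space M' = space \<mu>" and X: "\<And>j. j \<in> {1..n} \<times> UNIV \<Longrightarrow> ?X j \<in> borel_measurable M'" for M'
  proof -
    have "(\<lambda>x. \<lambda>i\<in>{1..n}. x i) \<in> M' \<rightarrow>\<^sub>M config_space n"
      using X[of "(_, _)"] by (intro measurable_configI measurable_seqI) auto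
    moreover have "(\<lambda>i\<in>{1..n}. x i) = x" if "x \<in> space M'" for x
      using that by (simp add: sp space space_config extensional_restrict)
    ultimately have "(\<lambda>x. x) \<in> M' \<rightarrow>\<^sub>M config_space n" by (subst measurable_cong[symmetric]) auto
    then show ?thesis by (simp add: measurable_cong_sets[OF refl s(1)])
  qed
  fix S :: "(nat \<times> int) set" and A :: "nat \<times> int \<Rightarrow> real set"
  assume fin: "finite S" and SJ: "S \<subseteq> {1..n} \<times> UNIV" and cl: "\<And>j. closed (A j)"
  define f where "f m \<eta> = (\<Prod>j\<in>S. bump (A j) m (?X j \<eta>))" for m \<eta>
  have XS: "?X j \<in> borel_measurable (config_space n)" if "j \<in> S" for j using that SJ
    by (intro Xc) auto
  have fm: "f m \<in> borel_measurable (config_space n)" for m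
    unfolding f_def by (intro borel_measurable_prod measurable_compose[OF XS bump_measurable])
  have f01: "0 \<le> f m \<eta>" "f m \<eta> \<le> 1" for m \<eta>
    unfolding f_def by (auto intro!: prod_nonneg prod_le_1 simp: bump_bounds)
  have f_lip: "\<bar>f m \<eta> - f m \<eta>'\<bar> \<le> (\<Sum>j\<in>S. real m * \<bar>?X j \<eta> - ?X j \<eta>'\<bar>)" for m \<eta> \<eta>'
  proof -
    have "\<bar>f m \<eta> - f m \<eta>'\<bar> \<le> (\<Sum>j\<in>S. \<bar>bump (A j) m (?X j \<eta>) - bump (A j) m (?X j \<eta>')\<bar>)"
      \<comment> \<open>All factors lie between 0 and 1, so replacing them one after another bounds
        the difference of the products by the sum of the differences.\<close>
      unfolding f_def real_norm_def[symmetric] by (rule norm_prod_diff) (auto simp: bump_bounds)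
    also have "\<dots> \<le> (\<Sum>j\<in>S. real m * \<bar>?X j \<eta> - ?X j \<eta>'\<bar>)" by (intro sum_mono bump_lipschitz)
    finally show ?thesis .
  qed
  have eq: "(\<integral>\<eta>. f m \<eta> \<partial>\<mu>) = (\<integral>\<eta>. f m \<eta> \<partial>\<mu>')" for m
  proof (rule ccontr)
    assume ne: "(\<integral>\<eta>. f m \<eta> \<partial>\<mu>) \<noteq> (\<integral>\<eta>. f m \<eta> \<partial>\<mu>')"
    define D where "D = \<bar>(\<integral>\<eta>. f m \<eta> \<partial>\<mu>) - (\<integral>\<eta>. f m \<eta> \<partial>\<mu>')\<bar>"
    define c where "c = real m * real (card S) + 1"
    have D: "0 < D" using ne by (simp add: D_def)
    have c: "0 < c" by (simp add: c_def add_nonneg_pos)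
    obtain \<Lambda> where \<Lambda>: "coupling n \<mu> \<mu>' \<Lambda>" and small: "cost n \<Lambda> < D / c"
      using small_coupling[OF st st', of "D / c"] D c by auto
    interpret config_coupling n \<rho> \<mu> \<mu>' \<Lambda> using st st' \<Lambda> by unfold_locales
    have i: "integrable \<Lambda> (\<lambda>p. f m (fst p))" "integrable \<Lambda> (\<lambda>p. f m (snd p))"
      using measurable_compose[OF fst_\<Lambda> fm] measurable_compose[OF snd_\<Lambda> fm] f01
      by (auto intro!: L.integrable_const_bound[where B = 1])
    have "(\<integral>\<eta>. f m \<eta> \<partial>\<mu>) - (\<integral>\<eta>. f m \<eta> \<partial>\<mu>') = (\<integral>p. f m (fst p) - f m (snd p) \<partial>\<Lambda>)"
      unfolding Bochner_Integration.integral_diff[OF i]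
      using integral_distr[OF fst_\<Lambda> fm] integral_distr[OF snd_\<Lambda> fm]
        by (simp add: distr_fst distr_snd)
    then have "D \<le> (\<integral>p. \<bar>f m (fst p) - f m (snd p)\<bar> \<partial>\<Lambda>)"
      unfolding D_def by simp
    also have "\<dots> \<le> (\<integral>p. (\<Sum>j\<in>S. real m * \<bar>?X j (fst p) - ?X j (snd p)\<bar>) \<partial>\<Lambda>)"
      using i SJ by (intro integral_mono f_lip integrable_abs Bochner_Integration.integrable_diff
        Bochner_Integration.integrable_sum integrable_mult_right dist_le_cost(2)) auto
    also have "\<dots> = (\<Sum>j\<in>S. real m * (\<integral>p. \<bar>?X j (fst p) - ?X j (snd p)\<bar> \<partial>\<Lambda>))"
      using SJ by (subst Bochner_Integration.integral_sum) (auto intro!: integrable_mult_right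
          dist_le_cost(2))
    also have "\<dots> \<le> (\<Sum>j\<in>S. real m * cost n \<Lambda>)"
      using SJ by (intro sum_mono mult_left_mono dist_le_cost(1)) auto
    also have "\<dots> \<le> c * cost n \<Lambda>" by (simp add: c_def algebra_simps cost_nonneg)
    also have "\<dots> < D" using small c by (simp add: pos_less_divide_eq mult.commute)
    finally show False by simp
  qed
  define B where "B = {\<eta> \<in> space \<mu>. \<forall>j\<in>S. ?X j \<eta> \<in> A j}"
  have B: "B \<in> sets (config_space n)"
  proof -
    have "{\<eta> \<in> space (config_space n). ?X j \<eta> \<in> A j} \<in> sets (config_space n)" if "j \<in> S" for j
      using measurable_sets[OF XS[OF that], of "A j"] cl[of j]
        by (auto simp: vimage_def Int_def conj_commute)
    then show ?thesis unfolding B_def space using fin by (intro sets.sets_Collect_finite_All) auto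
  qed
  have lim: "(\<lambda>m. f m \<eta>) \<longlonglongrightarrow> indicator B \<eta>" if "\<eta> \<in> space \<mu>" for \<eta>
  proof -
    have "(\<lambda>m. f m \<eta>) \<longlonglongrightarrow> (\<Prod>j\<in>S. indicator (A j) (?X j \<eta>))"
      unfolding f_def by (intro tendsto_prod bump_tendsto cl)
    also have "(\<Prod>j\<in>S. indicator (A j) (?X j \<eta>)) = (indicator B \<eta> :: real)"
      using fin that by (auto simp: B_def indicator_def prod_zero_iff)
    finally show ?thesis .
  qed
  have limM: "(\<lambda>m. \<integral>\<eta>. f m \<eta> \<partial>\<nu>) \<longlonglongrightarrow> measure \<nu> B"
    if "prob_space \<nu>" and sn: "sets \<nu> = sets (config_space n)" for \<nu>
  proof -
    interpret N: prob_space \<nu> by fact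
    have sp: "space \<nu> = space \<mu>" using sn space by (auto dest: sets_eq_imp_space_eq)
    have "(\<lambda>m. \<integral>\<eta>. f m \<eta> \<partial>\<nu>) \<longlonglongrightarrow> (\<integral>\<eta>. indicator B \<eta> \<partial>\<nu>)"
    proof (rule integral_dominated_convergence[where w = "\<lambda>_. 1"])
      show "AE \<eta> in \<nu>. (\<lambda>m. f m \<eta>) \<longlonglongrightarrow> indicator B \<eta>"
        using lim by (intro AE_I2) (simp add: sp)
    qed (use fm B f01 in \<open>auto simp: measurable_cong_sets[OF sn refl]\<close>)
    then show ?thesis using B sn by simp
  qed
  have "measure \<mu> B = measure \<mu>' B"
    using limM[OF p(1) s(1)] limM[OF p(2) s(2)] unfolding eq by (rule LIMSEQ_unique)
  then show "emeasure \<mu> {\<eta> \<in> space \<mu>. \<forall>j\<in>S. ?X j \<eta> \<in> A j}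
      = emeasure \<mu>' {\<eta> \<in> space \<mu>. \<forall>j\<in>S. ?X j \<eta> \<in> A j}"
    unfolding B_def[symmetric] by (simp add: M.emeasure_eq_measure M'.emeasure_eq_measure)
qed

lemma stationary_multi_law:
  assumes "\<forall>i. 1 < \<sigma> i" "strict_mono_on {1..m} \<sigma>" "\<forall>i\<in>{1..n}. \<kappa> i \<in> {1..m} \<and> \<sigma> (\<kappa> i) = \<rho> i"
  shows "stationary n \<rho> (multi_law n m \<sigma> \<kappa>)"
proof -
  have \<sigma>: "\<And>i. 1 < \<sigma> i" and \<kappa>: "\<And>i. i \<in> {1..n} \<Longrightarrow> \<kappa> i \<in> {1..m}" using assms by auto
  have "AE \<eta> in multi_law n m \<sigma> \<kappa>. \<forall>i\<in>{1..n}. cesaro (\<eta> i) (\<sigma> (\<kappa> i))"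
    using \<sigma> assms(2) \<kappa> by (rule AE_multi_law_cesaro)
  then have "AE \<eta> in multi_law n m \<sigma> \<kappa>. cesaro (\<eta> i) (\<rho> i)" if "i \<in> {1..n}" for i
    by eventually_elim (use that assms(3) in force)
  moreover have "prob_on_states n (multi_law n m \<sigma> \<kappa>)"
    using \<sigma> assms(2) \<kappa> by (rule prob_on_states_multi_law)
  moreover have "distr (multi_law n m \<sigma> \<kappa>) (config_space n) (translate n 1) = multi_law n m \<sigma> \<kappa>"
    using \<sigma> assms(2) \<kappa> by (rule multi_law_translate)
  moreover have "distr (multi_law n m \<sigma> \<kappa> \<Otimes>\<^sub>M exp_seq 1) (config_space n) (\<lambda>p. step n (fst p) (snd
      p)) = multi_law n m \<sigma> \<kappa>"
    using \<sigma> assms(2) \<kappa> by (rule multi_law_step)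
  moreover have "integrable (multi_law n m \<sigma> \<kappa>) (\<lambda>\<eta>. \<eta> i 0)" if "i \<in> {1..n}" for i
    using \<sigma> assms(2) \<kappa> that by (rule integrable_multi_law)
  ultimately show ?thesis unfolding stationary_def by blast
qed

theorem theorem5p3:
  fixes n :: nat
  assumes "1 \<le> n"
  shows "(\<forall>\<rho> :: nat \<Rightarrow> real. (\<forall>i\<in>{1..n}. 1 < \<rho> i) \<longrightarrow> invariant_measure n (multiclass_measure n \<rho>)) \<and>
    (\<forall>(\<mu> :: config measure) (\<rho> :: nat \<Rightarrow> real).
       prob_on_states n \<mu> \<longrightarrow>
       translation_ergodic n \<mu> \<longrightarrow>
       (\<forall>i\<in>{1..n}. \<forall>k. integrable \<mu> (\<lambda>\<eta>. \<eta> i k) \<and> (\<integral>\<eta>. \<eta> i k \<partial>\<mu>) = \<rho> i) \<longrightarrow>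
       (\<forall>i\<in>{1..n}. 1 < \<rho> i) \<longrightarrow>
       invariant_measure n \<mu> \<longrightarrow>
       \<mu> = multiclass_measure n \<rho>)"
proof (intro conjI allI impI)
  fix \<rho> :: "nat \<Rightarrow> real" assume \<rho>: "\<forall>i\<in>{1..n}. 1 < \<rho> i"
  then obtain m \<sigma> \<kappa> where law: "\<forall>i. 1 < \<sigma> i" "strict_mono_on {1..m} \<sigma>"
    "\<forall>i\<in>{1..n}. \<kappa> i \<in> {1..m} \<and> \<sigma> (\<kappa> i) = \<rho> i" "multiclass_measure n \<rho> = multi_law n m \<sigma> \<kappa>"
    using multiclass_measure_multi_law[OF assms, of \<rho>] by blast
  then show "invariant_measure n (multiclass_measure n \<rho>)"
    using invariant_multi_law[of \<sigma> m n \<kappa>] by auto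
next
  fix \<mu> :: "config measure" and \<rho> :: "nat \<Rightarrow> real"
  assume \<mu>: "prob_on_states n \<mu>" and erg: "translation_ergodic n \<mu>"
    and int: "\<forall>i\<in>{1..n}. \<forall>k. integrable \<mu> (\<lambda>\<eta>. \<eta> i k) \<and> (\<integral>\<eta>. \<eta> i k \<partial>\<mu>) = \<rho> i"
    and \<rho>: "\<forall>i\<in>{1..n}. 1 < \<rho> i" and inv: "invariant_measure n \<mu>"
  obtain m \<sigma> \<kappa> where law: "\<forall>i. 1 < \<sigma> i" "strict_mono_on {1..m} \<sigma>"
    "\<forall>i\<in>{1..n}. \<kappa> i \<in> {1..m} \<and> \<sigma> (\<kappa> i) = \<rho> i" "multiclass_measure n \<rho> = multi_law n m \<sigma> \<kappa>"
    using multiclass_measure_multi_law[OF assms, of \<rho>] \<rho> by blast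
  have "distr (\<mu> \<Otimes>\<^sub>M exp_seq 1) (config_space n) (\<lambda>p. step n (fst p) (snd p)) = \<mu>"
    using inv \<mu> distr_chain_space[of \<mu> n] by (simp add: invariant_measure_def prob_on_states_def)
  moreover have "distr \<mu> (config_space n) (translate n 1) = \<mu>"
    using erg by (simp add: translation_ergodic_def)
  \<comment> \<open>The 0-1 part of ergodicity enters here: it turns the averages granted by the
    state space into the prescribed means.\<close>
  moreover have "AE \<eta> in \<mu>. cesaro (\<eta> i) (\<rho> i)" if "i \<in> {1..n}" for i
    using ergodic_cesaro[OF \<mu> erg that] int that by simp
  ultimately have "stationary n \<rho> \<mu>" unfolding stationary_def using \<mu> int by blast
  then show "\<mu> = multiclass_measure n \<rho>"
    unfolding law(4) using stationary_unique[OF _ stationary_multi_law[OF law(1-3)]] by blast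
qed

end
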